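(* Let $1\le k\le n$ and let $d\ge1$. Let $id_Y=(2<3<\dots<k<k+1)\in W^P$. Then $$\Gamma_d(X(id_Y))=X\big(id_Y\cdot_k O^\circ(d)\big).$$
   Context: **Geometry.** For $1\le i\le 2n+2$ put $\bar i=2n+3-i$. Let $\widetilde E=\mathbb{C}^{2n+2}$ with basis $e_1,\dots,e_{2n+2}$ and symplectic form with $\widetilde\omega(e_i,e_j)=\delta_{i,\bar j}$ for $i\le j$; $E=\langle e_1,\dots,e_{2n+1}\rangle$, $\omega=\widetilde\omega|_E$. $X=\mathrm{IG}(k,2n+1)$ is the variety of $k$-dimensional $\omega$-isotropic subspaces of $E$; $H_2(X,\mathbb{Z})\cong\mathbb{Z}$. $\mathrm{Sp}_{2n+1}\subset\mathrm{GL}(E)$ is the group preserving $\omega$ and $B$ its subgroup of upper triangular matrices. **Weyl group.** $W$ is the group of permutations $w$ of $\{1,\dots,2n+2\}$ with $w(\bar i)=\overline{w(i)}$, with simple reflections $s_i$ ($1\le i\le n$, exchanging $i,i+1$ and $\bar i,\overline{i+1}$) and $s_{n+1}$ (exchanging $n+1$ and $\overline{n+1}$), and length $\ell$. $W_P=\langle s_j:j\ne k\rangle$; $W^P$ is the set of minimal length representatives of $W/W_P$: those $w$ with $w(1)<\dots<w(k)$ and $w(k+1)<\dots<w(n+1)\le n+1$, written as sequences $(w(1)<\dots<w(k))$. $W^{odd}=\{w\in W: w(j)\ne\bar1,\ 1\le j\le n+1\}$ and $W^\circ=\{w\in W^{odd}:w(j)\ne1,\ 1\le j\le k\}$. For $w\in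 W^{odd}$, $X(w)$ is the closure of the $B$-orbit of $\langle e_{w(1)},\dots,e_{w(k)}\rangle$ (it depends only on $wW_P$). **Modified Hecke product.** $w\cdot_k s_i=ws_i$ if $\ell(ws_i)>\ell(w)$ or $i=k$, and $w\cdot_k s_i=w$ otherwise. $O^\circ(1)=s_1s_2\cdots s_{n+1}\cdots s_2s_1$; $w\cdot_k O^\circ(1)$ is obtained by applying $\cdot_k$ successively with the letters of this word from left to right. $O^\circ(d)=O^\circ(d-1)\cdot_kO^\circ(1)$ for $d>1$, i.e. $w\cdot_kO^\circ(d)$ is obtained by applying this $d$ times. **Curve neighborhoods.** For a closed $\Omega\subset X$, $\Gamma_d(\Omega)=\mathrm{ev}_2(\mathrm{ev}_1^{-1}(\Omega))$ with reduced structure, where $\mathrm{ev}_1,\mathrm{ev}_2:\overline{\mathcal M}_{0,2}(X,d)\to X$ are the evaluation maps on the moduli space of genus 0 degree $d$ two-pointed stable maps. *)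

theory Defs
  imports
    Complex_Main
    "HOL-Library.Function_Algebras"
    "HOL-Library.Poly_Mapping"
    "HOL-Combinatorics.Permutations"
    "Jordan_Normal_Form.Determinant"
begin

section \<open>The odd symplectic space\<close>

definition bar :: "nat \<Rightarrow> nat \<Rightarrow> nat" where
  "bar n i = 2 * n + 3 - i"

text \<open>
  Vectors are functions \<open>v :: nat \<Rightarrow> complex\<close>, \<open>v i\<close> being the coordinate at the basis vector
  \<open>e\<^sub>i\<close> (\<open>i \<ge> 1\<close>). Linear algebra is that of the library locale \<^locale>\<open>vector_space\<close>,
  for the pointwise scaling.
\<close>

type_synonym cvec = "nat \<Rightarrow> complex"

definition cscale :: "complex \<Rightarrow> cvec \<Rightarrow> cvec" where
  "cscale c v = (\<lambda>i. c * v i)"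

global_interpretation cv: vector_space cscale
  by unfold_locales (auto simp: cscale_def fun_eq_iff algebra_simps)

definition basis_vec :: "nat \<Rightarrow> cvec" where
  "basis_vec j = (\<lambda>i. if i = j then 1 else 0)"

definition E_tilde :: "nat \<Rightarrow> cvec set" where
  "E_tilde n = cv.span (basis_vec ` {1..2 * n + 2})"

definition E_odd :: "nat \<Rightarrow> cvec set" where
  "E_odd n = cv.span (basis_vec ` {1..2 * n + 1})"

text \<open>
  The skew-symmetric form on \<open>E_tilde n\<close> with \<open>\<omega>(e\<^sub>i, e\<^sub>j) = \<delta>\<close> of \<open>i\<close> and \<open>bar j\<close>
  for \<open>i \<le> j\<close>. Its restriction to \<open>E_odd n\<close> is the degenerate form on the odd
  dimensional space.
\<close>

definition omega :: "nat \<Rightarrow> cvec \<Rightarrow> cvec \<Rightarrow> complex" where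
  "omega n v w = (\<Sum>i = 1..n + 1. v i * w (bar n i) - v (bar n i) * w i)"

lemma omega_basis_vec:
  assumes "1 \<le> i" "i \<le> j" "j \<le> 2 * n + 2"
  shows "omega n (basis_vec i) (basis_vec j) = (if i = bar n j then 1 else 0)"
    and "omega n (basis_vec j) (basis_vec i) = (if i = bar n j then - 1 else 0)"
proof -
  have A: "basis_vec i a * basis_vec j (bar n a) - basis_vec i (bar n a) * basis_vec j a =
      (if a = i then (if i = bar n j then 1 else 0) else 0)"
    if "a \<in> {1..n + 1}" for a
    using that assms by (auto simp: basis_vec_def bar_def)
  have B: "i \<in> {1..n + 1}" if "i = bar n j"
    using that assms by (auto simp: bar_def)
  have S: "omega n (basis_vec i) (basis_vec j) =
      (\<Sum>a = 1..n + 1. if a = i then (if i = bar n j then 1 else 0) else 0)"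
    unfolding omega_def by (rule sum.cong[OF refl]) (rule A)
  then show 1: "omega n (basis_vec i) (basis_vec j) = (if i = bar n j then 1 else 0)"
    using B by (subst S, subst sum.delta) auto
  have "omega n (basis_vec j) (basis_vec i) = - omega n (basis_vec i) (basis_vec j)"
    unfolding omega_def sum_negf[symmetric] by (rule sum.cong[OF refl]) (simp add: mult.commute)
  then show "omega n (basis_vec j) (basis_vec i) = (if i = bar n j then - 1 else 0)"
    using 1 by simp
qed

section \<open>The odd symplectic Grassmannian\<close>

definition IG :: "nat \<Rightarrow> nat \<Rightarrow> cvec set set" where
  "IG n k = {V. cv.subspace V \<and> V \<subseteq> E_odd n \<and> cv.dim V = k \<and>
                (\<forall>v\<in>V. \<forall>w\<in>V. omega n v w = 0)}"

text \<open>
  The maximal minor of the \<open>k \<times> (2 n + 1)\<close> matrix with rows \<open>b 0, \<dots>, b (k - 1)\<close>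
  on the columns in \<open>I\<close>, taken in increasing order.
\<close>

definition minor :: "nat \<Rightarrow> (nat \<Rightarrow> cvec) \<Rightarrow> nat set \<Rightarrow> complex" where
  "minor k b I = det (mat k k (\<lambda>(a, c). b a (sorted_list_of_set I ! c)))"

text \<open>
  \<open>plucker n k V p\<close>: the vector \<open>p\<close>, indexed by the \<open>k\<close>-subsets of \<open>{1..2 n + 1}\<close>, represents
  the image of \<open>V\<close> under the Pluecker embedding. It is determined by \<open>V\<close> up to a
  nonzero scalar (the choice of a basis of \<open>V\<close>), and is never the zero vector.
\<close>

definition plucker :: "nat \<Rightarrow> nat \<Rightarrow> cvec set \<Rightarrow> (nat set \<Rightarrow> complex) \<Rightarrow> bool" where
  "plucker n k V p \<longleftrightarrow>
     (\<exists>b. inj_on b {..<k} \<and> cv.independent (b ` {..<k}) \<and> cv.span (b ` {..<k}) = V \<and>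
          p = (\<lambda>I. if I \<subseteq> {1..2 * n + 1} \<and> card I = k then minor k b I else 0))"

text \<open>Polynomials in variables of type \<open>'v\<close>: finitely supported maps from monomials.\<close>

type_synonym 'v cpoly = "('v \<Rightarrow>\<^sub>0 nat) \<Rightarrow>\<^sub>0 complex"

definition eval_poly :: "'v cpoly \<Rightarrow> ('v \<Rightarrow> complex) \<Rightarrow> complex" where
  "eval_poly f p = (\<Sum>m\<in>Poly_Mapping.keys f.
     Poly_Mapping.lookup f m * (\<Prod>x\<in>Poly_Mapping.keys m. p x ^ Poly_Mapping.lookup m x))"

definition homogeneous :: "'v cpoly \<Rightarrow> bool" where
  "homogeneous f \<longleftrightarrow> (\<exists>r. \<forall>m\<in>Poly_Mapping.keys f.
     (\<Sum>x\<in>Poly_Mapping.keys m. Poly_Mapping.lookup m x) = r)"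

text \<open>Zariski closed subsets of the projective variety \<open>IG n k\<close>.\<close>

definition zariski_closed :: "nat \<Rightarrow> nat \<Rightarrow> cvec set set \<Rightarrow> bool" where
  "zariski_closed n k Z \<longleftrightarrow>
     (\<exists>F :: nat set cpoly set. (\<forall>f\<in>F. homogeneous f) \<and>
        Z = {V \<in> IG n k. \<forall>p. plucker n k V p \<longrightarrow> (\<forall>f\<in>F. eval_poly f p = 0)})"

text \<open>
  Elements of the groups are linear maps on the space of all coordinate functions; only their
  restriction to \<open>E_odd n\<close> matters, and every linear automorphism of \<open>E_odd n\<close> extends.
\<close>

definition Sp_odd :: "nat \<Rightarrow> (cvec \<Rightarrow> cvec) set" where
  "Sp_odd n = {g. Vector_Spaces.linear cscale cscale g \<and> bij_betw g (E_odd n) (E_odd n) \<and>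
                  (\<forall>v\<in>E_odd n. \<forall>w\<in>E_odd n. omega n (g v) (g w) = omega n v w)}"

definition Borel :: "nat \<Rightarrow> (cvec \<Rightarrow> cvec) set" where
  "Borel n = {g \<in> Sp_odd n. \<forall>j\<in>{1..2 * n + 1}. \<forall>i>j. g (basis_vec j) i = 0}"

text \<open>
  Used for \<open>w\<close> in \<open>Weyl_odd n\<close> (below), where the coordinate subspace lies in \<open>E_odd n\<close>;
  if that subspace is isotropic, the orbit lies in \<open>IG n k\<close>.
\<close>

definition schubert_variety :: "nat \<Rightarrow> nat \<Rightarrow> (nat \<Rightarrow> nat) \<Rightarrow> cvec set set" where
  "schubert_variety n k w =
     zariski_closed n k hull ((\<lambda>g. g ` cv.span ((\<lambda>j. basis_vec (w j)) ` {1..k})) ` Borel n)"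

section \<open>The Weyl group\<close>

definition Weyl :: "nat \<Rightarrow> (nat \<Rightarrow> nat) set" where
  "Weyl n = {w. w permutes {1..2 * n + 2} \<and> (\<forall>i\<in>{1..2 * n + 2}. w (bar n i) = bar n (w i))}"

definition Weyl_odd :: "nat \<Rightarrow> (nat \<Rightarrow> nat) set" where
  "Weyl_odd n = {w \<in> Weyl n. \<forall>j\<in>{1..n + 1}. w j \<noteq> bar n 1}"

definition simple_refl :: "nat \<Rightarrow> nat \<Rightarrow> nat \<Rightarrow> nat" where
  "simple_refl n i =
     (if i \<le> n
      then Transposition.transpose i (i + 1) \<circ> Transposition.transpose (bar n i) (bar n (i + 1))
      else Transposition.transpose (n + 1) (bar n (n + 1)))"

definition word_prod :: "nat \<Rightarrow> nat list \<Rightarrow> nat \<Rightarrow> nat" where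
  "word_prod n is = foldr (\<lambda>i w. simple_refl n i \<circ> w) is id"

definition weyl_length :: "nat \<Rightarrow> (nat \<Rightarrow> nat) \<Rightarrow> nat" where
  "weyl_length n w =
     (LEAST m. \<exists>is. length is = m \<and> set is \<subseteq> {1..n + 1} \<and> word_prod n is = w)"

text \<open>
  The set \<open>W\<^sup>P\<close> of minimal length representatives of the cosets of \<open>W\<^sub>P\<close>, by its usual
  one-line description; together with the last condition, monotonicity gives
  \<open>w (k + 1) < \<dots> < w (n + 1) \<le> n + 1\<close>.
\<close>

definition min_reps :: "nat \<Rightarrow> nat \<Rightarrow> (nat \<Rightarrow> nat) set" where
  "min_reps n k = {w \<in> Weyl n. strict_mono_on {1..k} w \<and> strict_mono_on {k + 1..n + 1} w \<and>
                                w (n + 1) \<le> n + 1}"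

section \<open>The modified Hecke product\<close>

definition hecke :: "nat \<Rightarrow> nat \<Rightarrow> (nat \<Rightarrow> nat) \<Rightarrow> nat \<Rightarrow> (nat \<Rightarrow> nat)" where
  "hecke n k w i =
     (if weyl_length n (w \<circ> simple_refl n i) > weyl_length n w \<or> i = k
      then w \<circ> simple_refl n i else w)"

definition hecke_O1 :: "nat \<Rightarrow> nat \<Rightarrow> (nat \<Rightarrow> nat) \<Rightarrow> (nat \<Rightarrow> nat)" where
  "hecke_O1 n k w = foldl (hecke n k) w ([1..<n + 2] @ rev [1..<n + 1])"

definition hecke_O :: "nat \<Rightarrow> nat \<Rightarrow> nat \<Rightarrow> (nat \<Rightarrow> nat) \<Rightarrow> (nat \<Rightarrow> nat)" where
  "hecke_O n k d w = (hecke_O1 n k ^^ d) w"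

section \<open>Genus 0 stable maps and curve neighborhoods\<close>

definition proportional :: "complex \<times> complex \<Rightarrow> complex \<times> complex \<Rightarrow> bool" where
  "proportional x y \<longleftrightarrow> x \<noteq> (0, 0) \<and> (\<exists>c. c \<noteq> 0 \<and> y = (c * fst x, c * snd x))"

quotient_type P1 = "complex \<times> complex" / partial: proportional
proof (rule part_equivpI)
  show "\<exists>x. proportional x x"
    by (rule exI[of _ "(1, 0)"]) (auto simp: proportional_def intro!: exI[of _ 1])
  show "symp proportional"
  proof (rule sympI)
    fix x y assume "proportional x y"
    then obtain c where "x \<noteq> (0, 0)" "c \<noteq> 0" "y = (c * fst x, c * snd x)"
      by (auto simp: proportional_def)
    then show "proportional y x"
      unfolding proportional_def
      by (intro conjI exI[of _ "inverse c"]) (auto simp: prod_eq_iff)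
  qed
  show "transp proportional"
  proof (rule transpI)
    fix x y z assume "proportional x y" "proportional y z"
    then obtain c c' where "x \<noteq> (0, 0)" "c \<noteq> 0" "y = (c * fst x, c * snd x)"
      "c' \<noteq> 0" "z = (c' * fst y, c' * snd y)"
      unfolding proportional_def by blast
    then show "proportional x z"
      unfolding proportional_def by (intro conjI exI[of _ "c' * c"]) auto
  qed
qed

text \<open>
  A morphism from \<open>P1\<close> to \<open>IG n k\<close> of degree \<open>e\<close>: in Pluecker coordinates it is given by binary
  forms of degree \<open>e\<close> without common zero (automatic, as \<open>plucker\<close> excludes the zero vector).
  The identification of the second homology group with the integers sends the class of a line in
  the Pluecker embedding to \<open>1\<close>, so \<open>e\<close> is the class of the push-forward of the
  fundamental class of \<open>P1\<close>.
\<close>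

definition P1_morphism :: "nat \<Rightarrow> nat \<Rightarrow> nat \<Rightarrow> (P1 \<Rightarrow> cvec set) \<Rightarrow> bool" where
  "P1_morphism n k e f \<longleftrightarrow> range f \<subseteq> IG n k \<and>
     (\<exists>c :: nat set \<Rightarrow> nat \<Rightarrow> complex. \<forall>s t. (s, t) \<noteq> (0, 0) \<longrightarrow>
        plucker n k (f (abs_P1 (s, t))) (\<lambda>I. \<Sum>i\<le>e. c I i * s ^ i * t ^ (e - i)))"

text \<open>
  A connected nodal curve of arithmetic genus 0 is a tree of projective lines.
  \<open>node C u v\<close> is the point of the component \<open>u\<close> that is glued to \<open>node C v u\<close> on \<open>v\<close>;
  \<open>edges C\<close> contains both orientations of each edge of the dual graph.
\<close>

record map_data =
  comps :: "nat set"
  edges :: "(nat \<times> nat) set"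
  node :: "nat \<Rightarrow> nat \<Rightarrow> P1"
  mark1 :: "nat \<times> P1"
  mark2 :: "nat \<times> P1"
  comp_map :: "nat \<Rightarrow> P1 \<Rightarrow> cvec set"

definition dual_tree :: "map_data \<Rightarrow> bool" where
  "dual_tree C \<longleftrightarrow> finite (comps C) \<and> comps C \<noteq> {} \<and>
     edges C \<subseteq> comps C \<times> comps C \<and> sym (edges C) \<and> irrefl (edges C) \<and>
     (\<forall>u\<in>comps C. \<forall>v\<in>comps C. (u, v) \<in> (edges C)\<^sup>*) \<and>
     card (edges C) = 2 * (card (comps C) - 1)"

definition nodes_on :: "map_data \<Rightarrow> nat \<Rightarrow> P1 set" where
  "nodes_on C u = {node C u v | v. (u, v) \<in> edges C}"

definition special_points :: "map_data \<Rightarrow> nat \<Rightarrow> P1 set" where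
  "special_points C u = nodes_on C u \<union> {x. mark1 C = (u, x) \<or> mark2 C = (u, x)}"

definition pointed_genus0_curve :: "map_data \<Rightarrow> bool" where
  "pointed_genus0_curve C \<longleftrightarrow> dual_tree C \<and>
     (\<forall>u. inj_on (node C u) {v. (u, v) \<in> edges C}) \<and>
     fst (mark1 C) \<in> comps C \<and> snd (mark1 C) \<notin> nodes_on C (fst (mark1 C)) \<and>
     fst (mark2 C) \<in> comps C \<and> snd (mark2 C) \<notin> nodes_on C (fst (mark2 C)) \<and>
     mark1 C \<noteq> mark2 C"

text \<open>
  \<open>stable_map n k d C\<close>: \<open>C\<close> is a genus 0, degree \<open>d\<close>, two-pointed stable map to \<open>IG n k\<close>,
  i.e. represents a closed point of the moduli space of stable maps.
\<close>

definition stable_map :: "nat \<Rightarrow> nat \<Rightarrow> nat \<Rightarrow> map_data \<Rightarrow> bool" where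
  "stable_map n k d C \<longleftrightarrow> pointed_genus0_curve C \<and>
     (\<exists>e. (\<forall>u\<in>comps C. P1_morphism n k (e u) (comp_map C u)) \<and> (\<Sum>u\<in>comps C. e u) = d) \<and>
     (\<forall>(u, v)\<in>edges C. comp_map C u (node C u v) = comp_map C v (node C v u)) \<and>
     (\<forall>u\<in>comps C. (\<exists>V. \<forall>x. comp_map C u x = V) \<longrightarrow> 3 \<le> card (special_points C u))"

definition ev1 :: "map_data \<Rightarrow> cvec set" where
  "ev1 C = comp_map C (fst (mark1 C)) (snd (mark1 C))"

definition ev2 :: "map_data \<Rightarrow> cvec set" where
  "ev2 C = comp_map C (fst (mark2 C)) (snd (mark2 C))"

text \<open>
  With the reduced structure, a closed subvariety is its set of closed points. Isomorphic
  stable maps have the same values under \<open>ev1\<close> and \<open>ev2\<close>, so one need not pass to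
  isomorphism classes.
\<close>

definition curve_nbhd :: "nat \<Rightarrow> nat \<Rightarrow> nat \<Rightarrow> cvec set set \<Rightarrow> cvec set set" where
  "curve_nbhd n k d \<Omega> = ev2 ` {C. stable_map n k d C \<and> ev1 C \<in> \<Omega>}"

section \<open>The element \<open>id\<^sub>Y\<close>\<close>

text \<open>The sequence \<open>(2 < 3 < \<dots> < k + 1)\<close> denotes exactly one element of \<open>W\<^sup>P\<close>.\<close>

definition is_id_Y :: "nat \<Rightarrow> nat \<Rightarrow> (nat \<Rightarrow> nat) \<Rightarrow> bool" where
  "is_id_Y n k w \<longleftrightarrow> w \<in> min_reps n k \<and> (\<forall>i\<in>{1..k}. w i = i + 1)"

lemma ex1_is_id_Y:
  assumes "1 \<le> k" "k \<le> n"
  shows "\<exists>!w. is_id_Y n k w"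
proof (rule ex_ex1I)
  define w where "w = (\<lambda>i. if 1 \<le> i \<and> i \<le> k then i + 1 else if i = k + 1 then 1
     else if i + k = 2 * n + 2 then 2 * n + 2
     else if 2 * n + 2 < i + k \<and> i \<le> 2 * n + 2 then i - 1 else i)"
  have inj: "inj_on w {1..2 * n + 2}"
  proof (rule inj_on_inverseI)
    define w' where "w' = (\<lambda>j. if 2 \<le> j \<and> j \<le> k + 1 then j - 1 else if j = 1 then k + 1
       else if j = 2 * n + 2 then 2 * n + 2 - k
       else if 2 * n + 2 \<le> j + k \<and> j \<le> 2 * n + 1 then j + 1 else j)"
    fix i assume i: "i \<in> {1..2 * n + 2}"
    consider "i \<le> k" | "i = k + 1" | "k + 1 < i" "i + k < 2 * n + 2"
      | "i + k = 2 * n + 2" "k + 1 < i" | "2 * n + 2 < i + k" "k + 1 < i"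
      using assms by linarith
    then show "w' (w i) = i"
      using i assms by cases ((simp add: w_def w'_def; fail) | (simp add: w_def w'_def, arith))+
  qed
  have sub: "w ` {1..2 * n + 2} \<subseteq> {1..2 * n + 2}"
    using assms by (auto simp: w_def)
  have "bij_betw w {1..2 * n + 2} {1..2 * n + 2}"
    unfolding bij_betw_def using inj sub
    by (metis card_image card_subset_eq finite_atLeastAtMost)
  then have "w permutes {1..2 * n + 2}"
    by (rule bij_imp_permutes) (use assms in \<open>auto simp: w_def\<close>)
  moreover have "w (bar n i) = bar n (w i)" if "i \<in> {1..2 * n + 2}" for i
  proof -
    consider "i \<le> k" | "i = k + 1" | "k + 1 < i" "i + k < 2 * n + 2"
      | "i + k = 2 * n + 2" "k + 1 < i" | "2 * n + 2 < i + k" "k + 1 < i"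
      using assms by linarith
    then show ?thesis
      using that assms by cases ((simp add: w_def bar_def; fail) | (simp add: w_def bar_def, arith))+
  qed
  ultimately have "w \<in> Weyl n"
    by (auto simp: Weyl_def)
  then have "is_id_Y n k w"
    using assms by (auto simp: is_id_Y_def min_reps_def strict_mono_on_def w_def)
  then show "\<exists>w. is_id_Y n k w" by (intro exI[of _ w])
next
  fix v w assume v: "is_id_Y n k v" and w: "is_id_Y n k w"
  have img: "u ` {k + 1..n + 1} = {1..n + 1} - {2..k + 1}" if u: "is_id_Y n k u" for u
  proof -
    have W: "u permutes {1..2 * n + 2}" and sm: "strict_mono_on {k + 1..n + 1} u"
      and le: "u (n + 1) \<le> n + 1" and eq: "\<And>i. i \<in> {1..k} \<Longrightarrow> u i = i + 1"
      using u by (auto simp: is_id_Y_def min_reps_def Weyl_def)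
    have "u i \<in> {1..n + 1} - {2..k + 1}" if i: "i \<in> {k + 1..n + 1}" for i
    proof -
      have "u i \<le> u (n + 1)"
        using i sm by (cases "i = n + 1") (auto dest!: strict_mono_onD[of _ u i "n + 1"])
      moreover have "u i \<in> {1..2 * n + 2}"
        using i by (intro permutes_in_image[OF W, THEN iffD2]) auto
      moreover have "u i \<noteq> j" if "j \<in> {2..k + 1}" for j
      proof -
        have "j - 1 \<in> {1..k}" using that by (auto; linarith)
        then have "u (j - 1) = j" "j - 1 \<noteq> i" 
          using that i eq[of "j - 1"] by (simp_all, linarith?)
        then show ?thesis using permutes_inj[OF W] by (metis injD)
      qed
      ultimately show ?thesis using le by auto
    qed
    moreover have "card (u ` {k + 1..n + 1}) = n + 1 - k"
      using permutes_inj_on[OF W] by (subst card_image) auto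
    moreover have "card ({1..n + 1} - {2..k + 1}) = n + 1 - k"
      using assms by (subst card_Diff_subset) auto
    ultimately show ?thesis
      by (intro card_subset_eq) auto
  qed
  have sorted: "sorted (map u [k + 1..<n + 2]) \<and> distinct (map u [k + 1..<n + 2])"
    if u: "is_id_Y n k u" for u
  proof -
    have sm: "strict_mono_on {k + 1..n + 1} u"
      using u by (auto simp: is_id_Y_def min_reps_def)
    have "sorted_wrt (<) (map u [k + 1..<n + 2])"
      unfolding sorted_wrt_map
      by (rule sorted_wrt_mono_rel[OF _ sorted_wrt_upt]) (auto intro!: strict_mono_onD[OF sm])
    then show ?thesis by (simp add: strict_sorted_iff)
  qed
  have ivl: "set [k + 1..<n + 2] = {k + 1..n + 1}" by auto
  have "map v [k + 1..<n + 2] = map w [k + 1..<n + 2]"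
    using sorted[OF v] sorted[OF w] img[OF v] img[OF w]
    by (intro sorted_distinct_set_unique) (auto simp only: set_map ivl)
  then have "v i = w i" if "i \<in> {k + 1..n + 1}" for i
    using that by (metis ivl map_eq_conv)
  moreover have "v i = w i" if "i \<in> {1..k}" for i
    using that v w by (auto simp: is_id_Y_def)
  ultimately have half: "v i = w i" if "i \<in> {1..n + 1}" for i
    using that by (cases "i \<le> k") auto
  have V: "v \<in> Weyl n" and W: "w \<in> Weyl n"
    using v w by (auto simp: is_id_Y_def min_reps_def)
  show "v = w"
  proof
    fix i
    consider "i \<notin> {1..2 * n + 2}" | "i \<in> {1..n + 1}" | "i \<in> {n + 2..2 * n + 2}"
      by force
    then show "v i = w i"
    proof cases
      case 1
      then show ?thesis
        using V W by (auto simp: Weyl_def permutes_def)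
    next
      case 2
      then show ?thesis by (rule half)
    next
      case 3
      then have j: "bar n i \<in> {1..n + 1}" "bar n i \<in> {1..2 * n + 2}" "bar n (bar n i) = i"
        by (auto simp: bar_def)
      then show ?thesis
        using V W half[OF j(1)] unfolding Weyl_def by (metis (mono_tags, lifting) mem_Collect_eq)
    qed
  qed
qed

end

theory Submission
  imports Defs
begin

text \<open>
  Let \<open>F\<close> be the span of the first \<open>k + 1\<close> basis vectors. Both sides of the theorem equal the locus
  \<open>dim (V \<inter> F) \<ge> k - min d k\<close>.

  The Hecke product turns \<open>2 < \<dots> < k + 1\<close> into the coset of
  \<open>m + 2 < \<dots> < k + 1 < 2 n + 2 - m < \<dots> < 2 n + 1\<close> with \<open>m = min d k\<close>. The orbit of the corresponding
  coordinate subspace is the open chart of the locus \<open>dim (V \<inter> F) \<ge> k - m\<close> on which one Pluecker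
  coordinate does not vanish, and every point of the locus is moved into the chart by successive
  one-parameter families, mostly of symplectic transvections; so the Schubert variety is the whole locus.

  A map of degree \<open>e\<close> from the projective line cannot lower \<open>dim (V \<inter> F)\<close> by more than \<open>e\<close>, since
  otherwise a Pluecker coordinate would vanish to an order exceeding its degree; adding up along the
  dual tree gives one inclusion. Conversely, a point of the locus is joined to a subspace of \<open>F\<close> by a
  chain of \<open>d\<close> lines, each of which raises \<open>dim (V \<inter> F)\<close> by one as long as \<open>V\<close> is not contained in \<open>F\<close>.
\<close>

section \<open>Linear algebra in the space of coordinate functions\<close>

text \<open>\<open>F\<close> is isotropic of dimension \<open>k + 1\<close>, one more than the
  dimension of \<open>V\<close>, and this surplus drives both the lines and the degenerations. A
  subspace \<open>H\<close> of \<open>V\<close> imposes only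
  \<open>dim H - dim (H \<inter> F)\<close> conditions on vectors of \<open>F\<close> that are to be
  orthogonal to it, so for the \<open>H\<close> that occur (\<open>V\<close> itself or a suitable
  hyperplane) some vector of \<open>F\<close> is orthogonal to \<open>H\<close> and lies outside
  \<open>V\<close>. It can be exchanged for a vector of \<open>V\<close> without losing isotropy.

  Closures are handled by limits: if the frames depend affinely on \<open>t\<close> and all members
  with \<open>t \<noteq> 0\<close> lie in a closed set, so does the member at \<open>0\<close>.
  Genericity is measured by two kernels, that of a subspace \<open>U\<close> of
  \<open>V \<inter> F\<close> projected to the coordinates \<open>m + 2..k + 1\<close>, and that of
  \<open>V\<close> projected to all \<open>k\<close> coordinates of the chart. The transvections
  that shrink the kernel of \<open>V\<close> fix \<open>U\<close>, so they do not spoil the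
  genericity of \<open>U\<close>.

  On the combinatorial side, a weighted count of inversions equals twice the length. Hence a letter
  \<open>i\<close> of the word acts exactly when the values at \<open>i\<close> and
  \<open>i + 1\<close> ascend or \<open>i = k\<close>, and the product is computed on one-line
  notation.\<close>

lemma cvec_sum_apply: "(\<Sum>i\<in>S. f i) x = (\<Sum>i\<in>S. (f i :: cvec) x)"
  by (induction S rule: infinite_finite_induct) auto

definition coord_space :: "nat set \<Rightarrow> cvec set" where
  "coord_space S = {v. \<forall>i. i \<notin> S \<longrightarrow> v i = 0}"

lemma subspace_coord_space [simp, intro]: "cv.subspace (coord_space S)"
  by (rule cv.subspaceI) (auto simp: coord_space_def cscale_def)

lemma basis_vec_in_coord_space [simp]: "basis_vec i \<in> coord_space S \<longleftrightarrow> i \<in> S"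
  by (auto simp: coord_space_def basis_vec_def)

lemma coord_space_Int: "coord_space S \<inter> coord_space T = coord_space (S \<inter> T)"
  by (auto simp: coord_space_def)

lemma coord_space_mono: "S \<subseteq> T \<Longrightarrow> coord_space S \<subseteq> coord_space T"
  by (auto simp: coord_space_def)

lemma coord_expand:
  assumes "finite S" "v \<in> coord_space S"
  shows "v = (\<Sum>i\<in>S. cscale (v i) (basis_vec i))"
proof
  fix j
  have "(\<Sum>i\<in>S. cscale (v i) (basis_vec i)) j = (\<Sum>i\<in>S. if j = i then v i else 0)"
    unfolding cvec_sum_apply by (rule sum.cong) (auto simp: cscale_def basis_vec_def)
  also have "\<dots> = v j"
    using assms by (auto simp: sum.delta' coord_space_def)
  finally show "v j = (\<Sum>i\<in>S. cscale (v i) (basis_vec i)) j" by simp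
qed

lemma span_basis_vec:
  assumes "finite S"
  shows "cv.span (basis_vec ` S) = coord_space S"
proof
  show "cv.span (basis_vec ` S) \<subseteq> coord_space S"
    by (rule cv.span_minimal) auto
  show "coord_space S \<subseteq> cv.span (basis_vec ` S)"
  proof
    fix v assume "v \<in> coord_space S"
    then have "v = (\<Sum>i\<in>S. cscale (v i) (basis_vec i))" by (rule coord_expand[OF assms])
    moreover have "(\<Sum>i\<in>S. cscale (v i) (basis_vec i)) \<in> cv.span (basis_vec ` S)"
      by (intro cv.span_sum cv.span_scale cv.span_base) auto
    ultimately show "v \<in> cv.span (basis_vec ` S)" by simp
  qed
qed

lemma E_odd_eq: "E_odd n = coord_space {1..2 * n + 1}"
  by (simp add: E_odd_def span_basis_vec)

lemma inj_basis_vec: "inj basis_vec"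
  by (auto simp: inj_def basis_vec_def fun_eq_iff split: if_splits)

lemma independent_basis_vec:
  assumes "finite S"
  shows "cv.independent (basis_vec ` S)"
proof (rule cv.independent_if_scalars_zero)
  fix f x assume z: "(\<Sum>x\<in>basis_vec ` S. cscale (f x) x) = 0" and "x \<in> basis_vec ` S"
  then obtain j where j: "j \<in> S" "x = basis_vec j" by auto
  have "(\<Sum>x\<in>basis_vec ` S. cscale (f x) x) = (\<Sum>i\<in>S. cscale (f (basis_vec i)) (basis_vec i))"
    by (subst sum.reindex) (auto intro: inj_on_subset[OF inj_basis_vec])
  then have "(\<Sum>i\<in>S. cscale (f (basis_vec i)) (basis_vec i)) j = 0" using z by simp
  then have "(\<Sum>i\<in>S. if j = i then f (basis_vec i) else 0) = 0"
    unfolding cvec_sum_apply by (subst (asm) sum.cong[OF refl]) (auto simp: cscale_def basis_vec_def)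
  then show "f x = 0" using j assms by (simp add: sum.delta')
qed (use assms in auto)

lemma dim_coord_space: "finite S \<Longrightarrow> cv.dim (coord_space S) = card S"
  using cv.dim_span_eq_card_independent[OF independent_basis_vec, of S]
  by (simp add: span_basis_vec card_image inj_on_subset[OF inj_basis_vec])

text \<open>The space of all coordinate functions is infinite-dimensional, and \<open>cv.dim\<close>
  of a subspace without a finite basis is the default value 0. Comparisons of dimensions therefore
  carry this finiteness condition.\<close>

definition fin_subspace :: "cvec set \<Rightarrow> bool" where
  "fin_subspace V \<longleftrightarrow> cv.subspace V \<and> (\<exists>B. finite B \<and> V \<subseteq> cv.span B)"

lemma fin_subspace_subspace: "fin_subspace V \<Longrightarrow> cv.subspace V"
  by (simp add: fin_subspace_def)

lemma fin_subspace_mono: "fin_subspace V \<Longrightarrow> cv.subspace U \<Longrightarrow> U \<subseteq> V \<Longrightarrow> fin_subspace U"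
  by (auto simp: fin_subspace_def)

lemma fin_subspace_coord_space: "finite S \<Longrightarrow> fin_subspace (coord_space S)"
  unfolding fin_subspace_def using span_basis_vec[of S]
  by (auto intro!: exI[of _ "basis_vec ` S"])

lemma fin_subspace_Int: "fin_subspace V \<Longrightarrow> cv.subspace U \<Longrightarrow> fin_subspace (V \<inter> U)"
  by (rule fin_subspace_mono[of V]) (auto simp: fin_subspace_def cv.subspace_inter)

lemma fin_subspace_span: "finite B \<Longrightarrow> fin_subspace (cv.span B)"
  by (auto simp: fin_subspace_def)

lemma fin_subspace_basis_extend:
  assumes "fin_subspace V" "U \<subseteq> V" "cv.independent U"
  obtains B where "U \<subseteq> B" "B \<subseteq> V" "finite B" "cv.independent B" "cv.span B = V"
    "card B = cv.dim V"
proof -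
  obtain B where B: "U \<subseteq> B" "B \<subseteq> V" "cv.independent B" "V \<subseteq> cv.span B"
    using cv.maximal_independent_subset_extend[OF assms(2,3)] by blast
  obtain C where C: "finite C" "V \<subseteq> cv.span C" using assms by (auto simp: fin_subspace_def)
  have "finite B" using cv.independent_span_bound[OF C(1) B(3)] B C by blast
  moreover have "cv.span B = V"
    using B assms(1) by (auto simp: fin_subspace_def dest: cv.span_minimal)
  ultimately show ?thesis using B that cv.basis_card_eq_dim[of B V] by auto
qed

lemma fin_subspace_basis:
  assumes "fin_subspace V"
  obtains B where "B \<subseteq> V" "finite B" "cv.independent B" "cv.span B = V" "card B = cv.dim V"
  by (rule fin_subspace_basis_extend[OF assms, of "{}"]) (use that cv.independent_empty in auto)

lemma dim_mono:
  assumes "fin_subspace V" "U \<subseteq> V"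
  shows "cv.dim U \<le> cv.dim V"
  by (rule fin_subspace_basis[OF assms(1)]) (use assms(2) cv.dim_le_card[of U] in force)

lemma dim_insert:
  assumes "fin_subspace U" "v \<notin> U"
  shows "cv.dim (cv.span (insert v U)) = cv.dim U + 1"
proof -
  obtain B where B: "B \<subseteq> U" "finite B" "cv.independent B" "cv.span B = U" "card B = cv.dim U"
    by (rule fin_subspace_basis[OF assms(1)])
  have "cv.independent (insert v B)" using B assms cv.independent_insertI by blast
  moreover have "cv.span (insert v U) = cv.span (insert v B)"
  proof (rule cv.span_eq[THEN iffD2], intro conjI)
    have "U \<subseteq> cv.span (insert v B)" using B(4) cv.span_mono[of B "insert v B"] by blast
    then show "insert v U \<subseteq> cv.span (insert v B)" by (auto intro: cv.span_base)
    show "insert v B \<subseteq> cv.span (insert v U)" using B(1) by (auto intro: cv.span_base)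
  qed
  moreover have "v \<notin> B" using B assms by blast
  ultimately show ?thesis using B by (simp add: cv.dim_eq_card_independent)
qed

lemma dim_less:
  assumes "fin_subspace V" "cv.subspace U" "U \<subseteq> V" "v \<in> V" "v \<notin> U"
  shows "cv.dim U < cv.dim V"
proof -
  have "fin_subspace U" using assms fin_subspace_mono by blast
  then have "cv.dim (cv.span (insert v U)) = cv.dim U + 1" using dim_insert assms by blast
  moreover have "cv.span (insert v U) \<subseteq> V"
    using assms by (intro cv.span_minimal) (auto simp: fin_subspace_def)
  ultimately show ?thesis using dim_mono[OF assms(1), of "cv.span (insert v U)"] by linarith
qed

lemma dim_eq_imp_eq:
  assumes "fin_subspace V" "cv.subspace U" "U \<subseteq> V" "cv.dim V \<le> cv.dim U"
  shows "U = V"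
proof (rule ccontr)
  assume "U \<noteq> V"
  then obtain v where "v \<in> V" "v \<notin> U" using assms(3) by blast
  then show False using dim_less[OF assms(1-3)] assms(4) by fastforce
qed

lemma nonzero_of_dim:
  assumes "cv.dim V > 0" "fin_subspace V"
  obtains v where "v \<in> V" "v \<noteq> 0"
proof -
  obtain B where B: "B \<subseteq> V" "finite B" "cv.independent B" "cv.span B = V" "card B = cv.dim V"
    by (rule fin_subspace_basis[OF assms(2)])
  have "B \<noteq> {}" using assms(1) B(5) by auto
  then obtain v where v: "v \<in> B" by blast
  then have "v \<noteq> 0" using B(3) cv.dependent_zero by blast
  then show ?thesis using B(1) v that by blast
qed

lemma subspace_choose_dim:
  assumes "fin_subspace V" "m \<le> cv.dim V"
  obtains U where "cv.subspace U" "U \<subseteq> V" "cv.dim U = m"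
proof -
  obtain B where B: "B \<subseteq> V" "finite B" "cv.independent B" "cv.span B = V" "card B = cv.dim V"
    by (rule fin_subspace_basis[OF assms(1)])
  obtain C where C: "C \<subseteq> B" "card C = m"
    using obtain_subset_with_card_n[of m B] assms(2) B(5) by auto
  have "cv.span C \<subseteq> V" using B(4) C(1) cv.span_mono[of C B] by simp
  moreover have "cv.dim (cv.span C) = m"
    using B(3) C cv.dim_span_eq_card_independent[of C] cv.independent_mono[of B C] by simp
  ultimately show ?thesis using that[of "cv.span C"] by auto
qed

section \<open>Linear forms and their kernels\<close>

definition linear_form :: "(cvec \<Rightarrow> complex) \<Rightarrow> bool" where
  "linear_form f \<longleftrightarrow> (\<forall>v w. f (v + w) = f v + f w) \<and> (\<forall>c v. f (cscale c v) = c * f v)"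

lemma linear_form_coord: "linear_form (\<lambda>v. v i)"
  by (auto simp: linear_form_def cscale_def)

lemma linear_form_zero: "linear_form f \<Longrightarrow> f 0 = 0"
  using cv.scale_zero_left[of 0] by (auto simp: linear_form_def dest!: spec[of _ 0])

lemma linear_form_diff: "linear_form f \<Longrightarrow> f (v - w) = f v - f w"
  unfolding linear_form_def by (elim conjE allE[of _ "v - w"] allE[of _ w]) (simp add: algebra_simps)

lemma linear_form_sum: "linear_form f \<Longrightarrow> f (\<Sum>i\<in>S. cscale (c i) (b i)) = (\<Sum>i\<in>S. c i * f (b i))"
  by (induction S rule: infinite_finite_induct) (auto simp: linear_form_zero, auto simp: linear_form_def)

lemma linear_form_combination:
  "\<forall>i\<in>J. linear_form (\<phi> i) \<Longrightarrow> linear_form (\<lambda>v. \<Sum>i\<in>J. c i * \<phi> i v)"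
  by (induction J rule: infinite_finite_induct) (auto simp: linear_form_def algebra_simps)

lemma subspace_ker: "linear_form f \<Longrightarrow> cv.subspace {v. f v = 0}"
  by (rule cv.subspaceI) (auto simp: linear_form_zero, auto simp: linear_form_def)

lemma dim_ker_nonzero:
  assumes V: "fin_subspace V" and f: "linear_form f" and v: "v \<in> V" "f v \<noteq> 0"
  shows "cv.dim V = cv.dim (V \<inter> {v. f v = 0}) + 1"
proof -
  let ?K = "V \<inter> {v. f v = 0}"
  have K: "fin_subspace ?K" using V f fin_subspace_Int subspace_ker by blast
  have "cv.span (insert v ?K) = V"
  proof
    show "cv.span (insert v ?K) \<subseteq> V"
      using V v by (intro cv.span_minimal) (auto simp: fin_subspace_def)
    show "V \<subseteq> cv.span (insert v ?K)"
    proof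
      fix w assume w: "w \<in> V"
      let ?c = "f w / f v"
      have "w - cscale ?c v \<in> ?K"
        using w v V f by (auto simp: fin_subspace_def linear_form_diff cv.subspace_diff cv.subspace_scale)
          (auto simp: linear_form_def)
      then have "(w - cscale ?c v) + cscale ?c v \<in> cv.span (insert v ?K)"
        by (intro cv.span_add cv.span_scale cv.span_base) auto
      then show "w \<in> cv.span (insert v ?K)" by simp
    qed
  qed
  then show ?thesis using dim_insert[OF K, of v] v by auto
qed

lemma dim_ker_le:
  assumes V: "fin_subspace V" and f: "linear_form f"
  shows "cv.dim V \<le> cv.dim (V \<inter> {v. f v = 0}) + 1"
proof (cases "\<exists>v\<in>V. f v \<noteq> 0")
  case True
  then show ?thesis using dim_ker_nonzero[OF V f] by auto
next
  case False
  then have "V \<inter> {v. f v = 0} = V" by auto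
  then show ?thesis by simp
qed

lemma dim_common_ker:
  assumes V: "fin_subspace V" and "finite J" and "\<And>j. j \<in> J \<Longrightarrow> linear_form (\<phi> j)"
  shows "cv.dim V \<le> cv.dim (V \<inter> {v. \<forall>j\<in>J. \<phi> j v = 0}) + card J"
  using assms(2,3)
proof (induction J)
  case (insert j J)
  let ?K = "V \<inter> {v. \<forall>j\<in>J. \<phi> j v = 0}"
  have "cv.subspace {v. \<forall>j\<in>J. \<phi> j v = 0}"
  proof -
    have "{v. \<forall>j\<in>J. \<phi> j v = 0} = (\<Inter>j\<in>J. {v. \<phi> j v = 0})" by auto
    then show ?thesis using insert.prems subspace_ker
      by (auto intro!: cv.subspace_Inter simp del: mem_Collect_eq)
  qed
  then have K: "fin_subspace ?K" using V fin_subspace_Int by blast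
  have "cv.dim ?K \<le> cv.dim (?K \<inter> {v. \<phi> j v = 0}) + 1"
    by (rule dim_ker_le[OF K]) (use insert.prems in auto)
  moreover have "?K \<inter> {v. \<phi> j v = 0} = V \<inter> {v. \<forall>j\<in>insert j J. \<phi> j v = 0}" by auto
  ultimately show ?case using insert by auto
qed auto

text \<open>Induction on \<open>J\<close>. On the kernel of the new form the induction hypothesis
  gives the coefficients; the remaining difference \<open>g\<close> vanishes on that kernel, so it
  is a multiple of the new form, with the factor read off at one vector \<open>u\<close> where that
  form is nonzero.\<close>

lemma linear_form_in_span:
  assumes "cv.subspace V" "finite J" "\<And>j. j \<in> J \<Longrightarrow> linear_form (\<phi> j)" "linear_form \<psi>"
    and "\<And>v. v \<in> V \<Longrightarrow> \<forall>j\<in>J. \<phi> j v = 0 \<Longrightarrow> \<psi> v = 0"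
  shows "\<exists>c. \<forall>v\<in>V. \<psi> v = (\<Sum>j\<in>J. c j * \<phi> j v)"
  using assms(2,1,3-)
proof (induction J arbitrary: V \<psi> rule: finite_induct)
  case empty
  then show ?case by auto
next
  case (insert j J)
  have lf: "linear_form (\<phi> j)" using insert by auto
  let ?V = "V \<inter> {v. \<phi> j v = 0}"
  have "\<exists>c. \<forall>v\<in>?V. \<psi> v = (\<Sum>j\<in>J. c j * \<phi> j v)"
    by (rule insert.IH)
       (use insert.prems lf in \<open>auto intro!: cv.subspace_inter subspace_ker\<close>)
  then obtain c where c: "\<And>v. v \<in> ?V \<Longrightarrow> \<psi> v = (\<Sum>j\<in>J. c j * \<phi> j v)" by blast
  show ?case
  proof (cases "\<exists>u\<in>V. \<phi> j u \<noteq> 0")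
    case False
    then show ?thesis using c insert by (intro exI[of _ c]) auto
  next
    case True
    then obtain u where u: "u \<in> V" "\<phi> j u \<noteq> 0" by auto
    define g where "g v = \<psi> v - (\<Sum>j\<in>J. c j * \<phi> j v)" for v
    have lc: "linear_form (\<lambda>v. \<Sum>j\<in>J. c j * \<phi> j v)"
      using insert.prems by (intro linear_form_combination) auto
    have g: "linear_form g" using lc \<open>linear_form \<psi>\<close>
      unfolding g_def linear_form_def by (simp add: algebra_simps)
    have "\<psi> v = (\<Sum>i\<in>insert j J. (c(j := g u / \<phi> j u)) i * \<phi> i v)" if v: "v \<in> V" for v
    proof -
      let ?w = "v - cscale (\<phi> j v / \<phi> j u) u"
      have "\<phi> j ?w = 0" using lf u by (subst linear_form_diff) (auto simp: linear_form_def)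
      then have "g ?w = 0"
        using c[of ?w] v u insert.prems(1) by (auto simp: g_def cv.subspace_diff cv.subspace_scale)
      then have "g v = \<phi> j v / \<phi> j u * g u"
        using g by (subst (asm) linear_form_diff) (auto simp: linear_form_def)
      then have *: "\<psi> v = g u / \<phi> j u * \<phi> j v + (\<Sum>i\<in>J. c i * \<phi> i v)"
        using g_def[of v] by (simp add: algebra_simps)
      have "(\<Sum>i\<in>J. (c(j := g u / \<phi> j u)) i * \<phi> i v) = (\<Sum>i\<in>J. c i * \<phi> i v)"
        using insert(2) by (intro sum.cong) auto
      then show ?thesis unfolding sum.insert[OF insert(1,2)] * by simp
    qed
    then show ?thesis by (intro exI[of _ "c(j := g u / \<phi> j u)"] ballI)
  qed
qed

text \<open>Ordered bases in exactly the form over which \<open>plucker\<close> quantifies, so that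
  the maximal minors of a frame are Pluecker coordinates.\<close>

definition frame :: "nat \<Rightarrow> (nat \<Rightarrow> cvec) \<Rightarrow> cvec set \<Rightarrow> bool" where
  "frame k b V \<longleftrightarrow> inj_on b {..<k} \<and> cv.independent (b ` {..<k}) \<and> cv.span (b ` {..<k}) = V"

lemma frameI:
  assumes z: "\<And>x. (\<Sum>a<k. cscale (x a) (b a)) = 0 \<Longrightarrow> \<forall>a<k. x a = 0"
  shows "frame k b (cv.span (b ` {..<k}))"
proof -
  have inj: "inj_on b {..<k}"
  proof (rule inj_onI)
    fix i j assume ij: "i \<in> {..<k}" "j \<in> {..<k}" "b i = b j"
    show "i = j"
    proof (rule ccontr)
      assume ne: "i \<noteq> j"
      let ?x = "\<lambda>a. if a = i then 1 else if a = j then -1 else 0 :: complex"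
      have "(\<Sum>a<k. cscale (?x a) (b a)) = (\<Sum>a\<in>{i,j}. cscale (?x a) (b a))"
        using ij by (intro sum.mono_neutral_right) auto
      also have "\<dots> = 0" using ij ne by (auto simp: cscale_def fun_eq_iff)
      finally show False using z ij by fastforce
    qed
  qed
  moreover have "cv.independent (b ` {..<k})"
  proof (rule cv.independent_if_scalars_zero)
    fix f x assume s: "(\<Sum>x\<in>b ` {..<k}. cscale (f x) x) = 0" and x: "x \<in> b ` {..<k}"
    have "(\<Sum>a<k. cscale (f (b a)) (b a)) = 0" using s by (subst (asm) sum.reindex[OF inj]) auto
    from z[OF this] x show "f x = 0" by auto
  qed auto
  ultimately show ?thesis by (simp add: frame_def)
qed

lemma frame_zero:
  assumes "frame k b V" "(\<Sum>a<k. cscale (x a) (b a)) = 0" "a < k"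
  shows "x a = 0"
proof (rule ccontr)
  assume ne: "x a \<noteq> 0"
  have inj: "inj_on b {..<k}" and ind: "cv.independent (b ` {..<k})" using assms by (auto simp: frame_def)
  let ?u = "\<lambda>v. x (the_inv_into {..<k} b v)"
  have "(\<Sum>v\<in>b ` {..<k}. cscale (?u v) v) = 0"
    using assms(2) by (subst sum.reindex[OF inj]) (auto simp: the_inv_into_f_f[OF inj])
  moreover have "?u (b a) \<noteq> 0" using ne assms(3) by (simp add: the_inv_into_f_f[OF inj])
  ultimately have "cv.dependent (b ` {..<k})"
    using assms(3) by (subst cv.dependent_finite) auto
  then show False using ind by simp
qed

lemma frame_elem:
  assumes "frame k b V" "v \<in> V"
  obtains x where "v = (\<Sum>a<k. cscale (x a) (b a))"
proof -
  have inj: "inj_on b {..<k}" using assms by (auto simp: frame_def)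
  have "v \<in> range (\<lambda>u. \<Sum>v\<in>b ` {..<k}. cscale (u v) v)"
    using assms cv.span_finite[of "b ` {..<k}"] by (auto simp: frame_def)
  then obtain u where "v = (\<Sum>v\<in>b ` {..<k}. cscale (u v) v)" by auto
  then have "v = (\<Sum>a<k. cscale (u (b a)) (b a))" by (simp add: sum.reindex[OF inj])
  then show ?thesis by (rule that)
qed

lemma frame_sum_in: "frame k b V \<Longrightarrow> (\<Sum>a<k. cscale (x a) (b a)) \<in> V"
  unfolding frame_def
  by (elim conjE, erule subst, intro cv.span_sum cv.span_scale cv.span_base) simp

lemma frame_in: "frame k b V \<Longrightarrow> a < k \<Longrightarrow> b a \<in> V"
  unfolding frame_def by (elim conjE, erule subst, rule cv.span_base) simp

lemma frame_dim: "frame k b V \<Longrightarrow> cv.dim V = k"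
  using cv.dim_span_eq_card_independent[of "b ` {..<k}"] by (auto simp: frame_def card_image)

lemma frame_fin_subspace: "frame k b V \<Longrightarrow> fin_subspace V"
  unfolding frame_def by (elim conjE, erule subst, rule fin_subspace_span) simp

lemma frame_exists:
  assumes "fin_subspace V" "cv.dim V = k"
  obtains b where "frame k b V"
proof -
  obtain B where B: "B \<subseteq> V" "finite B" "cv.independent B" "cv.span B = V" "card B = cv.dim V"
    by (rule fin_subspace_basis[OF assms(1)])
  obtain b where "bij_betw b {0..<k} B" using ex_bij_betw_nat_finite[OF B(2)] B(5) assms(2) by auto
  then have "frame k b V" using B assms(2) by (auto simp: frame_def bij_betw_def atLeast0LessThan)
  then show ?thesis by (rule that)
qed

section \<open>The skew form and its transvections\<close>

lemma bar_bar: "i \<le> 2 * n + 3 \<Longrightarrow> bar n (bar n i) = i"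
  by (simp add: bar_def)

lemma linear_form_omega_right: "linear_form (omega n v)"
  unfolding linear_form_def omega_def
  by (auto simp: cscale_def sum.distrib[symmetric] sum_distrib_left algebra_simps intro!: sum.cong)

lemma omega_skew: "omega n v w = - omega n w v"
  unfolding omega_def sum_negf[symmetric] by (rule sum.cong) (auto simp: mult.commute)

lemma linear_form_omega_left: "linear_form (\<lambda>v. omega n v w)"
  using linear_form_omega_right[of n w] unfolding linear_form_def
  by (simp add: omega_skew[of n _ w])

lemma omega_self [simp]: "omega n v v = 0"
  using omega_skew[of n v v] by simp

lemma omega_zero_left [simp]: "omega n 0 v = 0"
  and omega_zero_right [simp]: "omega n v 0 = 0"
  by (rule linear_form_zero[OF linear_form_omega_left] linear_form_zero[OF linear_form_omega_right])+

lemma omega_add_left: "omega n (v + v') w = omega n v w + omega n v' w"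
  and omega_scale_left: "omega n (cscale c v) w = c * omega n v w"
  and omega_add_right: "omega n w (v + v') = omega n w v + omega n w v'"
  and omega_scale_right: "omega n w (cscale c v) = c * omega n w v"
  using linear_form_omega_left[of n w] linear_form_omega_right[of n w]
  unfolding linear_form_def by auto

lemmas omega_bilinear = omega_add_left omega_scale_left omega_add_right omega_scale_right

lemma omega_basis_vec_left:
  assumes "1 \<le> i" "i \<le> 2 * n + 2"
  shows "omega n (basis_vec i) v = (if i \<le> n + 1 then v (bar n i) else - v (bar n i))"
proof -
  \<comment> \<open>The sum in \<open>omega\<close> runs over the first half of the indices only, so
    the \<open>i\<close>-th basis vector is seen by the summand at the smaller of \<open>i\<close>
    and \<open>bar n i\<close>.\<close>
  let ?j = "if i \<le> n + 1 then i else bar n i"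
  have "omega n (basis_vec i) v =
      (\<Sum>a = 1..n + 1. if ?j = a then (if i \<le> n + 1 then v (bar n i) else - v (bar n i)) else 0)"
    unfolding omega_def
    by (rule sum.cong) (use assms in \<open>auto simp: basis_vec_def bar_def\<close>)
  also have "\<dots> = (if i \<le> n + 1 then v (bar n i) else - v (bar n i))"
    using assms by (subst sum.delta') (auto simp: bar_def)
  finally show ?thesis .
qed

text \<open>The form pairs a coordinate \<open>i\<close> with the coordinate \<open>bar n i\<close>
  and no other, so orthogonality can be read off from the supports. Most isotropy checks below
  reduce to this.\<close>

lemma omega_coord_space:
  assumes "v \<in> coord_space S" "w \<in> coord_space T"
    and "\<And>i. 1 \<le> i \<Longrightarrow> i \<le> 2 * n + 2 \<Longrightarrow> i \<in> S \<Longrightarrow> bar n i \<notin> T"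
  shows "omega n v w = 0"
  unfolding omega_def
proof (rule sum.neutral, rule ballI)
  fix a assume a: "a \<in> {1..n + 1}"
  have "v a * w (bar n a) = 0"
    using assms(1,2) assms(3)[of a] a by (auto simp: coord_space_def)
  moreover have "v (bar n a) * w a = 0"
  proof -
    have "1 \<le> bar n a" "bar n a \<le> 2 * n + 2" "bar n (bar n a) = a"
      using a by (auto simp: bar_def)
    then have "bar n a \<in> S \<Longrightarrow> a \<notin> T"
      using assms(3)[of "bar n a"] by simp
    then show ?thesis using assms(1,2) by (auto simp: coord_space_def)
  qed
  ultimately show "v a * w (bar n a) - v (bar n a) * w a = 0" by (simp only: diff_self)
qed

lemma omega_basis_vec_1: "v \<in> E_odd n \<Longrightarrow> omega n (basis_vec 1) v = 0"
  "v \<in> E_odd n \<Longrightarrow> omega n v (basis_vec 1) = 0"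
  by (simp_all add: omega_skew[of n v] omega_basis_vec_left E_odd_eq coord_space_def bar_def)

text \<open>The radical of the form on \<open>E_odd n\<close> is the line of the first basis vector,
  because the partner of index \<open>1\<close> is \<open>2 * n + 2\<close>, which is missing from
  \<open>E_odd n\<close>.\<close>

lemma omega_nondegenerate:
  assumes "v \<in> E_odd n" "\<And>z. z \<in> E_odd n \<Longrightarrow> omega n z v = 0"
  shows "v = cscale (v 1) (basis_vec 1)"
proof
  fix i
  have "v i = 0" if i: "i \<in> {2..2 * n + 1}"
  proof -
    have "basis_vec (bar n i) \<in> E_odd n" using i by (auto simp: E_odd_eq bar_def)
    from assms(2)[OF this] show ?thesis using i
      by (subst (asm) omega_basis_vec_left) (auto simp: bar_def split: if_splits)
  qed
  moreover have "v i = 0" if "i \<notin> {1..2 * n + 1}"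
    using assms(1) that by (auto simp: E_odd_eq coord_space_def)
  moreover have "i = 1 \<or> i \<in> {2..2 * n + 1} \<or> i \<notin> {1..2 * n + 1}" by auto
  ultimately show "v i = cscale (v 1) (basis_vec 1) i"
    by (auto simp: cscale_def basis_vec_def)
qed

text \<open>Taken among all coordinate functions and hence infinite-dimensional, as
  \<open>omega\<close> reads only finitely many coordinates. It is used together with membership in
  some finite-dimensional space.\<close>

definition perp :: "nat \<Rightarrow> cvec set \<Rightarrow> cvec set" where
  "perp n V = {u. \<forall>v\<in>V. omega n u v = 0}"

lemma subspace_perp: "cv.subspace (perp n V)"
  by (rule cv.subspaceI) (auto simp: perp_def omega_bilinear)

lemma subspace_left_perp: "cv.subspace {v. \<forall>u\<in>V. omega n u v = 0}"
  by (rule cv.subspaceI) (auto simp: omega_bilinear)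

lemma omega_span_right:
  assumes "\<And>b. b \<in> B \<Longrightarrow> omega n u b = 0" "v \<in> cv.span B"
  shows "omega n u v = 0"
  using cv.span_minimal[OF _ subspace_left_perp[of "{u}" n], of B] assms by auto

text \<open>Conditions on \<open>A\<close> come only from the vectors that complete a basis of
  \<open>K\<close> to a basis of \<open>V\<close>, since \<open>K\<close> is already orthogonal to
  \<open>A\<close>.\<close>

lemma dim_perp:
  assumes A: "fin_subspace A" and V: "fin_subspace V" and K: "fin_subspace K" "K \<subseteq> V"
    and AK: "\<And>a v. a \<in> A \<Longrightarrow> v \<in> K \<Longrightarrow> omega n a v = 0"
  shows "cv.dim A + cv.dim K \<le> cv.dim (A \<inter> perp n V) + cv.dim V"
proof -
  obtain C where C: "C \<subseteq> K" "finite C" "cv.independent C" "cv.span C = K" "card C = cv.dim K"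
    by (rule fin_subspace_basis[OF K(1)])
  obtain B where B: "C \<subseteq> B" "B \<subseteq> V" "finite B" "cv.independent B" "cv.span B = V"
    "card B = cv.dim V"
    using fin_subspace_basis_extend[OF V, of C] C K(2) by blast
  let ?A = "A \<inter> {a. \<forall>b\<in>B - C. omega n a b = 0}"
  have "cv.dim A \<le> cv.dim ?A + card (B - C)"
    by (rule dim_common_ker[OF A]) (use B linear_form_omega_left in auto)
  moreover have "?A = A \<inter> perp n V"
  proof (intro equalityI subsetI)
    fix a assume a: "a \<in> ?A"
    have "omega n a b = 0" if "b \<in> B" for b using that a AK C(1) by auto
    then have "omega n a v = 0" if "v \<in> V" for v
      using omega_span_right[of B n a v] that B(5) by auto
    then show "a \<in> A \<inter> perp n V" using a by (auto simp: perp_def)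
  qed (use B in \<open>auto simp: perp_def\<close>)
  moreover have "card (B - C) = cv.dim V - cv.dim K"
    using B C by (simp add: card_Diff_subset)
  moreover have "cv.dim K \<le> cv.dim V" using dim_mono V K by blast
  ultimately show ?thesis by auto
qed

text \<open>The double orthogonal of \<open>U\<close> in \<open>E_odd n\<close> is \<open>U\<close>
  plus the radical. Pairing with \<open>x\<close> vanishes on the common kernel of the pairings with
  a basis of \<open>U\<close>, so it is a combination of them; the same combination of the basis
  vectors differs from \<open>x\<close> by a vector of the radical.\<close>

lemma double_perp:
  assumes U: "fin_subspace U" "U \<subseteq> E_odd n" and x: "x \<in> E_odd n"
    and perp: "\<And>z. z \<in> E_odd n \<Longrightarrow> z \<in> perp n U \<Longrightarrow> omega n z x = 0"
  shows "\<exists>u\<in>U. \<exists>c. x = u + cscale c (basis_vec 1)"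
proof -
  obtain B where B: "B \<subseteq> U" "finite B" "cv.independent B" "cv.span B = U" "card B = cv.dim U"
    by (rule fin_subspace_basis[OF U(1)])
  have "\<exists>c. \<forall>z\<in>E_odd n. omega n z x = (\<Sum>b\<in>B. c b * omega n z b)"
  proof (rule linear_form_in_span)
    fix z assume z: "z \<in> E_odd n" "\<forall>b\<in>B. omega n z b = 0"
    then have "z \<in> perp n U" using omega_span_right[of B n z] B(4) by (auto simp: perp_def)
    then show "omega n z x = 0" using perp z by blast
  qed (use B linear_form_omega_left in \<open>auto simp: E_odd_eq\<close>)
  then obtain c where c: "\<And>z. z \<in> E_odd n \<Longrightarrow> omega n z x = (\<Sum>b\<in>B. c b * omega n z b)" by blast
  define u where "u = (\<Sum>b\<in>B. cscale (c b) b)"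
  have u: "u \<in> U" unfolding u_def using B(1) U(1)
    by (intro cv.subspace_sum cv.subspace_scale) (auto simp: fin_subspace_def)
  have sub: "cv.subspace (E_odd n)" by (simp add: E_odd_eq)
  have "omega n z (x - u) = 0" if "z \<in> E_odd n" for z
    using c[OF that] linear_form_sum[OF linear_form_omega_right, of n z c "\<lambda>b. b" B]
    by (simp add: linear_form_diff[OF linear_form_omega_right] u_def)
  moreover have "x - u \<in> E_odd n" using sub u U(2) x by (intro cv.subspace_diff) auto
  ultimately have "x - u = cscale ((x - u) 1) (basis_vec 1)" by (rule omega_nondegenerate[rotated])
  then have "x = u + cscale ((x - u) 1) (basis_vec 1)" by (metis add.commute diff_add_cancel)
  then show ?thesis using u by blast
qed

text \<open>A space is not the union of two proper subspaces: if neither witness works for both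
  vectors, their sum does.\<close>

lemma perp_avoiding_two:
  assumes U: "fin_subspace U" "U \<subseteq> E_odd n" and x: "x \<in> E_odd n" and y: "y \<in> E_odd n"
    and nx: "\<And>u c. u \<in> U \<Longrightarrow> x \<noteq> u + cscale c (basis_vec 1)"
    and ny: "\<And>u c. u \<in> U \<Longrightarrow> y \<noteq> u + cscale c (basis_vec 1)"
  obtains z where "z \<in> E_odd n" "z \<in> perp n U" "omega n z x \<noteq> 0" "omega n z y \<noteq> 0"
proof -
  obtain z1 where z1: "z1 \<in> E_odd n" "z1 \<in> perp n U" "omega n z1 x \<noteq> 0"
    using double_perp[OF U x] nx by blast
  obtain z2 where z2: "z2 \<in> E_odd n" "z2 \<in> perp n U" "omega n z2 y \<noteq> 0"
    using double_perp[OF U y] ny by blast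
  have s: "z1 + z2 \<in> E_odd n" "z1 + z2 \<in> perp n U"
    using z1 z2 subspace_perp[of n U] by (auto simp: E_odd_eq intro!: cv.subspace_add)
  show ?thesis
  proof (cases "omega n z1 y = 0")
    case False
    then show ?thesis using z1 that by blast
  next
    case y1: True
    show ?thesis
    proof (cases "omega n z2 x = 0")
      case False
      then show ?thesis using z2 that by blast
    next
      case True
      then show ?thesis using y1 z1 z2 s that[of "z1 + z2"] by (simp add: omega_bilinear)
    qed
  qed
qed

text \<open>For \<open>y = x\<close> this is the usual transvection with parameter
  \<open>2 * t\<close>. If \<open>x\<close> and \<open>y\<close> are orthogonal, the part multiplied
  by \<open>t\<close> squares to zero, so the map is the exponential of an infinitesimal isometry:
  affine in \<open>t\<close>, with inverse at \<open>- t\<close>.\<close>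

definition transvection :: "nat \<Rightarrow> cvec \<Rightarrow> cvec \<Rightarrow> complex \<Rightarrow> cvec \<Rightarrow> cvec" where
  "transvection n x y t v = v + cscale t (cscale (omega n x v) y + cscale (omega n y v) x)"

lemma linear_transvection: "Vector_Spaces.linear cscale cscale (transvection n x y t)"
  unfolding Vector_Spaces.linear_iff
  by (auto simp: cv.vector_space_axioms transvection_def omega_bilinear
      cv.scale_right_distrib cv.scale_left_distrib mult.left_commute algebra_simps)

lemma omega_transvection:
  assumes "omega n x y = 0"
  shows "omega n (transvection n x y t v) (transvection n x y t w) = omega n v w"
  using assms omega_skew[of n y x] omega_skew[of n v x] omega_skew[of n v y]
  by (simp add: transvection_def omega_bilinear algebra_simps)

lemma transvection_inverse:
  assumes "omega n x y = 0"
  shows "transvection n x y (- t) (transvection n x y t v) = v"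
  using assms omega_skew[of n y x]
  by (simp add: transvection_def omega_bilinear algebra_simps)

lemma inj_transvection: "omega n x y = 0 \<Longrightarrow> inj (transvection n x y t)"
  by (rule inj_on_inverseI) (rule transvection_inverse)

lemma transvection_in_E_odd:
  "x \<in> E_odd n \<Longrightarrow> y \<in> E_odd n \<Longrightarrow> v \<in> E_odd n \<Longrightarrow> transvection n x y t v \<in> E_odd n"
  by (auto simp: transvection_def E_odd_eq intro!: cv.subspace_add cv.subspace_scale)

lemma transvection_basis_vec_1:
  "x \<in> E_odd n \<Longrightarrow> y \<in> E_odd n \<Longrightarrow> transvection n x y t (basis_vec 1) = basis_vec 1"
  by (simp add: transvection_def omega_basis_vec_1 del: One_nat_def)

section \<open>Images of frames and of isotropic subspaces\<close>

lemma frame_image: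
  assumes b: "frame k b V" and f: "Vector_Spaces.linear cscale cscale f" and inj: "inj_on f V"
  shows "frame k (f \<circ> b) (f ` V)"
proof -
  interpret f: Vector_Spaces.linear cscale cscale f by (rule f)
  have "f ` V = cv.span ((f \<circ> b) ` {..<k})"
    using b f.span_image[of "b ` {..<k}"] by (auto simp: frame_def image_comp)
  moreover have "frame k (f \<circ> b) (cv.span ((f \<circ> b) ` {..<k}))"
  proof (rule frameI)
    fix x assume "(\<Sum>a<k. cscale (x a) ((f \<circ> b) a)) = 0"
    then have "f (\<Sum>a<k. cscale (x a) (b a)) = f 0" by (simp add: f.sum f.scale f.zero)
    then have "(\<Sum>a<k. cscale (x a) (b a)) = 0"
      using inj_onD[OF inj _ frame_sum_in[OF b]] cv.subspace_0
        fin_subspace_subspace[OF frame_fin_subspace[OF b]] by blast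
    then show "\<forall>a<k. x a = 0" using frame_zero[OF b, of x] by simp
  qed
  ultimately show ?thesis by simp
qed

lemma dim_image:
  assumes "fin_subspace V" "Vector_Spaces.linear cscale cscale f" "inj_on f V"
  shows "fin_subspace (f ` V)" "cv.dim (f ` V) = cv.dim V"
proof -
  obtain b where b: "frame (cv.dim V) b V" using frame_exists[OF assms(1)] by blast
  show "fin_subspace (f ` V)" "cv.dim (f ` V) = cv.dim V"
    using frame_image[OF b assms(2,3)] by (rule frame_fin_subspace, rule frame_dim)
qed

lemma fin_subspace_E_odd: "fin_subspace (E_odd n)"
  by (simp add: E_odd_eq fin_subspace_coord_space)

lemma IG_fin_subspace: "V \<in> IG n k \<Longrightarrow> fin_subspace V"
  using fin_subspace_mono[OF fin_subspace_E_odd] by (auto simp: IG_def)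

lemma IG_I:
  assumes b: "frame k b V" and E: "\<And>a. a < k \<Longrightarrow> b a \<in> E_odd n"
    and iso: "\<And>i j. i < j \<Longrightarrow> j < k \<Longrightarrow> omega n (b i) (b j) = 0"
  shows "V \<in> IG n k"
proof -
  have V: "V = cv.span (b ` {..<k})" using b by (simp add: frame_def)
  have "omega n (b i) (b j) = 0" if "i < k" "j < k" for i j
    using iso[of i j] iso[of j i] that omega_skew[of n "b i" "b j"] by (cases i j rule: linorder_cases) auto
  then have 1: "omega n (b i) w = 0" if "i < k" "w \<in> V" for i w
    using that omega_span_right[of "b ` {..<k}" n "b i" w] V by auto
  have "omega n v w = 0" if "v \<in> V" "w \<in> V" for v w
  proof (rule omega_span_right[of "b ` {..<k}"])
    fix c assume "c \<in> b ` {..<k}"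
    then show "omega n v c = 0" using 1[OF _ that(1)] omega_skew[of n v c] by auto
  qed (use that V in simp)
  moreover have "V \<subseteq> E_odd n" unfolding V
    by (rule cv.span_minimal) (use E in \<open>auto simp: E_odd_eq\<close>)
  ultimately show ?thesis using frame_fin_subspace[OF b] frame_dim[OF b]
    by (auto simp: IG_def fin_subspace_def)
qed

lemma IG_image:
  assumes V: "V \<in> IG n k" and f: "Vector_Spaces.linear cscale cscale f" "inj_on f V" "f ` V \<subseteq> E_odd n"
    and iso: "\<And>v w. v \<in> V \<Longrightarrow> w \<in> V \<Longrightarrow> omega n (f v) (f w) = omega n v w"
  shows "f ` V \<in> IG n k"
  using dim_image[OF IG_fin_subspace[OF V] f(1,2)] V f(3) iso
  by (auto simp: IG_def fin_subspace_def)

section \<open>Pluecker coordinates and flag loci\<close>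

lemma in_coord_space_compl: "v \<in> coord_space (- I) \<longleftrightarrow> (\<forall>i\<in>I. v i = 0)"
  by (auto simp: coord_space_def)

lemma coord_space_compl: "coord_space (- I) = {v. \<forall>i\<in>I. v i = 0}"
  by (auto simp: coord_space_def)

lemma coord_space_empty: "coord_space {} = {0}"
  by (auto simp: coord_space_def)

section \<open>Minors and Pluecker coordinates\<close>

lemma linear_combination_apply:
  "(\<Sum>a<k. cscale (x a) (b a)) i = (\<Sum>a<k. x a * b a i)"
  by (simp add: cvec_sum_apply cscale_def)

lemma minor_expand:
  "minor k b I = (\<Sum>p | p permutes {0..<k}. signof p * (\<Prod>i = 0..<k. b i (sorted_list_of_set I ! p i)))"
proof -
  have "p i < k" if "p permutes {0..<k}" "i < k" for p i
    using permutes_in_image[OF that(1), of i] that(2) by simp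
  then show ?thesis
    unfolding minor_def by (subst det_def'[of _ k]) (auto intro!: sum.cong prod.cong)
qed

text \<open>A kernel vector of the transposed submatrix is a list of coefficients for which the
  combination of the frame vanishes at all of \<open>I\<close>. This turns the vanishing of a
  Pluecker coordinate into a condition on \<open>V\<close> alone.\<close>

lemma minor_eq_0_iff:
  assumes b: "frame k b V" and I: "finite I" "card I = k"
  shows "minor k b I = 0 \<longleftrightarrow> (\<exists>v\<in>V. v \<noteq> 0 \<and> v \<in> coord_space (- I))"
proof -
  define L where "L = sorted_list_of_set I"
  have L: "length L = k" "set L = I" using I by (auto simp: L_def)
  define A where "A = mat k k (\<lambda>(a, c). b a (L ! c))"
  have A: "A \<in> carrier_mat k k" by (simp add: A_def)
  have ent: "(transpose_mat A *\<^sub>v x) $ c = (\<Sum>a<k. cscale (x $ a) (b a)) (L ! c)"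
    if "x \<in> carrier_vec k" "c < k" for x c
    using that unfolding linear_combination_apply
    by (auto simp: A_def scalar_prod_def atLeast0LessThan mult.commute intro!: sum.cong)
  have "minor k b I = 0 \<longleftrightarrow> det (transpose_mat A) = 0"
    using det_transpose[OF A] by (simp add: minor_def A_def L_def)
  also have "\<dots> \<longleftrightarrow> (\<exists>x. x \<in> carrier_vec k \<and> x \<noteq> 0\<^sub>v k \<and> transpose_mat A *\<^sub>v x = 0\<^sub>v k)"
    by (rule det_0_iff_vec_prod_zero_field) (use A in auto)
  also have "\<dots> \<longleftrightarrow> (\<exists>v\<in>V. v \<noteq> 0 \<and> v \<in> coord_space (- I))"
  proof
    assume "\<exists>x. x \<in> carrier_vec k \<and> x \<noteq> 0\<^sub>v k \<and> transpose_mat A *\<^sub>v x = 0\<^sub>v k"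
    then obtain x where x: "x \<in> carrier_vec k" "x \<noteq> 0\<^sub>v k" "transpose_mat A *\<^sub>v x = 0\<^sub>v k" by blast
    let ?v = "\<Sum>a<k. cscale (x $ a) (b a)"
    have "?v i = 0" if i: "i \<in> I" for i
    proof -
      obtain c where c: "c < k" "i = L ! c" using i L by (metis in_set_conv_nth)
      then show ?thesis using ent[OF x(1), of c] x(3) by simp
    qed
    then have "?v \<in> coord_space (- I)" by (simp add: in_coord_space_compl)
    moreover have "?v \<noteq> 0"
    proof
      assume "?v = 0"
      then have "\<forall>a<k. x $ a = 0" using frame_zero[OF b, of "\<lambda>a. x $ a"] by simp
      then have "x = 0\<^sub>v k" using x(1) by (intro eq_vecI) auto
      then show False using x by simp
    qed
    ultimately show "\<exists>v\<in>V. v \<noteq> 0 \<and> v \<in> coord_space (- I)"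
      using frame_sum_in[OF b, of "\<lambda>a. x $ a"] by (intro bexI[of _ ?v]) auto
  next
    assume "\<exists>v\<in>V. v \<noteq> 0 \<and> v \<in> coord_space (- I)"
    then obtain v where v: "v \<in> V" "v \<noteq> 0" "v \<in> coord_space (- I)" by auto
    obtain y where y: "v = (\<Sum>a<k. cscale (y a) (b a))" by (rule frame_elem[OF b v(1)])
    let ?x = "vec k y"
    have vx: "v = (\<Sum>a<k. cscale (?x $ a) (b a))" unfolding y by (rule sum.cong) auto
    have "?x \<noteq> 0\<^sub>v k"
    proof
      assume "?x = 0\<^sub>v k"
      then have "v = (\<Sum>a<k. cscale ((0\<^sub>v k :: complex vec) $ a) (b a))" using vx by simp
      also have "\<dots> = 0" by (intro sum.neutral) (auto simp: cscale_def fun_eq_iff)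
      finally show False using v by simp
    qed
    moreover have "transpose_mat A *\<^sub>v ?x = 0\<^sub>v k"
    proof (rule eq_vecI)
      fix c assume c: "c < dim_vec (0\<^sub>v k :: complex vec)"
      then have "(transpose_mat A *\<^sub>v ?x) $ c = v (L ! c)"
        using ent[of ?x c] vx by simp
      also have "\<dots> = 0" using c v(3) L nth_mem[of c L] by (simp add: in_coord_space_compl)
      finally show "(transpose_mat A *\<^sub>v ?x) $ c = 0\<^sub>v k $ c" using c by simp
    qed (use A in auto)
    ultimately show "\<exists>x. x \<in> carrier_vec k \<and> x \<noteq> 0\<^sub>v k \<and> transpose_mat A *\<^sub>v x = 0\<^sub>v k"
      by (intro exI[of _ ?x]) auto
  qed
  finally show ?thesis .
qed

text \<open>The factor is the determinant of the matrix expressing \<open>b'\<close> in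
  \<open>b\<close>; it may be \<open>0\<close>, as \<open>b'\<close> is only a family of vectors in
  \<open>V\<close>.\<close>

lemma minor_change_frame:
  assumes b: "frame k b V" and b': "\<And>a. a < k \<Longrightarrow> b' a \<in> V"
  obtains c where "\<And>I. finite I \<Longrightarrow> card I = k \<Longrightarrow> minor k b' I = c * minor k b I"
proof -
  have "\<forall>a. \<exists>x. a < k \<longrightarrow> b' a = (\<Sum>e<k. cscale (x e) (b e))"
    using frame_elem[OF b b'] by metis
  then obtain X where X: "\<And>a. a < k \<Longrightarrow> b' a = (\<Sum>e<k. cscale (X a e) (b e))" by metis
  define M where "M = mat k k (\<lambda>(a, e). X a e)"
  have "minor k b' I = det M * minor k b I" for I
  proof -
    define A where "A = mat k k (\<lambda>(a, c). b a (sorted_list_of_set I ! c))"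
    have "mat k k (\<lambda>(a, c). b' a (sorted_list_of_set I ! c)) = M * A"
      by (rule eq_matI)
        (auto simp: A_def M_def X linear_combination_apply scalar_prod_def atLeast0LessThan intro!: sum.cong)
    then show ?thesis using det_mult[of M k A] by (simp add: A_def M_def minor_def)
  qed
  then show ?thesis using that by blast
qed

lemma plucker_frame:
  assumes "frame k b V"
  shows "plucker n k V (\<lambda>I. if I \<subseteq> {1..2 * n + 1} \<and> card I = k then minor k b I else 0)"
  using assms unfolding plucker_def frame_def by blast

lemma plucker_obtain_frame:
  assumes "plucker n k V p"
  obtains b where "frame k b V" "p = (\<lambda>I. if I \<subseteq> {1..2 * n + 1} \<and> card I = k then minor k b I else 0)"
  using assms unfolding plucker_def frame_def by blast

lemma plucker_eq_0_iff:
  assumes "plucker n k V p" "I \<subseteq> {1..2 * n + 1}" "card I = k"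
  shows "p I = 0 \<longleftrightarrow> (\<exists>v\<in>V. v \<noteq> 0 \<and> v \<in> coord_space (- I))"
proof -
  obtain b where b: "frame k b V" "p = (\<lambda>I. if I \<subseteq> {1..2 * n + 1} \<and> card I = k then minor k b I else 0)"
    by (rule plucker_obtain_frame[OF assms(1)])
  have "finite I" using assms(2) finite_subset by blast
  then show ?thesis using minor_eq_0_iff[OF b(1) _ assms(3)] assms(2,3) b(2) by simp
qed

lemma plucker_scalar:
  assumes p: "plucker n k V p" and b: "\<And>a. a < k \<Longrightarrow> b a \<in> V"
  obtains c where "\<And>I. I \<subseteq> {1..2 * n + 1} \<Longrightarrow> card I = k \<Longrightarrow> minor k b I = c * p I"
proof -
  obtain b' where b': "frame k b' V" "p = (\<lambda>I. if I \<subseteq> {1..2 * n + 1} \<and> card I = k then minor k b' I else 0)"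
    by (rule plucker_obtain_frame[OF p])
  obtain c where "\<And>I. finite I \<Longrightarrow> card I = k \<Longrightarrow> minor k b I = c * minor k b' I"
    using minor_change_frame[OF b'(1), of b] b by blast
  then show ?thesis using b'(2) finite_subset[of _ "{1..2 * n + 1}"] by (intro that[of c]) auto
qed

section \<open>Closed sets and limits of one-parameter families\<close>

lemma eval_poly_scale:
  assumes "homogeneous f"
  obtains r where "\<And>c p. eval_poly f (\<lambda>x. c * p x) = c ^ r * eval_poly f p"
proof -
  obtain r where r: "\<And>m. m \<in> Poly_Mapping.keys f \<Longrightarrow>
      (\<Sum>x\<in>Poly_Mapping.keys m. Poly_Mapping.lookup m x) = r"
    using assms by (auto simp: homogeneous_def)
  have "eval_poly f (\<lambda>x. c * p x) = c ^ r * eval_poly f p" for c p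
    unfolding eval_poly_def sum_distrib_left
    by (rule sum.cong) (auto simp: power_mult_distrib prod.distrib r power_sum[symmetric])
  then show ?thesis using that by blast
qed

text \<open>The Pluecker coordinates of a family of frames affine in \<open>t\<close> are polynomial
  in \<open>t\<close>. A defining equation evaluated along the family is thus continuous, and it
  vanishes for \<open>t \<noteq> 0\<close>, hence also at \<open>0\<close>.\<close>

lemma zariski_closed_limit:
  assumes C: "zariski_closed n k C" and V0: "V 0 \<in> IG n k"
    and fr: "\<And>t. frame k (\<lambda>a. b a + cscale t (c a)) (V t)"
    and gen: "\<And>t. t \<noteq> 0 \<Longrightarrow> V t \<in> C"
  shows "V 0 \<in> C"
proof -
  obtain F where F: "\<And>f. f \<in> F \<Longrightarrow> homogeneous f"
    "C = {V \<in> IG n k. \<forall>p. plucker n k V p \<longrightarrow> (\<forall>f\<in>F. eval_poly f p = 0)}"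
    using C by (auto simp: zariski_closed_def)
  define p where "p t = (\<lambda>I. if I \<subseteq> {1..2 * n + 1} \<and> card I = k
    then minor k (\<lambda>a. b a + cscale t (c a)) I else 0)" for t
  have p: "plucker n k (V t) (p t)" for t unfolding p_def by (rule plucker_frame[OF fr])
  have cont: "isCont (\<lambda>t. p t I) 0" for I
  proof (cases "I \<subseteq> {1..2 * n + 1} \<and> card I = k")
    case True
    then show ?thesis unfolding p_def minor_expand
      by (simp add: cscale_def) (intro continuous_intros)
  next
    case False
    have "p t I = 0" for t unfolding p_def by (rule if_not_P[OF False])
    then show ?thesis by simp
  qed
  have zero: "eval_poly f (p 0) = 0" if f: "f \<in> F" for f
  proof -
    have "isCont (\<lambda>t. eval_poly f (p t)) 0"
      unfolding eval_poly_def by (intro continuous_intros cont)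
    then have "((\<lambda>t. eval_poly f (p t)) \<longlongrightarrow> eval_poly f (p 0)) (at 0)" by (simp add: isCont_def)
    moreover have "((\<lambda>t. eval_poly f (p t)) \<longlongrightarrow> 0) (at 0)"
    proof (rule tendsto_eventually, rule eventually_at_filter[THEN iffD2], rule always_eventually, safe)
      fix t :: complex assume "t \<noteq> 0"
      then show "eval_poly f (p t) = 0" using gen p F(2) f by auto
    qed
    ultimately show ?thesis using tendsto_unique[OF at_neq_bot] by blast
  qed
  \<comment> \<open>Membership in \<open>C\<close> refers to every representative of the Pluecker
    point. Each is a multiple of \<open>p 0\<close>, and homogeneity transfers the
    vanishing.\<close>
  have "eval_poly f p' = 0" if p': "plucker n k (V 0) p'" and f: "f \<in> F" for f p'
  proof -
    obtain b' where b': "frame k b' (V 0)"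
      "p' = (\<lambda>I. if I \<subseteq> {1..2 * n + 1} \<and> card I = k then minor k b' I else 0)"
      by (rule plucker_obtain_frame[OF p'])
    obtain c where c: "\<And>I. I \<subseteq> {1..2 * n + 1} \<Longrightarrow> card I = k \<Longrightarrow> minor k b' I = c * p 0 I"
      using plucker_scalar[OF p[of 0], of b'] frame_in[OF b'(1)] by blast
    have "p' I = c * p 0 I" for I
    proof (cases "I \<subseteq> {1..2 * n + 1} \<and> card I = k")
      case True
      then show ?thesis using c by (simp add: b'(2))
    next
      case False
      then show ?thesis unfolding b'(2) p_def by (simp only: if_False mult_zero_right)
    qed
    then have "p' = (\<lambda>I. c * p 0 I)" by blast
    moreover obtain r where "\<And>(c :: complex) p. eval_poly f (\<lambda>x. c * p x) = c ^ r * eval_poly f p"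
      using eval_poly_scale[OF F(1)[OF f]] by blast
    ultimately show ?thesis using zero[OF f] by simp
  qed
  then show ?thesis using F(2) V0 by auto
qed

text \<open>Greedy choice: a coordinate of \<open>S\<close> is kept when it cuts the current kernel
  down by one dimension and dropped when it vanishes on that kernel. So \<open>T\<close> indexes a
  basis of the coordinate forms restricted to \<open>V\<close>.\<close>

lemma coord_selection:
  assumes V: "fin_subspace V" and "finite S"
  shows "\<exists>T\<subseteq>S. card T + cv.dim (V \<inter> coord_space (- S)) = cv.dim V \<and>
    V \<inter> coord_space (- T) = V \<inter> coord_space (- S)"
  using assms(2)
proof (induction S)
  case empty
  then show ?case by (auto simp: coord_space_def)
next
  case (insert s S)
  then obtain T where T: "T \<subseteq> S" "card T + cv.dim (V \<inter> coord_space (- S)) = cv.dim V"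
    "V \<inter> coord_space (- T) = V \<inter> coord_space (- S)" by blast
  let ?K = "V \<inter> coord_space (- S)"
  have eq: "V \<inter> coord_space (- insert s T) = V \<inter> coord_space (- T) \<inter> {v. v s = 0}" for T
    by (auto simp: in_coord_space_compl)
  show ?case
  proof (cases "\<exists>v\<in>?K. v s \<noteq> 0")
    case True
    then obtain v where v: "v \<in> ?K" "v s \<noteq> 0" by blast
    have "cv.dim ?K = cv.dim (?K \<inter> {v. v s = 0}) + 1"
      using v by (intro dim_ker_nonzero[where v = v] fin_subspace_Int V linear_form_coord) auto
    moreover have "card (insert s T) = card T + 1"
      using insert T(1) finite_subset by (subst card_insert_disjoint) auto
    ultimately show ?thesis using T unfolding eq
      by (intro exI[of _ "insert s T"]) (auto simp: eq)
  next
    case False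
    then have "V \<inter> coord_space (- insert s S) = ?K" by (auto simp: in_coord_space_compl)
    then show ?thesis using T by (intro exI[of _ T]) auto
  qed
qed

text \<open>As in an echelon form, the coordinates beyond \<open>q\<close> are selected to detect
  \<open>V\<close> modulo its part in the first \<open>q\<close> coordinates, and those up to
  \<open>q\<close> to detect that part. The Pluecker coordinate at \<open>I\<close> is nonzero,
  while \<open>I\<close> records the dimension of the intersection with the flag.\<close>

lemma adapted_index_set:
  assumes V: "cv.subspace V" "V \<subseteq> E_odd n" and q: "q \<le> 2 * n + 1"
  obtains I where "I \<subseteq> {1..2 * n + 1}" "card I = cv.dim V"
    "V \<inter> coord_space (- I) = {0}" "card (I \<inter> {1..q}) = cv.dim (V \<inter> coord_space {1..q})"
    "V \<inter> coord_space (- (I - {1..q})) = V \<inter> coord_space {1..q}"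
proof -
  have fV: "fin_subspace V" using fin_subspace_mono[OF fin_subspace_E_odd V] .
  let ?S = "{q + 1..2 * n + 1}" and ?U = "V \<inter> coord_space {1..q}"
  have VS: "V \<inter> coord_space (- ?S) = ?U"
  proof -
    have "v \<in> coord_space (- ?S) \<longleftrightarrow> v \<in> coord_space {1..q}" if v: "v \<in> V" for v
    proof -
    from v have z: "v i = 0" if "i \<notin> {1..2 * n + 1}" for i
      using V(2) that by (auto simp: E_odd_eq coord_space_def)
    have "i \<notin> {1..q} \<longleftrightarrow> i \<notin> {1..2 * n + 1} \<or> i \<in> ?S" for i using q by auto
    then show ?thesis using z by (auto simp: coord_space_def)
    qed
    then show ?thesis by blast
  qed
  obtain T where T: "T \<subseteq> ?S" "card T + cv.dim ?U = cv.dim V" "V \<inter> coord_space (- T) = ?U"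
    using coord_selection[OF fV, of ?S] unfolding VS by auto
  have fU: "fin_subspace ?U" using fV by (intro fin_subspace_Int) auto
  have U0: "?U \<inter> coord_space (- {1..q}) = {0}"
    using cv.subspace_0[OF V(1)] by (simp add: Int_assoc coord_space_Int coord_space_empty)
  then have "cv.dim (?U \<inter> coord_space (- {1..q})) = 0"
    using cv.dim_span_eq_card_independent[OF cv.independent_empty] by simp
  then obtain T' where T': "T' \<subseteq> {1..q}" "card T' = cv.dim ?U" "?U \<inter> coord_space (- T') = {0}"
    using coord_selection[OF fU, of "{1..q}"] U0 by auto
  have "T' \<inter> T = {}" using T T' by force
  moreover have "finite T" "finite T'" using T T' finite_subset by blast+
  moreover have "(T \<union> T') \<inter> {1..q} = T'" "(T \<union> T') - {1..q} = T" using T(1) T'(1) by auto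
  moreover have "V \<inter> coord_space (- (T \<union> T')) = {0}"
  proof -
    have "coord_space (- (T \<union> T')) = coord_space (- T) \<inter> coord_space (- T')"
      by (simp add: coord_space_Int)
    then show ?thesis using T(3) T'(3) by (simp add: Int_assoc[symmetric])
  qed
  moreover have "T \<union> T' \<subseteq> {1..2 * n + 1}" using T(1) T'(1) q by auto
  ultimately show ?thesis using T T'
    by (intro that[of "T \<union> T'"]) (auto simp: card_Un_disjoint Int_commute)
qed

text \<open>The bound is written with \<open>m\<close> on the right to avoid truncated subtraction;
  for \<open>m \<ge> k\<close> the locus is all of \<open>IG n k\<close>.\<close>

definition flag_locus :: "nat \<Rightarrow> nat \<Rightarrow> nat \<Rightarrow> cvec set set" where
  "flag_locus n k m = {V \<in> IG n k. k \<le> cv.dim (V \<inter> coord_space {1..k + 1}) + m}"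

lemma eval_poly_variable:
  "eval_poly (Poly_Mapping.single (Poly_Mapping.single I 1) 1) p = p I"
  by (simp add: eval_poly_def)

text \<open>Fewer than \<open>k - m\<close> elements of \<open>I\<close> are at most
  \<open>k + 1\<close>, so they cannot detect all of
  \<open>V \<inter> coord_space {1..k + 1}\<close>. A nonzero vector killed by them vanishes at the
  other elements of \<open>I\<close> automatically.\<close>

lemma flag_locus_plucker_zero:
  assumes V: "V \<in> flag_locus n k m" and p: "plucker n k V p"
    and I: "I \<subseteq> {1..2 * n + 1}" "card I = k" "m < card (I - {1..k + 1})"
  shows "p I = 0"
proof -
  let ?U = "V \<inter> coord_space {1..k + 1}"
  have U: "fin_subspace ?U" using V by (intro fin_subspace_Int IG_fin_subspace) (auto simp: flag_locus_def)
  have fI: "finite I" using I finite_subset by blast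
  let ?K = "?U \<inter> {v. \<forall>i\<in>I \<inter> {1..k + 1}. v i = 0}"
  have "cv.dim ?U \<le> cv.dim ?K + card (I \<inter> {1..k + 1})"
    using U fI by (intro dim_common_ker linear_form_coord) auto
  moreover have "card (I \<inter> {1..k + 1}) + card (I - {1..k + 1}) = k"
    using card_Int_Diff[OF fI] I(2) by simp
  ultimately have "cv.dim ?K > 0" using V I(3) by (auto simp: flag_locus_def)
  moreover have "?K = ?U \<inter> coord_space (- (I \<inter> {1..k + 1}))" by (simp only: coord_space_compl)
  then have "fin_subspace ?K" using fin_subspace_Int[OF U] by simp
  ultimately obtain v where v: "v \<in> ?K" "v \<noteq> 0" using nonzero_of_dim by blast
  have "v i = 0" if "i \<in> I" for i
    using v(1) that by (cases "i \<in> {1..k + 1}") (auto simp: coord_space_def)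
  then have "v \<in> coord_space (- I)" by (simp add: in_coord_space_compl)
  then show ?thesis using v plucker_eq_0_iff[OF p I(1,2)] by blast
qed

text \<open>An adapted index set gives a nonzero Pluecker coordinate whose number of columns beyond
  \<open>k + 1\<close> is exactly the codimension of the intersection in \<open>V\<close>.\<close>

lemma flag_locus_of_plucker_zero:
  assumes V: "V \<in> IG n k" and p: "plucker n k V p" and k: "k \<le> n"
    and zero: "\<And>I. I \<subseteq> {1..2 * n + 1} \<Longrightarrow> card I = k \<Longrightarrow> m < card (I - {1..k + 1}) \<Longrightarrow> p I = 0"
  shows "V \<in> flag_locus n k m"
proof -
  have V': "cv.subspace V" "V \<subseteq> E_odd n" "cv.dim V = k" using V by (auto simp: IG_def)
  have q: "k + 1 \<le> 2 * n + 1" using k by simp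
  obtain I where I: "I \<subseteq> {1..2 * n + 1}" "card I = cv.dim V"
    "V \<inter> coord_space (- I) = {0}" "card (I \<inter> {1..k + 1}) = cv.dim (V \<inter> coord_space {1..k + 1})"
    by (rule adapted_index_set[OF V'(1,2) q])
  have "p I \<noteq> 0" using plucker_eq_0_iff[OF p I(1)] I(2,3) V'(3) by auto
  then have "\<not> m < card (I - {1..k + 1})" using zero I V'(3) by auto
  moreover have "card (I \<inter> {1..k + 1}) + card (I - {1..k + 1}) = k"
    using card_Int_Diff[of I] I(1,2) V'(3) finite_subset[of I "{1..2 * n + 1}"] by simp
  ultimately show ?thesis using V I(4) by (auto simp: flag_locus_def)
qed

lemma zariski_closed_flag_locus:
  assumes "k \<le> n"
  shows "zariski_closed n k (flag_locus n k m)"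
proof -
  let ?F = "{Poly_Mapping.single (Poly_Mapping.single I 1) 1 :: nat set cpoly | I.
    I \<subseteq> {1..2 * n + 1} \<and> card I = k \<and> m < card (I - {1..k + 1})}"
  have "\<forall>f\<in>?F. homogeneous f" by (auto simp: homogeneous_def)
  moreover have "flag_locus n k m =
      {V \<in> IG n k. \<forall>p. plucker n k V p \<longrightarrow> (\<forall>f\<in>?F. eval_poly f p = 0)}"
  proof (intro equalityI subsetI)
    fix V assume "V \<in> flag_locus n k m"
    then show "V \<in> {V \<in> IG n k. \<forall>p. plucker n k V p \<longrightarrow> (\<forall>f\<in>?F. eval_poly f p = 0)}"
      using flag_locus_plucker_zero[of V n k m]
      by (auto simp: eval_poly_variable[unfolded One_nat_def] flag_locus_def)
  next
    fix V assume V: "V \<in> {V \<in> IG n k. \<forall>p. plucker n k V p \<longrightarrow> (\<forall>f\<in>?F. eval_poly f p = 0)}"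
    obtain b where b: "frame k b V"
      using V frame_exists[OF IG_fin_subspace, of V n k k] by (auto simp: IG_def)
    let ?p = "\<lambda>I. if I \<subseteq> {1..2 * n + 1} \<and> card I = k then minor k b I else 0"
    have p: "plucker n k V ?p" by (rule plucker_frame[OF b])
    have z: "?p I = 0" if "I \<subseteq> {1..2 * n + 1}" "card I = k" "m < card (I - {1..k + 1})" for I
    proof -
      have "eval_poly (Poly_Mapping.single (Poly_Mapping.single I 1) 1) ?p = 0"
        using V p that by blast
      then show ?thesis by (simp add: eval_poly_variable[unfolded One_nat_def])
    qed
    have "V \<in> IG n k" using V by blast
    then show "V \<in> flag_locus n k m" by (rule flag_locus_of_plucker_zero[OF _ p assms z])
  qed
  ultimately show ?thesis unfolding zariski_closed_def by blast
qed

section \<open>Schubert varieties are flag loci\<close>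

lemma frame_snoc:
  assumes b: "frame r b V" and v: "v \<notin> V"
  shows "frame (Suc r) (\<lambda>a. if a < r then b a else v) (cv.span (insert v V))"
proof -
  let ?b = "\<lambda>a. if a < r then b a else v"
  have V: "fin_subspace V" by (rule frame_fin_subspace[OF b])
  have eq: "(\<Sum>a<Suc r. cscale (x a) (?b a)) = (\<Sum>a<r. cscale (x a) (b a)) + cscale (x r) v" for x
    by (simp add: sum.cong[of "{..<r}" "{..<r}" "\<lambda>a. cscale (x a) (?b a)" "\<lambda>a. cscale (x a) (b a)"])
  have 1: "frame (Suc r) ?b (cv.span (?b ` {..<Suc r}))"
  proof (rule frameI)
    fix x assume z: "(\<Sum>a<Suc r. cscale (x a) (?b a)) = 0"
    have "x r = 0"
    proof (rule ccontr)
      assume ne: "x r \<noteq> 0"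
      have "cscale (x r) v = - (\<Sum>a<r. cscale (x a) (b a))"
        using z unfolding eq by (simp add: eq_neg_iff_add_eq_0 add.commute)
      also have "\<dots> \<in> V"
        using cv.subspace_neg[OF fin_subspace_subspace[OF V] frame_sum_in[OF b]] .
      finally have "cscale (1 / x r) (cscale (x r) v) \<in> V"
        by (rule cv.subspace_scale[OF fin_subspace_subspace[OF V]])
      then show False using ne v by simp
    qed
    then show "\<forall>a<Suc r. x a = 0"
      using z frame_zero[OF b, of x] unfolding eq by (auto simp: less_Suc_eq)
  qed
  have "?b ` {..<Suc r} = insert v (b ` {..<r})" by (auto simp: lessThan_Suc)
  moreover have "cv.span (insert v (b ` {..<r})) = cv.span (insert v V)"
  proof (rule cv.span_eq[THEN iffD2], intro conjI)
    show "insert v (b ` {..<r}) \<subseteq> cv.span (insert v V)"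
      using frame_in[OF b] by (auto intro: cv.span_base)
    have "V \<subseteq> cv.span (insert v (b ` {..<r}))"
      using b cv.span_mono[of "b ` {..<r}" "insert v (b ` {..<r})"] by (auto simp: frame_def)
    then show "insert v V \<subseteq> cv.span (insert v (b ` {..<r}))" by (auto intro: cv.span_base)
  qed
  ultimately show ?thesis using 1 by simp
qed

text \<open>The second interval consists of the \<open>bar n j\<close> with \<open>j\<close> in
  \<open>2..m + 1\<close>: the first \<open>m\<close> entries of \<open>2, ..., k + 1\<close> have
  been negated. It is empty for \<open>m = 0\<close>.\<close>

definition schubert_index :: "nat \<Rightarrow> nat \<Rightarrow> nat \<Rightarrow> nat set" where
  "schubert_index n k m = {m + 2..k + 1} \<union> {2 * n + 2 - m..2 * n + 1}"

locale schubert =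
  fixes n k m :: nat
  assumes mk: "m \<le> k" and kn: "k \<le> n"
begin

abbreviation "II \<equiv> schubert_index n k m"
abbreviation "QQ \<equiv> {m + 2..k + 1}"
abbreviation "FF \<equiv> coord_space {1..k + 1}"

lemma finite_II: "finite II"
  by (simp add: schubert_index_def)

lemma II_subset: "II \<subseteq> {2..2 * n + 1}"
  using mk kn by (auto simp: schubert_index_def)

lemma card_II: "card II = k"
proof -
  have "{m + 2..k + 1} \<inter> {2 * n + 2 - m..2 * n + 1} = {}" using mk kn by auto
  then show ?thesis using mk kn by (simp add: schubert_index_def card_Un_disjoint)
qed

lemma II_isotropic: "i \<in> II \<Longrightarrow> bar n i \<notin> II"
  using mk kn by (auto simp: schubert_index_def bar_def)

lemma bar_II: "bar n ` II = {2..m + 1} \<union> {2 * n + 2 - k..2 * n + 1 - m}"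
proof (intro equalityI subsetI)
  fix j assume "j \<in> {2..m + 1} \<union> {2 * n + 2 - k..2 * n + 1 - m}"
  then have "bar n j \<in> II" "j = bar n (bar n j)" using mk kn by (auto simp: schubert_index_def bar_def)
  then show "j \<in> bar n ` II" by blast
qed (use mk kn in \<open>auto simp: schubert_index_def bar_def\<close>)

lemma FF_isotropic: "v \<in> FF \<Longrightarrow> w \<in> FF \<Longrightarrow> omega n v w = 0"
  by (erule (1) omega_coord_space) (use mk kn in \<open>auto simp: bar_def\<close>)

lemma FF_subset_E_odd: "FF \<subseteq> E_odd n"
  unfolding E_odd_eq using kn by (intro coord_space_mono) auto

lemma coord_space_II_in_flag_locus: "coord_space II \<in> flag_locus n k m"
proof -
  have "omega n v w = 0" if "v \<in> coord_space II" "w \<in> coord_space II" for v w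
    using that by (rule omega_coord_space) (use II_isotropic in auto)
  then have "coord_space II \<in> IG n k"
    using II_subset by (auto simp: IG_def dim_coord_space finite_II card_II E_odd_eq
        intro!: coord_space_mono)
  moreover have "II \<inter> {1..k + 1} = QQ" using mk kn by (auto simp: schubert_index_def)
  then have "cv.dim (coord_space II \<inter> FF) = k - m"
    unfolding coord_space_Int by (simp add: dim_coord_space)
  ultimately show ?thesis by (simp add: flag_locus_def)
qed

text \<open>Upper triangular maps send \<open>FF\<close> into itself, so the intersection with
  \<open>FF\<close> cannot lose dimension.\<close>

lemma Borel_flag_locus:
  assumes g: "g \<in> Borel n" and V: "V \<in> flag_locus n k m"
  shows "g ` V \<in> flag_locus n k m"
proof -
  have lin: "Vector_Spaces.linear cscale cscale g" and bij: "bij_betw g (E_odd n) (E_odd n)"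
    and om: "\<And>v w. v \<in> E_odd n \<Longrightarrow> w \<in> E_odd n \<Longrightarrow> omega n (g v) (g w) = omega n v w"
    and up: "\<And>j i. j \<in> {1..2 * n + 1} \<Longrightarrow> i > j \<Longrightarrow> g (basis_vec j) i = 0"
    using g by (auto simp: Borel_def Sp_odd_def)
  interpret g: Vector_Spaces.linear cscale cscale g by (rule lin)
  have VE: "V \<subseteq> E_odd n" and VI: "V \<in> IG n k" using V by (auto simp: flag_locus_def IG_def)
  have inj: "inj_on g V" using bij VE by (auto simp: bij_betw_def intro: inj_on_subset)
  have "g ` V \<in> IG n k"
    using VI lin inj
  proof (rule IG_image)
    show "g ` V \<subseteq> E_odd n" using bij_betwE[OF bij] VE by blast
    show "omega n (g v) (g w) = omega n v w" if "v \<in> V" "w \<in> V" for v w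
      using om that VE by blast
  qed
  moreover have "g v \<in> FF" if v: "v \<in> FF" for v
  proof -
    have gE: "g (basis_vec j) \<in> E_odd n" if "j \<in> {1..k + 1}" for j
      using bij that kn by (intro bij_betwE[OF bij, rule_format]) (auto simp: E_odd_eq)
    have "g (basis_vec j) \<in> FF" if j: "j \<in> {1..k + 1}" for j
      unfolding coord_space_def
    proof safe
      fix i assume "i \<notin> {1..k + 1}"
      then show "g (basis_vec j) i = 0"
        using gE[OF j] up[of j i] j kn by (cases "i = 0") (auto simp: E_odd_eq coord_space_def)
    qed
    then have "(\<Sum>i\<in>{1..k + 1}. cscale (v i) (g (basis_vec i))) \<in> FF"
      by (intro cv.subspace_sum cv.subspace_scale) auto
    moreover have "g v = (\<Sum>i\<in>{1..k + 1}. cscale (v i) (g (basis_vec i)))"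
      by (subst coord_expand[OF _ v]) (simp_all only: g.sum g.scale finite_atLeastAtMost)
    ultimately show ?thesis by simp
  qed
  then have "g ` (V \<inter> FF) \<subseteq> g ` V \<inter> FF" by auto
  moreover have "cv.dim (g ` (V \<inter> FF)) = cv.dim (V \<inter> FF)"
    by (rule dim_image[OF fin_subspace_Int[OF IG_fin_subspace[OF VI]] lin])
       (use inj in \<open>auto intro: inj_on_subset\<close>)
  moreover have "fin_subspace (g ` V \<inter> FF)"
    using IG_fin_subspace[OF \<open>g ` V \<in> IG n k\<close>] by (rule fin_subspace_Int) simp
  ultimately have "cv.dim (V \<inter> FF) \<le> cv.dim (g ` V \<inter> FF)"
    using dim_mono[of "g ` V \<inter> FF" "g ` (V \<inter> FF)"] by simp
  then show ?thesis using \<open>g ` V \<in> IG n k\<close> V by (auto simp: flag_locus_def)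
qed

end

section \<open>The open chart lies in a single Borel orbit\<close>

lemma omega_sum_sum:
  "omega n (\<Sum>i\<in>S. cscale (v i) (b i)) (\<Sum>j\<in>S. cscale (w j) (b j)) =
   (\<Sum>i\<in>S. \<Sum>j\<in>S. v i * w j * omega n (b i) (b j))"
  by (subst linear_form_sum[OF linear_form_omega_left], subst linear_form_sum[OF linear_form_omega_right])
    (simp add: sum_distrib_left mult.assoc)

text \<open>Triangularity with ones on the diagonal makes the linear extension injective on
  \<open>E_odd n\<close>, and agreement of the Gram matrices makes it an isometry.\<close>

lemma Borel_of_family:
  assumes E: "\<And>i. i \<in> {1..2 * n + 1} \<Longrightarrow> b i \<in> E_odd n"
    and diag: "\<And>i. i \<in> {1..2 * n + 1} \<Longrightarrow> b i i = 1"
    and up: "\<And>i j. i \<in> {1..2 * n + 1} \<Longrightarrow> j > i \<Longrightarrow> b i j = 0"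
    and om: "\<And>i j. i \<in> {1..2 * n + 1} \<Longrightarrow> j \<in> {1..2 * n + 1} \<Longrightarrow>
      omega n (b i) (b j) = omega n (basis_vec i) (basis_vec j)"
  obtains g where "g \<in> Borel n" "\<And>i. i \<in> {1..2 * n + 1} \<Longrightarrow> g (basis_vec i) = b i"
proof
  let ?N = "{1..2 * n + 1}"
  define g where "g v = (\<Sum>i\<in>?N. cscale (v i) (b i))" for v
  have lin: "Vector_Spaces.linear cscale cscale g"
    unfolding Vector_Spaces.linear_iff g_def
    by (auto simp: cv.vector_space_axioms sum.distrib[symmetric] cv.scale_right_distrib
        cv.scale_left_distrib cv.scale_sum_right) (auto simp: cscale_def fun_eq_iff mult.assoc)
  interpret g: Vector_Spaces.linear cscale cscale g by (rule lin)
  show gb: "g (basis_vec i) = b i" if i: "i \<in> ?N" for i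
  proof -
    have "g (basis_vec i) = (\<Sum>j\<in>?N. if i = j then b j else 0)"
      unfolding g_def by (rule sum.cong) (auto simp: basis_vec_def cscale_def)
    also have "\<dots> = b i" using i by (subst sum.delta') auto
    finally show ?thesis .
  qed
  have gE: "g v \<in> E_odd n" for v
    unfolding g_def using E by (intro cv.subspace_sum cv.subspace_scale) (auto simp: E_odd_eq)
  have ker: "v = 0" if v: "v \<in> E_odd n" "g v = 0" for v
  proof (rule ccontr)
    assume "v \<noteq> 0"
    let ?S = "{i \<in> ?N. v i \<noteq> 0}"
    have "?S \<noteq> {}" using v(1) \<open>v \<noteq> 0\<close> by (auto simp: E_odd_eq coord_space_def fun_eq_iff)
    \<comment> \<open>At the largest index of the support of \<open>v\<close>, only the summand with
      that index contributes to \<open>g v\<close>.\<close>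
    define i where "i = Max ?S"
    have i: "i \<in> ?S" unfolding i_def using \<open>?S \<noteq> {}\<close> by (intro Max_in) auto
    have mx: "v j = 0" if "j > i" "j \<in> ?N" for j
    proof (rule ccontr)
      assume "v j \<noteq> 0"
      then have "j \<le> i" unfolding i_def using that by (intro Max_ge) auto
      then show False using that by simp
    qed
    have "g v i = (\<Sum>j\<in>?N. if i = j then v j else 0)"
      unfolding g_def cvec_sum_apply
    proof (rule sum.cong)
      fix j assume j: "j \<in> ?N"
      show "cscale (v j) (b j) i = (if i = j then v j else 0)"
        using mx[of j] up[of j i] diag[of j] j by (cases i j rule: linorder_cases) (auto simp: cscale_def)
    qed simp
    also have "\<dots> = v i" using i by (subst sum.delta') auto
    finally show False using i v(2) by simp
  qed
  have inj: "inj_on g (E_odd n)"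
  proof (rule inj_onI)
    fix v w assume vw: "v \<in> E_odd n" "w \<in> E_odd n" "g v = g w"
    have "v - w \<in> E_odd n" using vw by (auto simp: E_odd_eq intro: cv.subspace_diff)
    moreover have "g (v - w) = 0" using vw by (simp add: g.diff)
    ultimately show "v = w" using ker[of "v - w"] by simp
  qed
  have "g ` E_odd n = E_odd n"
  proof (rule dim_eq_imp_eq[OF fin_subspace_E_odd])
    show "cv.subspace (g ` E_odd n)" by (rule g.subspace_image) (simp add: E_odd_eq)
    show "cv.dim (E_odd n) \<le> cv.dim (g ` E_odd n)"
      using dim_image[OF fin_subspace_E_odd lin inj] by simp
  qed (use gE in auto)
  then have bij: "bij_betw g (E_odd n) (E_odd n)" using inj by (simp add: bij_betw_def)
  have "omega n (g v) (g w) = omega n v w" if "v \<in> E_odd n" "w \<in> E_odd n" for v w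
  proof -
    have "v = (\<Sum>i\<in>?N. cscale (v i) (basis_vec i))" "w = (\<Sum>i\<in>?N. cscale (w i) (basis_vec i))"
      using that by (auto simp only: E_odd_eq intro!: coord_expand)
    then have "omega n v w = (\<Sum>i\<in>?N. \<Sum>j\<in>?N. v i * w j * omega n (basis_vec i) (basis_vec j))"
      using omega_sum_sum[of n v basis_vec ?N w] by simp
    then show ?thesis unfolding g_def omega_sum_sum using om by (auto intro!: sum.cong)
  qed
  then show "g \<in> Borel n" using lin bij gb up by (auto simp: Borel_def Sp_odd_def)
qed

text \<open>Requiring zeros on \<open>J - {i}\<close> leaves a nonzero vector by counting. Since
  \<open>J\<close> detects \<open>W\<close>, its coordinate at \<open>i\<close> is nonzero and can
  be scaled to \<open>1\<close>.\<close>

lemma normalized_vector: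
  assumes W: "fin_subspace W" and J: "finite J" "card J \<le> cv.dim W" "i \<in> J"
    and inj: "\<And>v. v \<in> W \<Longrightarrow> \<forall>j\<in>J. v j = 0 \<Longrightarrow> v = 0"
  obtains v where "v \<in> W" "v i = 1" "\<And>j. j \<in> J - {i} \<Longrightarrow> v j = 0"
proof -
  let ?K = "W \<inter> {v. \<forall>j\<in>J - {i}. v j = 0}"
  have "cv.dim W \<le> cv.dim ?K + card (J - {i})"
    using W J by (intro dim_common_ker linear_form_coord) auto
  moreover have "card (J - {i}) < card J" using J(1,3) by (intro card_Diff1_less)
  ultimately have "cv.dim ?K > 0" using J(2) by linarith
  moreover have "fin_subspace ?K" using fin_subspace_Int[OF W, of "coord_space (- (J - {i}))"]
    by (simp only: coord_space_compl subspace_coord_space[of "- (J - {i})", unfolded coord_space_compl])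
  ultimately obtain v where v: "v \<in> ?K" "v \<noteq> 0" using nonzero_of_dim by blast
  then have "v i \<noteq> 0" using inj[of v] by blast
  moreover have "cscale (1 / v i) v \<in> W"
    using v(1) W by (intro cv.subspace_scale) (auto simp: fin_subspace_def)
  ultimately show ?thesis using v(1) by (intro that[of "cscale (1 / v i) v"]) (auto simp: cscale_def)
qed

context schubert
begin

text \<open>The vectors \<open>b a\<close> normalized at \<open>II\<close> are the images of the \<open>basis_vec a\<close> with \<open>a \<in> II\<close> under the
  group element sought. It fixes the basis vectors at \<open>1\<close> and at \<open>bar n ` II\<close>, and the correction \<open>c r\<close>
  of the remaining ones is forced by \<open>omega n (basis_vec r + c r) (b a) = 0\<close>.\<close>

lemma chart_in_orbit:
  assumes V: "V \<in> flag_locus n k m" and chart: "V \<inter> coord_space (- II) = {0}"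
  obtains g where "g \<in> Borel n" "V = g ` coord_space II"
proof -
  have VI: "V \<in> IG n k" using V by (simp add: flag_locus_def)
  have V': "fin_subspace V" "V \<subseteq> E_odd n" "cv.dim V = k" "cv.subspace V"
    and iso: "\<And>v w. v \<in> V \<Longrightarrow> w \<in> V \<Longrightarrow> omega n v w = 0"
    using VI IG_fin_subspace[OF VI] by (auto simp: IG_def)
  \<comment> \<open>For \<open>i\<close> in \<open>QQ\<close> the vector is taken in
    \<open>V \<inter> FF\<close>. This gives upper triangularity: an index above \<open>i\<close> is
    then either in \<open>II\<close>, where the normalization gives zero, or beyond
    \<open>k + 1\<close>.\<close>
  have "\<exists>v. v \<in> V \<and> v i = 1 \<and> (\<forall>j\<in>II - {i}. v j = 0) \<and> (i \<in> QQ \<longrightarrow> v \<in> FF)"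
    if i: "i \<in> II" for i
  proof (cases "i \<in> QQ")
    case True
    have fF: "fin_subspace (V \<inter> FF)" using V'(1) by (rule fin_subspace_Int) simp
    have dF: "card QQ \<le> cv.dim (V \<inter> FF)" using V mk by (auto simp: flag_locus_def)
    have z: "v j = 0" if "v \<in> V \<inter> FF" "j \<in> II - QQ" for v j
      using that mk kn by (auto simp: schubert_index_def coord_space_def)
    have inj: "v = 0" if v: "v \<in> V \<inter> FF" "\<forall>j\<in>QQ. v j = 0" for v
    proof -
      have "v j = 0" if "j \<in> II" for j using z[OF v(1), of j] v(2) that by (cases "j \<in> QQ") auto
      then have "v \<in> V \<inter> coord_space (- II)" using v(1) by (auto simp: in_coord_space_compl)
      then show ?thesis using chart by blast
    qed
    obtain v where v: "v \<in> V \<inter> FF" "v i = 1" "\<And>j. j \<in> QQ - {i} \<Longrightarrow> v j = 0"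
      using normalized_vector[OF fF _ dF True inj] by blast
    have "v j = 0" if "j \<in> II - {i}" for j
      using z[OF v(1), of j] v(3)[of j] that by (cases "j \<in> QQ") auto
    then show ?thesis using v by blast
  next
    case False
    have inj: "v = 0" if "v \<in> V" "\<forall>j\<in>II. v j = 0" for v
    proof -
      have "v \<in> V \<inter> coord_space (- II)" using that by (simp add: in_coord_space_compl)
      then show ?thesis using chart by blast
    qed
    have "card II \<le> cv.dim V" using V'(3) card_II by simp
    then obtain v where "v \<in> V" "v i = 1" "\<And>j. j \<in> II - {i} \<Longrightarrow> v j = 0"
      using normalized_vector[OF V'(1) finite_II _ i inj] by blast
    then show ?thesis using False by blast
  qed
  then obtain b where b: "\<And>i. i \<in> II \<Longrightarrow> b i \<in> V" "\<And>i. i \<in> II \<Longrightarrow> b i i = 1"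
    "\<And>i j. i \<in> II \<Longrightarrow> j \<in> II - {i} \<Longrightarrow> b i j = 0" "\<And>i. i \<in> II \<Longrightarrow> i \<in> QQ \<Longrightarrow> b i \<in> FF"
    by metis
  \<comment> \<open>The indices split into \<open>II\<close>, the set \<open>?W\<close> of
    \<open>1\<close> and the partners of \<open>II\<close>, and the remaining middle block
    \<open>?R\<close>, which is closed under \<open>bar n\<close>.\<close>
  let ?P = "{2..m + 1}" and ?P' = "{2 * n + 2 - m..2 * n + 1}" and ?R = "{k + 2..2 * n + 1 - k}"
  let ?N = "{1..2 * n + 1}" and ?W = "insert 1 (bar n ` II)"
  \<comment> \<open>Only \<open>a\<close> in \<open>?P'\<close> enters. For \<open>a\<close> in
    \<open>QQ\<close> the vector \<open>b a\<close> lies in \<open>FF\<close>, which is orthogonal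
    both to the basis vectors of \<open>?R\<close> and to the correction, as the latter lives on
    \<open>?P\<close>.\<close>
  define c where "c r = (\<Sum>a\<in>?P'. cscale (- omega n (basis_vec r) (b a)) (basis_vec (bar n a)))" for r
  define B where "B i = (if i \<in> II then b i else if i \<in> ?R then basis_vec i + c i else basis_vec i)" for i
  have parts: "i \<in> II \<or> i \<in> ?R \<or> i \<in> ?W" if "i \<in> ?N" for i
    using that mk kn unfolding bar_II by (auto simp: schubert_index_def)
  have disj: "?W \<inter> II = {}" "?R \<inter> II = {}" "?W \<inter> ?R = {}" "?P \<subseteq> ?W" "?W \<subseteq> ?N" "?R \<subseteq> ?N"
    using mk kn unfolding bar_II by (auto simp: schubert_index_def)
  have cP: "c r \<in> coord_space ?P" for r
    unfolding c_def using mk kn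
    by (intro cv.subspace_sum cv.subspace_scale subspace_coord_space) (auto simp: bar_def)
  \<comment> \<open>The partners of \<open>?W\<close> are \<open>II\<close> and
    \<open>2 * n + 2\<close>, so vectors supported on \<open>?W\<close> are orthogonal to those
    supported on \<open>T\<close>. Since \<open>b a - basis_vec a\<close> is supported on
    \<open>T\<close>, replacing \<open>basis_vec a\<close> by \<open>b a\<close> is invisible to
    \<open>?W\<close>.\<close>
  define T where "T = ?N - II"
  have WT: "omega n v w = 0" if "v \<in> coord_space ?W" "w \<in> coord_space T" for v w
    using that by (rule omega_coord_space) (use II_subset in \<open>auto simp: T_def bar_def\<close>)
  have TW: "omega n w v = 0" if "v \<in> coord_space ?W" "w \<in> coord_space T" for v w
    using WT[OF that] omega_skew[of n w v] by simp
  have PT: "coord_space ?P \<subseteq> coord_space T" "coord_space ?P \<subseteq> coord_space ?W"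
  proof -
    have "?P \<subseteq> ?N - II" using mk kn by (auto simp: schubert_index_def)
    then show "coord_space ?P \<subseteq> coord_space T" unfolding T_def by (rule coord_space_mono)
    show "coord_space ?P \<subseteq> coord_space ?W" using disj(4) by (rule coord_space_mono)
  qed
  have RT: "basis_vec r \<in> coord_space T" if "r \<in> ?R" for r
    unfolding T_def basis_vec_in_coord_space using disj(2,6) that by (metis DiffI disjoint_iff subsetD)
  have dT: "b a - basis_vec a \<in> coord_space T" if a: "a \<in> II" for a
    unfolding coord_space_def T_def
  proof (rule CollectI, intro allI impI)
    fix i assume i: "i \<notin> ?N - II"
    have "b a i = 0" if "i \<notin> ?N"
      using b(1)[OF a] V'(2) that by (auto simp: E_odd_eq coord_space_def)
    moreover have "i \<noteq> a" if "i \<notin> ?N" using a II_subset that by auto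
    ultimately show "(b a - basis_vec a) i = 0"
      using i b(2)[OF a] b(3)[OF a, of i] by (cases "i \<in> ?N") (auto simp: basis_vec_def)
  qed
  have om_ba: "omega n w (b a) = omega n w (basis_vec a)" if "a \<in> II" "w \<in> coord_space ?W" for a w
    using WT[OF that(2) dT[OF that(1)]] by (simp add: linear_form_diff[OF linear_form_omega_right])
  have cT: "c r \<in> coord_space T" and cW: "c r \<in> coord_space ?W" for r
    using cP[of r] PT by blast+
  have BR: "B r = basis_vec r + c r" if "r \<in> ?R" for r
    using that disj(2) by (auto simp: B_def)
  have BW: "omega n (basis_vec i) (B j) = omega n (basis_vec i) (basis_vec j)" if i: "i \<in> ?W" for i j
  proof -
    have "basis_vec i \<in> coord_space ?W" using i unfolding basis_vec_in_coord_space .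
    then show ?thesis using om_ba[of j "basis_vec i"] WT[OF _ cT] by (simp add: B_def omega_add_right)
  qed
  have RR: "omega n (B r) (B s) = omega n (basis_vec r) (basis_vec s)" if "r \<in> ?R" "s \<in> ?R" for r s
    using WT[OF cW RT[OF that(2)], of r] WT[OF cW cT, of r s] TW[OF cW RT[OF that(1)], of s]
    by (simp add: BR[OF that(1)] BR[OF that(2)] omega_bilinear)
  have RI: "omega n (B r) (B a) = omega n (basis_vec r) (basis_vec a)" if r: "r \<in> ?R" and a: "a \<in> II" for r a
  proof -
    have "omega n (basis_vec r) (basis_vec a) = 0"
      by (rule omega_coord_space[of _ "{r}" _ "{a}"])
         (use r a mk kn in \<open>auto simp: bar_def schubert_index_def\<close>)
    moreover have "omega n (basis_vec r + c r) (b a) = 0"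
    proof (cases "a \<in> QQ")
      case True
      then have ba: "b a \<in> FF" using b(4) a by blast
      have "omega n (basis_vec r) (b a) = 0"
        by (rule omega_coord_space[OF _ ba, of _ "{r}"]) (use r mk kn in \<open>auto simp: bar_def\<close>)
      moreover have "omega n (c r) (b a) = 0"
        by (rule omega_coord_space[OF cP ba]) (use mk kn in \<open>auto simp: bar_def\<close>)
      ultimately show ?thesis by (simp add: omega_bilinear)
    next
      case False
      then have a': "a \<in> ?P'" using a by (auto simp: schubert_index_def)
      have "omega n (c r) (b a) = omega n (c r) (basis_vec a)"
        by (rule om_ba[OF a cW])
      also have "\<dots> = (\<Sum>e\<in>?P'. - omega n (basis_vec r) (b e) *
          omega n (basis_vec (bar n e)) (basis_vec a))"
        unfolding c_def by (rule linear_form_sum[OF linear_form_omega_left])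
      also have "\<dots> = (\<Sum>e\<in>?P'. if e = a then - omega n (basis_vec r) (b e) else 0)"
      proof (rule sum.cong)
        fix e assume e: "e \<in> ?P'"
        have "omega n (basis_vec (bar n e)) (basis_vec a) = (if e = a then 1 else 0)"
          using e a' mk kn by (subst omega_basis_vec_left) (auto simp: bar_def basis_vec_def)
        then show "- omega n (basis_vec r) (b e) * omega n (basis_vec (bar n e)) (basis_vec a) =
            (if e = a then - omega n (basis_vec r) (b e) else 0)" by simp
      qed simp
      also have "\<dots> = - omega n (basis_vec r) (b a)" using a' by (subst sum.delta) auto
      finally show ?thesis by (simp add: omega_bilinear)
    qed
    ultimately show ?thesis using a by (simp add: BR[OF r]) (simp add: B_def)
  qed
  have II': "omega n (B a) (B e) = omega n (basis_vec a) (basis_vec e)" if "a \<in> II" "e \<in> II" for a e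
  proof -
    have "omega n (basis_vec a) (basis_vec e) = 0"
      by (rule omega_coord_space[of _ II _ II]) (use that II_isotropic in auto)
    then show ?thesis using iso b(1) that by (auto simp: B_def)
  qed
  have BWeq: "B i = basis_vec i" if "i \<in> ?W" for i
    using that disj by (auto simp: B_def)
  have "omega n (B i) (B j) = omega n (basis_vec i) (basis_vec j)" if i: "i \<in> ?N" and j: "j \<in> ?N" for i j
  proof -
    consider "i \<in> ?W" | "j \<in> ?W" | "i \<in> ?R" "j \<in> ?R" | "i \<in> ?R" "j \<in> II" | "i \<in> II" "j \<in> ?R"
      | "i \<in> II" "j \<in> II"
      using parts[OF i] parts[OF j] by blast
    then show ?thesis
    proof cases
      case 1
      then show ?thesis using BW BWeq by metis
    next
      case 2
      then have "omega n (B j) (B i) = omega n (basis_vec j) (basis_vec i)" using BW BWeq by metis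
      then show ?thesis using omega_skew[of n "B i"] omega_skew[of n "basis_vec i"] by metis
    next
      case 5
      then have "omega n (B j) (B i) = omega n (basis_vec j) (basis_vec i)" using RI by blast
      then show ?thesis using omega_skew[of n "B i"] omega_skew[of n "basis_vec i"] by metis
    qed (use RR RI II' in blast)+
  qed
  moreover have "B i \<in> E_odd n" if "i \<in> ?N" for i
  proof -
    have "c i \<in> E_odd n" using cP[of i] coord_space_mono[of ?P ?N] kn mk by (auto simp: E_odd_eq)
    then show ?thesis using that b(1) V'(2)
      by (auto simp: B_def E_odd_eq intro!: cv.subspace_add)
  qed
  moreover have "B i i = 1" if "i \<in> ?N" for i
  proof -
    have "c i i = 0" if "i \<in> ?R" using cP[of i] that mk by (auto simp: coord_space_def)
    then show ?thesis using b(2) by (auto simp: B_def basis_vec_def)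
  qed
  moreover have "B i j = 0" if i: "i \<in> ?N" and j: "j > i" for i j
  proof (cases "i \<in> II")
    case True
    show ?thesis
    proof (cases "j \<in> II")
      case True
      then show ?thesis using \<open>i \<in> II\<close> b(3)[of i j] j by (auto simp: B_def)
    next
      case False
      then have "b i j = 0"
      proof (cases "i \<in> QQ")
        case True
        have "j > k + 1" using True False j by (auto simp: schubert_index_def)
        then show ?thesis using b(4)[OF \<open>i \<in> II\<close> True] by (auto simp: coord_space_def)
      next
        case F: False
        have "j \<notin> ?N" using F False \<open>i \<in> II\<close> j by (auto simp: schubert_index_def)
        then show ?thesis using b(1)[OF \<open>i \<in> II\<close>] V'(2) by (auto simp: E_odd_eq coord_space_def)
      qed
      then show ?thesis using \<open>i \<in> II\<close> by (simp add: B_def)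
    qed
  next
    case False
    have "c i j = 0" if "i \<in> ?R" using cP[of i] that mk j by (auto simp: coord_space_def)
    then show ?thesis using False j by (auto simp: B_def basis_vec_def)
  qed
  ultimately obtain g where g: "g \<in> Borel n" "\<And>i. i \<in> ?N \<Longrightarrow> g (basis_vec i) = B i"
    using Borel_of_family[of n B] by blast
  have lin: "Vector_Spaces.linear cscale cscale g" and bij: "bij_betw g (E_odd n) (E_odd n)"
    using g(1) by (auto simp: Borel_def Sp_odd_def)
  interpret g: Vector_Spaces.linear cscale cscale g by (rule lin)
  have IE: "coord_space II \<subseteq> E_odd n"
    unfolding E_odd_eq using II_subset by (intro coord_space_mono) auto
  have "g ` coord_space II = V"
  proof (rule dim_eq_imp_eq[OF V'(1)])
    have "g (basis_vec i) \<in> V" if "i \<in> II" for i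
      using that g(2)[of i] II_subset b(1) by (auto simp: B_def)
    then have "g ` (basis_vec ` II) \<subseteq> V" by blast
    then have "cv.span (g ` (basis_vec ` II)) \<subseteq> V" using V'(4) by (rule cv.span_minimal)
    then show "g ` coord_space II \<subseteq> V"
      by (simp add: g.span_image span_basis_vec finite_II)
    show "cv.subspace (g ` coord_space II)" by (rule g.subspace_image) simp
    have "inj_on g (coord_space II)" using bij IE by (auto simp: bij_betw_def intro: inj_on_subset)
    then show "cv.dim V \<le> cv.dim (g ` coord_space II)"
      using dim_image[OF fin_subspace_coord_space[OF finite_II] lin] V'(3)
      by (simp add: dim_coord_space finite_II card_II)
  qed
  then show ?thesis using g(1) that by blast
qed

end

text \<open>The image of a fixed frame under the transvections is affine in \<open>t\<close> and
  gives back \<open>V\<close> at \<open>0\<close>. To show that \<open>V\<close> lies in a closed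
  set it thus suffices to treat its proper translates.\<close>

lemma transvection_limit:
  assumes C: "zariski_closed n k C" and V: "V \<in> IG n k"
    and xy: "x \<in> E_odd n" "y \<in> E_odd n" "omega n x y = 0"
    and gen: "\<And>t. t \<noteq> 0 \<Longrightarrow> transvection n x y t ` V \<in> IG n k \<Longrightarrow> transvection n x y t ` V \<in> C"
  shows "V \<in> C"
proof -
  have VE: "V \<subseteq> E_odd n" "cv.dim V = k" using V by (auto simp: IG_def)
  obtain b where b: "frame k b V" using frame_exists[OF IG_fin_subspace[OF V] VE(2)] by blast
  let ?T = "transvection n x y"
  have "?T 0 ` V = V" by (auto simp: transvection_def)
  moreover have "?T 0 ` V \<in> C"
  proof (rule zariski_closed_limit[OF C])
    show "?T 0 ` V \<in> IG n k" using V calculation by simp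
    show "frame k (\<lambda>a. b a + cscale t (cscale (omega n x (b a)) y + cscale (omega n y (b a)) x)) (?T t ` V)" for t
      using frame_image[OF b linear_transvection inj_on_subset[OF inj_transvection[OF xy(3)] subset_UNIV]]
      by (simp add: transvection_def comp_def)
    show "?T t ` V \<in> C" if "t \<noteq> 0" for t
    proof (rule gen[OF that])
      show "?T t ` V \<in> IG n k"
        using V linear_transvection inj_on_subset[OF inj_transvection[OF xy(3)] subset_UNIV]
        by (rule IG_image)
           (use VE(1) xy in \<open>auto simp: omega_transvection intro: transvection_in_E_odd\<close>)
    qed
  qed
  ultimately show ?thesis by simp
qed

lemma basis_vec_1_notin_transvection:
  assumes "x \<in> E_odd n" "y \<in> E_odd n" "omega n x y = 0" "basis_vec 1 \<notin> V"
  shows "basis_vec 1 \<notin> transvection n x y t ` V"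
proof
  assume "basis_vec 1 \<in> transvection n x y t ` V"
  then obtain v where "v \<in> V" "transvection n x y t v = transvection n x y t (basis_vec 1)"
    unfolding transvection_basis_vec_1[OF assms(1,2)] by auto
  then show False using injD[OF inj_transvection[OF assms(3)]] assms(4) by blast
qed

lemma ex_perp_nonzero:
  assumes "finite S" "S \<subseteq> {1..2 * n + 2}" "fin_subspace U" "cv.dim U = card S"
    and x: "x \<in> U" "x \<noteq> 0" "x \<in> coord_space (- S)"
  obtains y where "y \<noteq> 0" "y \<in> coord_space (bar n ` S)" "y \<in> perp n U"
proof -
  let ?A = "coord_space (bar n ` S)"
  have inj: "inj_on (bar n) S" using assms(2) by (intro inj_on_inverseI[of _ "bar n"]) (auto simp: bar_def)
  have A: "fin_subspace ?A" using assms(1) by (intro fin_subspace_coord_space) simp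
  have K: "fin_subspace (U \<inter> coord_space (- S))" using assms(3) by (rule fin_subspace_Int) simp
  have "cv.dim ?A + cv.dim (U \<inter> coord_space (- S)) \<le> cv.dim (?A \<inter> perp n U) + cv.dim U"
  proof (rule dim_perp[OF A assms(3) K])
    fix a v assume "a \<in> ?A" "v \<in> U \<inter> coord_space (- S)"
    then show "omega n a v = 0"
      by (intro omega_coord_space[of a "bar n ` S" v "- S"]) (use assms(2) in \<open>auto simp: bar_def\<close>)
  qed simp
  moreover have "cv.dim ?A = cv.dim U"
    using assms(1,4) inj by (simp add: dim_coord_space card_image)
  moreover have "cv.dim {0} < cv.dim (U \<inter> coord_space (- S))"
    by (rule dim_less[OF K cv.subspace_single_0, of x])
       (use x cv.subspace_0[OF fin_subspace_subspace[OF K]] in auto)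
  ultimately have "cv.dim (?A \<inter> perp n U) > 0" by linarith
  moreover have "fin_subspace (?A \<inter> perp n U)" using A subspace_perp by (rule fin_subspace_Int)
  ultimately obtain y where "y \<in> ?A \<inter> perp n U" "y \<noteq> 0" using nonzero_of_dim by blast
  then show ?thesis using that by blast
qed

lemma omega_bar_coord_space:
  assumes "S \<subseteq> {1..2 * n + 2}" "y \<in> coord_space (bar n ` S)" "v \<in> coord_space (- S)"
  shows "omega n y v = 0"
  using assms(2,3) by (rule omega_coord_space) (use assms(1) in \<open>auto simp: bar_def\<close>)

lemma subspace_scale_notin:
  assumes "cv.subspace V" "v \<notin> V" "cscale c v \<in> V"
  shows "c = 0"
proof (rule ccontr)
  assume "c \<noteq> 0"
  then have "v = cscale (1 / c) (cscale c v)" by simp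
  also have "\<dots> \<in> V" by (rule cv.subspace_scale[OF assms(1,3)])
  finally show False using assms(2) by simp
qed

context schubert
begin

text \<open>Induction on the dimension of the kernel of the projection of \<open>V\<close> to the coordinates \<open>II\<close>. The form
  with \<open>y\<close> depends only on these coordinates and kills \<open>V\<close>, so the transvection along \<open>z\<close> moves the
  kernel vector \<open>x\<close> to a vector with a new projection. It fixes \<open>U\<close>, because \<open>z\<close> is perpendicular
  to \<open>U\<close>.\<close>

lemma generic_second_step:
  assumes C: "zariski_closed n k C"
    and chart: "\<And>V. V \<in> flag_locus n k m \<Longrightarrow> V \<inter> coord_space (- II) = {0} \<Longrightarrow> V \<in> C"
    and "V \<in> IG n k" "basis_vec 1 \<notin> V" "U \<subseteq> V"
    and U: "cv.subspace U" "U \<subseteq> FF" "cv.dim U = k - m" "U \<inter> coord_space (- QQ) = {0}"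
  shows "V \<in> C"
  using assms(3-5)
proof (induction "cv.dim (V \<inter> coord_space (- II))" arbitrary: V rule: less_induct)
  case less
  have V: "fin_subspace V" "cv.subspace V" "V \<subseteq> E_odd n" "cv.dim V = k"
    using less.prems(1) IG_fin_subspace by (auto simp: IG_def)
  have fU: "fin_subspace U" using V(1) U(1) less.prems(3) by (rule fin_subspace_mono)
  have IIN: "II \<subseteq> {1..2 * n + 2}" using II_subset by auto
  have K: "fin_subspace (V \<inter> coord_space (- II))" using V(1) by (rule fin_subspace_Int) simp
  show ?case
  proof (cases "V \<inter> coord_space (- II) = {0}")
    case True
    have "cv.dim U \<le> cv.dim (V \<inter> FF)"
      using V(1) less.prems(3) U(2) by (intro dim_mono fin_subspace_Int) auto
    then have "V \<in> flag_locus n k m" using U(3) less.prems(1) by (auto simp: flag_locus_def)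
    then show ?thesis using chart True by blast
  next
    case False
    then obtain x where x: "x \<in> V" "x \<noteq> 0" "x \<in> coord_space (- II)"
      using cv.subspace_0[OF V(2)] cv.subspace_0[OF subspace_coord_space] by blast
    obtain y where y: "y \<noteq> 0" "y \<in> coord_space (bar n ` II)" "y \<in> perp n V"
      by (rule ex_perp_nonzero[OF finite_II IIN V(1) _ x]) (simp add: V(4) card_II)
    have QI: "QQ \<subseteq> II" by (simp add: schubert_index_def)
    have "bar n ` II \<subseteq> {1..2 * n + 1}" unfolding bar_II using mk kn by auto
    then have xy: "x \<in> E_odd n" "y \<in> E_odd n"
      using x(1) V(3) y(2) coord_space_mono unfolding E_odd_eq by blast+
    \<comment> \<open>\<open>U\<close> is detected by \<open>QQ\<close>, where \<open>x\<close>
      vanishes; so \<open>x\<close> would be a multiple of the first basis vector, which is not in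
      \<open>V\<close>.\<close>
    have nx: "x \<noteq> u + cscale c (basis_vec 1)" if u: "u \<in> U" for u c
    proof
      assume eq: "x = u + cscale c (basis_vec 1)"
      have "u i = 0" if i: "i \<in> QQ" for i
        using fun_cong[OF eq, of i] x(3) i QI by (auto simp: in_coord_space_compl basis_vec_def cscale_def)
      then have "u = 0" using U(4) u in_coord_space_compl[of u QQ] by blast
      then have "x = cscale c (basis_vec 1)" using eq by simp
      then show False using subspace_scale_notin[OF V(2) less.prems(2), of c] x(1,2) by auto
    qed
    have ny: "y \<noteq> u + cscale c (basis_vec 1)" if u: "u \<in> U" for u c
    proof
      assume eq: "y = u + cscale c (basis_vec 1)"
      have yz: "y i = 0" if "i \<notin> bar n ` II" for i using y(2) that by (auto simp: coord_space_def)
      have "u i = 0" if i: "i \<in> QQ" for i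
      proof -
        have "i \<notin> bar n ` II" unfolding bar_II using i mk kn by auto
        then show ?thesis using fun_cong[OF eq, of i] yz[of i] i by (auto simp: basis_vec_def cscale_def)
      qed
      then have "u = 0" using U(4) u in_coord_space_compl[of u QQ] by blast
      then have eq': "y = cscale c (basis_vec 1)" using eq by simp
      have "1 \<notin> bar n ` II" unfolding bar_II using kn by auto
      then have "c = 0" using fun_cong[OF eq', of 1] yz[of 1] by (auto simp: basis_vec_def cscale_def)
      then show False using eq' y(1) by simp
    qed
    obtain z where z: "z \<in> E_odd n" "z \<in> perp n U" "omega n z x \<noteq> 0" "omega n z y \<noteq> 0"
      using perp_avoiding_two[OF fU _ xy nx ny] less.prems(3) V(3) by blast
    show ?thesis
    proof (rule transvection_limit[OF C less.prems(1) z(1) z(1) omega_self])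
      fix t :: complex assume t: "t \<noteq> 0"
      let ?T = "transvection n z z t"
      assume IG: "?T ` V \<in> IG n k"
      show "?T ` V \<in> C"
      proof (rule less.hyps)
        have "?T u = u" if "u \<in> U" for u using z(2) that by (simp add: transvection_def perp_def)
        then show "U \<subseteq> ?T ` V" using less.prems(3) by (metis image_eqI subsetD subsetI)
        show "basis_vec 1 \<notin> ?T ` V"
          by (rule basis_vec_1_notin_transvection[OF z(1) z(1) omega_self less.prems(2)])
        show "cv.dim (?T ` V \<inter> coord_space (- II)) < cv.dim (V \<inter> coord_space (- II))"
        proof (rule dim_less[OF K])
          \<comment> \<open>Pairing \<open>w = ?T v\<close> with \<open>y\<close> gives
            \<open>0 = 2 * t * omega n z v * omega n y z\<close>. So \<open>omega n z v\<close>
            vanishes and \<open>w = v\<close>: no new kernel vector arises, and \<open>x\<close>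
            drops out.\<close>
          have "w \<in> V \<and> omega n z w = 0" if w: "w \<in> ?T ` V" "w \<in> coord_space (- II)" for w
          proof -
            obtain v where v: "v \<in> V" "w = ?T v" using w(1) by blast
            have "omega n y w = 0" by (rule omega_bar_coord_space[OF IIN y(2) w(2)])
            moreover have "omega n y v = 0" using y(3) v(1) by (simp add: perp_def)
            moreover have "omega n y w =
                omega n y v + t * (omega n z v * omega n y z + omega n z v * omega n y z)"
              by (simp only: v(2) transvection_def omega_bilinear)
            ultimately have "omega n z v = 0"
              using z(4) t omega_skew[of n y z] by auto
            then show ?thesis using v by (simp add: transvection_def)
          qed
          then show "?T ` V \<inter> coord_space (- II) \<subseteq> V \<inter> coord_space (- II)"
            "x \<notin> ?T ` V \<inter> coord_space (- II)" using z(3) by blast+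
          show "cv.subspace (?T ` V \<inter> coord_space (- II))"
            using IG by (intro cv.subspace_inter) (auto simp: IG_def)
        qed (use x in auto)
      qed (use IG in auto)
    qed
  qed
qed

text \<open>The kernel of the projection of \<open>U\<close> to the coordinates \<open>QQ\<close> is
  reduced in the same manner, but \<open>U\<close> must stay inside \<open>FF\<close>. Hence one of
  the two vectors of the transvection is a basis vector of \<open>FF\<close>: it is orthogonal to
  \<open>U\<close>, so \<open>U\<close> moves only along it. The other vector is chosen to be
  nonzero on the kernel vector \<open>x\<close>.\<close>

lemma generic_first_step:
  assumes C: "zariski_closed n k C"
    and chart: "\<And>V. V \<in> flag_locus n k m \<Longrightarrow> V \<inter> coord_space (- II) = {0} \<Longrightarrow> V \<in> C"
    and "V \<in> IG n k" "basis_vec 1 \<notin> V" "U \<subseteq> V" "cv.subspace U" "U \<subseteq> FF" "cv.dim U = k - m"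
  shows "V \<in> C"
  using assms(3-8)
proof (induction "cv.dim (U \<inter> coord_space (- QQ))" arbitrary: V U rule: less_induct)
  case less
  have V: "fin_subspace V" "cv.subspace V" "V \<subseteq> E_odd n" "cv.dim V = k"
    using less.prems(1) IG_fin_subspace by (auto simp: IG_def)
  have fU: "fin_subspace U" using V(1) less.prems(4,3) by (rule fin_subspace_mono)
  have QQN: "QQ \<subseteq> {1..2 * n + 2}" "finite QQ" using mk kn by auto
  have K: "fin_subspace (U \<inter> coord_space (- QQ))" using fU by (rule fin_subspace_Int) simp
  show ?case
  proof (cases "U \<inter> coord_space (- QQ) = {0}")
    case True
    then show ?thesis using generic_second_step[OF C chart] less.prems by blast
  next
    case False
    then obtain x where x: "x \<in> U" "x \<noteq> 0" "x \<in> coord_space (- QQ)"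
      using cv.subspace_0[OF less.prems(4)] cv.subspace_0[OF subspace_coord_space] by blast
    obtain y where y: "y \<noteq> 0" "y \<in> coord_space (bar n ` QQ)" "y \<in> perp n U"
      by (rule ex_perp_nonzero[OF QQN(2,1) fU _ x]) (simp add: less.prems(6))
    \<comment> \<open>A nonzero coordinate \<open>j\<close> of \<open>y\<close> has its partner
      \<open>i\<close> in \<open>QQ\<close>, so \<open>y\<close> pairs nontrivially with the basis
      vector at \<open>i\<close>, which lies in \<open>FF\<close>.\<close>
    obtain j where j: "y j \<noteq> 0" using y(1) by (auto simp: fun_eq_iff)
    define i where "i = bar n j"
    have "j \<in> bar n ` QQ" using j y(2) by (auto simp: coord_space_def)
    then have i: "i \<in> QQ" "bar n i = j" using QQN(1) by (auto simp: i_def bar_def)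
    let ?z = "basis_vec i"
    have zF: "?z \<in> FF" and zE: "?z \<in> E_odd n" using i(1) mk kn by (auto simp: E_odd_eq)
    have yz: "omega n y ?z \<noteq> 0"
      unfolding omega_skew[of n y] using i QQN(1) j by (subst omega_basis_vec_left) auto
    have nx: "x \<noteq> u + cscale c (basis_vec 1)" if u: "u \<in> cv.span {?z}" for u c
    proof
      assume eq: "x = u + cscale c (basis_vec 1)"
      obtain a where a: "u = cscale a ?z" using u by (auto simp: cv.span_singleton)
      have "x i = 0" using x(3) i(1) by (auto simp: in_coord_space_compl)
      then have "a = 0" using fun_cong[OF eq, of i] a i(1) by (auto simp: basis_vec_def cscale_def)
      then have "x = cscale c (basis_vec 1)" using eq a by simp
      then show False
        using subspace_scale_notin[OF V(2) less.prems(2), of c] x(1,2) less.prems(3) by auto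
    qed
    have xE: "x \<in> E_odd n" using x(1) less.prems(3) V(3) by blast
    have zs: "cv.span {?z} \<subseteq> E_odd n" using zE by (intro cv.span_minimal) (auto simp: E_odd_eq)
    obtain z' where z': "z' \<in> E_odd n" "z' \<in> perp n (cv.span {?z})" "omega n z' x \<noteq> 0"
      using perp_avoiding_two[OF fin_subspace_span zs xE xE nx nx] by blast
    have zz': "omega n ?z z' = 0"
      using z'(2) cv.span_base[of ?z "{?z}"] omega_skew[of n ?z z'] by (simp add: perp_def)
    show ?thesis
    proof (rule transvection_limit[OF C less.prems(1) zE z'(1) zz'])
      fix t :: complex assume t: "t \<noteq> 0"
      let ?T = "transvection n ?z z' t"
      assume IG: "?T ` V \<in> IG n k"
      have T: "?T u = u + cscale (t * omega n z' u) ?z" if "u \<in> U" for u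
        using FF_isotropic[OF zF, of u] that less.prems(5) by (auto simp: transvection_def)
      have inj: "inj_on ?T U" using inj_transvection[OF zz'] by (rule inj_on_subset) simp
      have sub: "cv.subspace (?T ` U)"
        using dim_image(1)[OF fU linear_transvection inj] by (simp add: fin_subspace_def)
      show "?T ` V \<in> C"
      proof (rule less.hyps)
        show "?T ` U \<subseteq> ?T ` V" using less.prems(3) by blast
        show "?T ` U \<subseteq> FF" using T zF less.prems(5)
          by (auto intro!: cv.subspace_add cv.subspace_scale)
        show "cv.dim (?T ` U) = k - m"
          using dim_image(2)[OF fU linear_transvection inj] less.prems(6) by simp
        show "basis_vec 1 \<notin> ?T ` V"
          by (rule basis_vec_1_notin_transvection[OF zE z'(1) zz' less.prems(2)])
        show "cv.dim (?T ` U \<inter> coord_space (- QQ)) < cv.dim (U \<inter> coord_space (- QQ))"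
        proof (rule dim_less[OF K])
          have "w \<in> U \<and> omega n z' w = 0" if w: "w \<in> ?T ` U" "w \<in> coord_space (- QQ)" for w
          proof -
            obtain u where u: "u \<in> U" "w = ?T u" using w(1) by blast
            have "omega n y w = 0" by (rule omega_bar_coord_space[OF QQN(1) y(2) w(2)])
            moreover have "omega n y u = 0" using y(3) u(1) by (simp add: perp_def)
            ultimately have "omega n z' u = 0"
              using yz t by (auto simp: u(2) T[OF u(1)] omega_bilinear)
            then show ?thesis using u T[OF u(1)] by simp
          qed
          then show "?T ` U \<inter> coord_space (- QQ) \<subseteq> U \<inter> coord_space (- QQ)"
            "x \<notin> ?T ` U \<inter> coord_space (- QQ)" using z'(3) by blast+
          show "cv.subspace (?T ` U \<inter> coord_space (- QQ))"
            using sub by (intro cv.subspace_inter) auto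
        qed (use x in auto)
      qed (use IG sub in auto)
    qed
  qed
qed

end

text \<open>Since the flag space is isotropic, \<open>H\<close> imposes at most
  \<open>dim H - dim (H \<inter> coord_space {1..k + 1})\<close> conditions on it. The assumption
  \<open>dim\<close> says that the solutions outnumber the part of \<open>V\<close> in the flag
  space.\<close>

lemma ex_flag_perp:
  assumes V: "V \<in> IG n k" and H: "cv.subspace H" "H \<subseteq> V" and k: "k \<le> n"
    and dim: "cv.dim (V \<inter> coord_space {1..k + 1}) + cv.dim H < k + 1 + cv.dim (H \<inter> coord_space {1..k + 1})"
  obtains z where "z \<in> coord_space {1..k + 1}" "z \<in> perp n H" "z \<notin> V"
proof -
  let ?F = "coord_space {1..k + 1}"
  have F: "fin_subspace ?F" by (rule fin_subspace_coord_space) simp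
  have fV: "fin_subspace V" by (rule IG_fin_subspace[OF V])
  have fH: "fin_subspace H" by (rule fin_subspace_mono[OF fV H])
  have "cv.dim ?F + cv.dim (H \<inter> ?F) \<le> cv.dim (?F \<inter> perp n H) + cv.dim H"
  proof (rule dim_perp[OF F fH])
    show "fin_subspace (H \<inter> ?F)" using fH by (rule fin_subspace_Int) simp
    show "omega n a v = 0" if "a \<in> ?F" "v \<in> H \<inter> ?F" for a v
      by (rule omega_coord_space[of a "{1..k + 1}" v "{1..k + 1}"]) (use that k in \<open>auto simp: bar_def\<close>)
  qed simp
  moreover have "cv.dim ?F = k + 1" by (simp add: dim_coord_space)
  ultimately have "cv.dim (V \<inter> ?F) < cv.dim (?F \<inter> perp n H)" using dim by linarith
  moreover have "fin_subspace (V \<inter> ?F)" using fV by (rule fin_subspace_Int) simp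
  ultimately have "\<not> ?F \<inter> perp n H \<subseteq> V \<inter> ?F" using dim_mono by (meson leD)
  then show ?thesis using that by blast
qed

context schubert
begin

text \<open>The first basis vector spans the kernel of the form on \<open>E_odd n\<close>, hence no isometry moves it out
  of \<open>V\<close>; it is replaced by its sum with a multiple of a vector of \<open>FF\<close> perpendicular to \<open>V\<close>.\<close>

lemma flag_locus_subset_closed:
  assumes C: "zariski_closed n k C"
    and chart: "\<And>V. V \<in> flag_locus n k m \<Longrightarrow> V \<inter> coord_space (- II) = {0} \<Longrightarrow> V \<in> C"
  shows "flag_locus n k m \<subseteq> C"
proof
  have no_kernel: "V \<in> C" if V: "V \<in> flag_locus n k m" and e: "basis_vec 1 \<notin> V" for V
  proof -
    have IG: "V \<in> IG n k" and d: "k - m \<le> cv.dim (V \<inter> FF)" using V by (auto simp: flag_locus_def)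
    have "fin_subspace (V \<inter> FF)" using IG_fin_subspace[OF IG] by (rule fin_subspace_Int) simp
    then obtain U where "cv.subspace U" "U \<subseteq> V \<inter> FF" "cv.dim U = k - m"
      using subspace_choose_dim d by blast
    then show ?thesis using generic_first_step[OF C chart IG e] by blast
  qed
  fix V assume V: "V \<in> flag_locus n k m"
  show "V \<in> C"
  proof (cases "basis_vec 1 \<in> V")
    case False
    then show ?thesis by (rule no_kernel[OF V])
  next
    case e: True
    let ?e = "basis_vec 1"
    have IG: "V \<in> IG n k" using V by (auto simp: flag_locus_def)
    have V': "fin_subspace V" "cv.subspace V" "V \<subseteq> E_odd n" "cv.dim V = k"
      and iso: "\<And>v w. v \<in> V \<Longrightarrow> w \<in> V \<Longrightarrow> omega n v w = 0"
      using IG IG_fin_subspace by (auto simp: IG_def)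
    \<comment> \<open>With \<open>H = V\<close> the required inequality reduces to
      \<open>k < k + 1\<close>.\<close>
    obtain z where z: "z \<in> FF" "z \<in> perp n V" "z \<notin> V"
      using ex_flag_perp[OF IG V'(2) order_refl kn] V'(4) by auto
    have lf: "linear_form (\<lambda>v. v 1)" by (rule linear_form_coord)
    define W where "W = V \<inter> {v. v 1 = 0}"
    have fW: "fin_subspace W" unfolding W_def using V'(1) subspace_ker[OF lf] by (rule fin_subspace_Int)
    note W = fW fin_subspace_subspace[OF fW]
    have e1: "basis_vec (Suc 0) (Suc 0) = 1" by (simp add: basis_vec_def)
    have dW: "cv.dim V = cv.dim W + 1"
      unfolding W_def by (rule dim_ker_nonzero[OF V'(1) lf e]) (simp add: e1)
    obtain b where b: "frame (cv.dim W) b W" using frame_exists[OF W(1)] by blast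
    have kW: "k = Suc (cv.dim W)" using dW V'(4) by simp
    define X where "X t = cv.span (insert (?e + cscale t z) W)" for t
    have new: "?e + cscale t z \<notin> W" for t
    proof
      assume a: "?e + cscale t z \<in> W"
      then have "(?e + cscale t z) - ?e \<in> V" using e V'(2) by (intro cv.subspace_diff) (auto simp: W_def)
      then have "cscale t z \<in> V" by simp
      then have "t = 0" by (rule subspace_scale_notin[OF V'(2) z(3)])
      then show False using a e1 by (auto simp: W_def cscale_def)
    qed
    have fr: "frame k (\<lambda>a. if a < cv.dim W then b a else ?e + cscale t z) (X t)" for t
      unfolding X_def kW by (rule frame_snoc[OF b new])
    have zE: "z \<in> E_odd n" using z(1) FF_subset_E_odd by blast
    have XIG: "X t \<in> IG n k" for t
    proof (rule IG_I[OF fr])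
      fix a assume "a < k"
      then show "(if a < cv.dim W then b a else ?e + cscale t z) \<in> E_odd n"
        using frame_in[OF b, of a] V'(3) e zE
        by (auto simp: W_def E_odd_eq intro!: cv.subspace_add cv.subspace_scale)
    next
      fix i j assume ij: "i < j" "j < k"
      then have bi: "b i \<in> V" using frame_in[OF b, of i] kW by (auto simp: W_def)
      have "omega n (b i) z = 0" using z(2) bi omega_skew[of n "b i" z] by (auto simp: perp_def)
      then show "omega n (if i < cv.dim W then b i else ?e + cscale t z)
          (if j < cv.dim W then b j else ?e + cscale t z) = 0"
        using ij kW iso[OF bi] frame_in[OF b, of j] e by (auto simp: omega_bilinear W_def)
    qed
    have X0: "X 0 = V"
    proof (rule dim_eq_imp_eq[OF V'(1)])
      show "X 0 \<subseteq> V" unfolding X_def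
        by (rule cv.span_minimal) (use e V'(2) in \<open>auto simp: W_def\<close>)
      show "cv.subspace (X 0)" by (simp add: X_def)
      show "cv.dim V \<le> cv.dim (X 0)" using frame_dim[OF fr] V'(4) by simp
    qed
    have "X t \<in> C" if t: "t \<noteq> 0" for t
    proof (rule no_kernel)
      have eF: "?e + cscale t z \<in> FF" using z(1) by (intro cv.subspace_add cv.subspace_scale) auto
      have fWF: "fin_subspace (W \<inter> FF)" using W(1) by (rule fin_subspace_Int) simp
      \<comment> \<open>The dimension lost in \<open>FF\<close> by passing from \<open>V\<close> to
        \<open>W\<close> is regained by the new vector \<open>?e + cscale t z\<close>, which also
        lies in \<open>FF\<close>.\<close>
      have "cv.dim (V \<inter> FF) = cv.dim (V \<inter> FF \<inter> {v. v 1 = 0}) + 1"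
        by (rule dim_ker_nonzero[OF fin_subspace_Int[OF V'(1)] lf, where v = ?e]) (use e e1 in auto)
      also have "V \<inter> FF \<inter> {v. v 1 = 0} = W \<inter> FF" by (auto simp: W_def)
      also have "cv.dim (W \<inter> FF) + 1 = cv.dim (cv.span (insert (?e + cscale t z) (W \<inter> FF)))"
        by (rule dim_insert[OF fWF, symmetric]) (use new in blast)
      also have "\<dots> \<le> cv.dim (X t \<inter> FF)"
      proof (rule dim_mono)
        show "fin_subspace (X t \<inter> FF)" using IG_fin_subspace[OF XIG] by (rule fin_subspace_Int) simp
        show "cv.span (insert (?e + cscale t z) (W \<inter> FF)) \<subseteq> X t \<inter> FF"
        proof (rule cv.span_minimal)
          show "insert (?e + cscale t z) (W \<inter> FF) \<subseteq> X t \<inter> FF"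
            using eF by (auto simp: X_def intro: cv.span_base)
        qed (auto simp: X_def intro: cv.subspace_inter)
      qed
      finally show "X t \<in> flag_locus n k m" using V XIG by (auto simp: flag_locus_def)
      \<comment> \<open>Otherwise \<open>?e - cscale c (?e + cscale t z)\<close> lies in
        \<open>W\<close> for some \<open>c\<close>. As \<open>z\<close> is outside \<open>V\<close>
        this forces \<open>c = 0\<close>, but the first coordinate of \<open>?e\<close> is not
        zero.\<close>
      show "?e \<notin> X t"
      proof
        assume "?e \<in> X t"
        then obtain c where "?e - cscale c (?e + cscale t z) \<in> cv.span W"
          by (auto simp: X_def cv.span_breakdown_eq)
        then have c: "?e - cscale c (?e + cscale t z) \<in> W" using cv.span_eq_iff[THEN iffD2, OF W(2)] by simp
        then have c1: "?e - cscale c (?e + cscale t z) \<in> V" by (simp add: W_def)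
        have c2: "?e - cscale c ?e \<in> V"
          by (intro cv.subspace_diff[OF V'(2)] cv.subspace_scale[OF V'(2)] e)
        have "?e - cscale c ?e - (?e - cscale c (?e + cscale t z)) \<in> V"
          by (rule cv.subspace_diff[OF V'(2) c2 c1])
        then have "cscale (c * t) z \<in> V" by (simp add: cv.scale_right_distrib)
        then have "c = 0" using subspace_scale_notin[OF V'(2) z(3)] t by fastforce
        then show False using c e1 by (auto simp: W_def)
      qed
    qed
    then have "X 0 \<in> C"
    proof (rule zariski_closed_limit[OF C XIG, rotated])
      have eq: "(\<lambda>a. (if a < cv.dim W then b a else ?e) + cscale t (if a < cv.dim W then 0 else z)) =
          (\<lambda>a. if a < cv.dim W then b a else ?e + cscale t z)" for t by auto
      show "frame k (\<lambda>a. (if a < cv.dim W then b a else ?e) +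
          cscale t (if a < cv.dim W then 0 else z)) (X t)" for t
        unfolding eq by (rule fr)
    qed
    then show ?thesis using X0 by simp
  qed
qed

lemma schubert_variety_eq:
  assumes w: "w ` {1..k} = II"
  shows "schubert_variety n k w = flag_locus n k m"
proof -
  have "(\<lambda>j. basis_vec (w j)) ` {1..k} = basis_vec ` II" using w by (metis image_image)
  then have span: "cv.span ((\<lambda>j. basis_vec (w j)) ` {1..k}) = coord_space II"
    by (simp only: span_basis_vec[OF finite_II])
  let ?O = "(\<lambda>g. g ` coord_space II) ` Borel n"
  have "zariski_closed n k hull ?O \<subseteq> flag_locus n k m"
  proof (rule hull_minimal)
    show "?O \<subseteq> flag_locus n k m"
      using Borel_flag_locus[OF _ coord_space_II_in_flag_locus] by blast
  qed (rule zariski_closed_flag_locus[OF kn])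
  moreover have "flag_locus n k m \<subseteq> zariski_closed n k hull ?O"
    unfolding hull_def
  proof (rule Inter_greatest)
    fix C assume "C \<in> {t. zariski_closed n k t \<and> ?O \<subseteq> t}"
    then show "flag_locus n k m \<subseteq> C"
      by (intro flag_locus_subset_closed) (auto elim: chart_in_orbit)
  qed
  ultimately show ?thesis unfolding schubert_variety_def span by blast
qed

end

section \<open>The degree bound\<close>

text \<open>The factor is the sign of the permutation that sorts the columns. It depends on
  \<open>c\<close> alone, so it is the same for all frames.\<close>

lemma det_columns:
  assumes c: "inj_on c {..<k}"
  shows "\<exists>\<epsilon> :: complex. \<forall>b. det (mat k k (\<lambda>(a, l). b a (c l))) = \<epsilon> * minor k b (c ` {..<k})"
proof -
  define J where "J = c ` {..<k}"
  define L where "L = sorted_list_of_set J"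
  have L: "length L = k" "set L = J" "distinct L"
    using c by (auto simp: L_def J_def card_image)
  have "\<exists>i<k. L ! i = c l" if "l < k" for l
    using that L by (metis J_def imageI in_set_conv_nth lessThan_iff)
  then obtain q where q: "\<And>l. l < k \<Longrightarrow> q l < k \<and> L ! q l = c l" by metis
  define p where "p l = (if l < k then q l else l)" for l
  have inj: "inj_on p {0..<k}"
  proof (rule inj_onI)
    fix i j assume ij: "i \<in> {0..<k}" "j \<in> {0..<k}" "p i = p j"
    then have "c i = c j" using q[of i] q[of j] by (simp add: p_def)
    then show "i = j" using c ij by (auto dest: inj_onD)
  qed
  have "p ` {0..<k} \<subseteq> {0..<k}" using q by (auto simp: p_def)
  then have "bij_betw p {0..<k} {0..<k}" using inj by (simp add: bij_betw_def endo_inj_surj)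
  then have p: "p permutes {0..<k}" by (rule bij_imp_permutes) (auto simp: p_def)
  have "det (mat k k (\<lambda>(a, l). b a (c l))) = signof p * minor k b J" for b :: "nat \<Rightarrow> cvec"
  proof -
    let ?A = "mat k k (\<lambda>(l, a). b a (L ! l))"
    have "mat k k (\<lambda>(a, l). b a (c l)) = transpose_mat (mat k k (\<lambda>(i, j). ?A $$ (p i, j)))"
      by (rule eq_matI) (use q in \<open>auto simp: p_def\<close>)
    moreover have "det (transpose_mat (mat k k (\<lambda>(i, j). ?A $$ (p i, j)))) = signof p * det ?A"
      by (subst det_transpose[of _ k]) (auto intro: det_permute_rows[OF _ p])
    moreover have "?A = transpose_mat (mat k k (\<lambda>(a, l). b a (L ! l)))"
      by (rule eq_matI) auto
    then have "det ?A = minor k b J" by (simp add: det_transpose[of _ k] minor_def L_def)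
    ultimately show ?thesis by simp
  qed
  then show ?thesis unfolding J_def by blast
qed

text \<open>The reduced matrix of \<open>V\<close> in the affine chart at \<open>I\<close>: its
  entries off \<open>I\<close> are the local coordinates of \<open>V\<close>.\<close>

definition normalized_frame :: "nat \<Rightarrow> nat set \<Rightarrow> cvec set \<Rightarrow> (nat \<Rightarrow> cvec) \<Rightarrow> bool" where
  "normalized_frame k I V b \<longleftrightarrow> (\<forall>a<k. b a \<in> V \<and>
     (\<forall>l<k. b a (sorted_list_of_set I ! l) = (if l = a then 1 else 0)))"

lemma normalized_frame_exists:
  assumes V: "fin_subspace V" "cv.dim V = k" and I: "finite I" "card I = k"
    and inj: "\<And>v. v \<in> V \<Longrightarrow> v \<in> coord_space (- I) \<Longrightarrow> v = 0"
  obtains b where "normalized_frame k I V b"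
proof -
  let ?L = "sorted_list_of_set I"
  have L: "length ?L = k" "set ?L = I" "distinct ?L" using I by auto
  have "\<exists>v. v \<in> V \<and> (\<forall>l<k. v (?L ! l) = (if l = a then 1 else 0))" if a: "a < k" for a
  proof -
    have i: "?L ! a \<in> I" using L a nth_mem[of a ?L] by simp
    have "card I \<le> cv.dim V" using V I by simp
    then obtain v where v: "v \<in> V" "v (?L ! a) = 1" "\<And>j. j \<in> I - {?L ! a} \<Longrightarrow> v j = 0"
      using normalized_vector[OF V(1) I(1) _ i] inj in_coord_space_compl by blast
    have "v (?L ! l) = (if l = a then 1 else 0)" if "l < k" for l
      using v(2) v(3)[of "?L ! l"] that a L nth_mem[of l ?L] nth_eq_iff_index_eq[OF L(3), of l a] by auto
    then show ?thesis using v(1) by blast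
  qed
  then obtain b where "\<And>a. a < k \<Longrightarrow> b a \<in> V \<and> (\<forall>l<k. b a (?L ! l) = (if l = a then 1 else 0))"
    by metis
  then show ?thesis by (intro that[of b]) (simp add: normalized_frame_def)
qed

lemma plucker_normalized_frame:
  assumes p: "plucker n k V p" and b: "normalized_frame k J V b"
    and J: "J \<subseteq> {1..2 * n + 1}" "card J = k" and I: "I \<subseteq> {1..2 * n + 1}" "card I = k"
  shows "p I = p J * minor k b I"
proof -
  obtain c where c: "\<And>I. I \<subseteq> {1..2 * n + 1} \<Longrightarrow> card I = k \<Longrightarrow> minor k b I = c * p I"
    using plucker_scalar[OF p, of b] b by (auto simp: normalized_frame_def)
  have "mat k k (\<lambda>(a, l). b a (sorted_list_of_set J ! l)) = 1\<^sub>m k"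
    by (rule eq_matI) (use b in \<open>auto simp: normalized_frame_def\<close>)
  then have "minor k b J = 1" by (simp add: minor_def)
  then have "c * p J = 1" using c[OF J] by simp
  then show ?thesis using c[OF I] by (metis mult.assoc mult.commute mult_1_left)
qed

text \<open>A chart coordinate is, up to a constant, a quotient of Pluecker coordinates, because
  exchanging one column of the identity block leaves a single entry as determinant. The factor is
  chosen before \<open>V\<close>, \<open>p\<close> and \<open>b\<close>, so along a curve every
  entry becomes a quotient of polynomials.\<close>

lemma normalized_frame_entry:
  assumes J: "J \<subseteq> {1..2 * n + 1}" "card J = k" and a: "a < k" and j: "j \<in> {1..2 * n + 1} - J"
  shows "\<exists>\<epsilon>. \<forall>V p b. plucker n k V p \<longrightarrow> normalized_frame k J V b \<longrightarrow>
    b a j * p J = \<epsilon> * p (insert j (J - {sorted_list_of_set J ! a}))"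
proof -
  let ?L = "sorted_list_of_set J"
  have fJ: "finite J" using J(1) finite_subset by blast
  have L: "length ?L = k" "set ?L = J" "distinct ?L" using fJ J(2) by auto
  have La: "?L ! a \<in> J" using L a nth_mem[of a ?L] by simp
  define c where "c l = (if l = a then j else ?L ! l)" for l
  define I where "I = insert j (J - {?L ! a})"
  have Lim: "(\<lambda>l. ?L ! l) ` ({..<k} - {a}) = J - {?L ! a}"
  proof -
    have "(\<lambda>l. ?L ! l) ` {..<k} = J" using L by (auto simp: set_conv_nth)
    moreover have "inj_on (\<lambda>l. ?L ! l) {..<k}" using L inj_on_nth[OF L(3), of "{..<k}"] by auto
    ultimately show ?thesis using a by (simp add: inj_on_image_set_diff[where C = "{..<k}"])
  qed
  have "c ` {..<k} = insert (c a) (c ` ({..<k} - {a}))" using a by blast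
  also have "c ` ({..<k} - {a}) = (\<lambda>l. ?L ! l) ` ({..<k} - {a})" by (auto simp: c_def)
  finally have im: "c ` {..<k} = I" by (simp add: Lim I_def c_def)
  have cI: "card I = k" "I \<subseteq> {1..2 * n + 1}"
    using J j La fJ card_Suc_Diff1[OF fJ La] by (auto simp: I_def)
  then have "inj_on c {..<k}" using im by (intro eq_card_imp_inj_on) auto
  then obtain \<epsilon> where \<epsilon>: "\<And>b. det (mat k k (\<lambda>(a, l). b a (c l))) = \<epsilon> * minor k b I"
    using det_columns[of c k] im by auto
  have "b a j * p J = \<epsilon> * p I" if p: "plucker n k V p" and b: "normalized_frame k J V b" for V p b
  proof -
    let ?x = "vec k (\<lambda>e. b e j)"
    \<comment> \<open>The left side is the identity matrix with column \<open>a\<close> replaced by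
      column \<open>j\<close> of the frame; Cramer's rule evaluates its determinant as
      \<open>b a j\<close>.\<close>
    have "mat k k (\<lambda>(a, l). b a (c l)) = replace_col (1\<^sub>m k) (1\<^sub>m k *\<^sub>v ?x) a"
      by (rule eq_matI) (use b in \<open>auto simp: replace_col_def c_def normalized_frame_def\<close>)
    then have "b a j = \<epsilon> * minor k b I"
      using cramer_lemma_mat[of "1\<^sub>m k :: complex mat" k ?x a] a \<epsilon>[of b] by simp
    then show ?thesis using plucker_normalized_frame[OF p b J cI(2,1)] by simp
  qed
  then show ?thesis unfolding I_def by blast
qed

lemma binary_form_poly:
  fixes c :: "nat \<Rightarrow> complex"
  obtains P where "degree P \<le> e"
    "\<And>\<tau>. poly P \<tau> = (\<Sum>i\<le>e. c i * (s + \<tau> * s') ^ i * (t + \<tau> * t') ^ (e - i))"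
proof
  let ?P = "\<Sum>i\<le>e. smult (c i) ([:s, s':] ^ i * [:t, t':] ^ (e - i))"
  show "degree ?P \<le> e"
  proof (rule degree_sum_le)
    fix i assume i: "i \<in> {..e}"
    have "degree (smult (c i) ([:s, s':] ^ i * [:t, t':] ^ (e - i))) \<le>
        degree ([:s, s':] ^ i) + degree ([:t, t':] ^ (e - i))"
      using degree_smult_le degree_mult_le le_trans by blast
    also have "\<dots> \<le> degree [:s, s':] * i + degree [:t, t':] * (e - i)"
      by (intro add_mono degree_power_le)
    also have "\<dots> \<le> 1 * i + 1 * (e - i)" by (intro add_mono mult_right_mono) auto
    finally show "degree (smult (c i) ([:s, s':] ^ i * [:t, t':] ^ (e - i))) \<le> e" using i by simp
  qed simp
  show "poly ?P \<tau> = (\<Sum>i\<le>e. c i * (s + \<tau> * s') ^ i * (t + \<tau> * t') ^ (e - i))" for \<tau>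
    by (simp add: poly_sum mult.assoc)
qed

text \<open>A zero on the line through two representatives would make them proportional. Distinct
  points are therefore joined by an affine parameter that stays defined for every value, and binary
  forms restrict to polynomials in it.\<close>

lemma abs_P1_segment_nonzero:
  assumes "(s0, t0) \<noteq> (0, 0)" "(s1, t1) \<noteq> (0, 0)" "abs_P1 (s0, t0) \<noteq> abs_P1 (s1, t1)"
  shows "(s0 + \<tau> * (s1 - s0), t0 + \<tau> * (t1 - t0)) \<noteq> (0, 0)"
proof
  assume "(s0 + \<tau> * (s1 - s0), t0 + \<tau> * (t1 - t0)) = (0, 0)"
  then have z: "s0 * (1 - \<tau>) = - \<tau> * s1" "t0 * (1 - \<tau>) = - \<tau> * t1"
    by (simp_all add: algebra_simps eq_neg_iff_add_eq_0)
  have \<tau>: "\<tau> \<noteq> 0" using z assms(1) by auto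
  have \<tau>': "1 - \<tau> \<noteq> 0"
  proof
    assume "1 - \<tau> = 0"
    then show False using z assms(2) by simp
  qed
  have "s1 = - (1 - \<tau>) / \<tau> * s0" "t1 = - (1 - \<tau>) / \<tau> * t0"
    using z \<tau> by (simp_all add: field_simps)
  then have "proportional (s0, t0) (s1, t1)"
    using assms(1) \<tau> \<tau>' by (auto simp: proportional_def intro!: exI[of _ "- (1 - \<tau>) / \<tau>"])
  then show False using Quotient3_rel_abs[OF Quotient3_P1] assms(3) by blast
qed

lemma P1_cases:
  obtains s t where "(s, t) \<noteq> (0, 0)" "x = abs_P1 (s, t)"
proof -
  have "\<exists>s t. (s, t) \<noteq> (0, 0) \<and> x = abs_P1 (s, t)"
    by (induction x rule: P1.abs_induct) (auto simp: proportional_def)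
  then show ?thesis using that by blast
qed

lemma card_nth_sorted_list_of_set:
  assumes "finite I" "card I = k"
  shows "card {i. i < k \<and> sorted_list_of_set I ! i \<in> S} = card (I \<inter> S)"
proof -
  let ?L = "sorted_list_of_set I"
  have L: "length ?L = k" "set ?L = I" "distinct ?L" using assms by auto
  have "(\<lambda>i. ?L ! i) ` {i. i < k \<and> ?L ! i \<in> S} = I \<inter> S"
    using L by (auto simp: set_conv_nth)
  moreover have "inj_on (\<lambda>i. ?L ! i) {i. i < k \<and> ?L ! i \<in> S}"
    using inj_on_nth[OF L(3)] L(1) by auto
  ultimately show ?thesis using card_image by metis
qed

text \<open>Near \<open>f x\<close> the map has a frame normalized along an index set adapted to the flag. The entries
  of the rows spanning \<open>f x \<inter> coord_space {1..k + 1}\<close> in the columns beyond \<open>k + 1\<close> vanish at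
  \<open>x\<close>, so the Pluecker coordinates with many such columns vanish there to order more than \<open>e\<close>,
  which exceeds their degree.\<close>

lemma P1_morphism_flag_locus:
  assumes f: "P1_morphism n k e f" and k: "k \<le> n" and x: "f x \<in> flag_locus n k m"
  shows "f y \<in> flag_locus n k (m + e)"
proof (rule ccontr)
  assume neg: "f y \<notin> flag_locus n k (m + e)"
  have fIG: "f z \<in> IG n k" for z using f by (auto simp: P1_morphism_def)
  obtain c where c: "\<And>s t. (s, t) \<noteq> (0, 0) \<Longrightarrow>
      plucker n k (f (abs_P1 (s, t))) (\<lambda>I. \<Sum>i\<le>e. c I i * s ^ i * t ^ (e - i))"
    using f by (auto simp: P1_morphism_def)
  obtain s0 t0 where x0: "(s0, t0) \<noteq> (0, 0)" "x = abs_P1 (s0, t0)" by (rule P1_cases)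
  obtain s1 t1 where y0: "(s1, t1) \<noteq> (0, 0)" "y = abs_P1 (s1, t1)" by (rule P1_cases)
  have "x \<noteq> y" using neg x by (auto simp: flag_locus_def)
  then have nz: "(s0 + \<tau> * (s1 - s0), t0 + \<tau> * (t1 - t0)) \<noteq> (0, 0)" for \<tau>
    using abs_P1_segment_nonzero[OF x0(1) y0(1)] x0(2) y0(2) by blast
  define V where "V \<tau> = f (abs_P1 (s0 + \<tau> * (s1 - s0), t0 + \<tau> * (t1 - t0)))" for \<tau>
  have "\<forall>I. \<exists>P. degree P \<le> e \<and> (\<forall>\<tau>. poly P \<tau> =
      (\<Sum>i\<le>e. c I i * (s0 + \<tau> * (s1 - s0)) ^ i * (t0 + \<tau> * (t1 - t0)) ^ (e - i)))"
  proof
    fix I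
    show "\<exists>P. degree P \<le> e \<and> (\<forall>\<tau>. poly P \<tau> =
      (\<Sum>i\<le>e. c I i * (s0 + \<tau> * (s1 - s0)) ^ i * (t0 + \<tau> * (t1 - t0)) ^ (e - i)))"
      by (rule binary_form_poly[of e "c I" s0 "s1 - s0" t0 "t1 - t0"]) blast
  qed
  then obtain P where P: "\<And>I. degree (P I) \<le> e" "\<And>I \<tau>. poly (P I) \<tau> =
      (\<Sum>i\<le>e. c I i * (s0 + \<tau> * (s1 - s0)) ^ i * (t0 + \<tau> * (t1 - t0)) ^ (e - i))"
    by metis
  have pl: "plucker n k (V \<tau>) (\<lambda>I. poly (P I) \<tau>)" for \<tau>
    unfolding P(2) V_def by (rule c[OF nz])
  have V0: "V 0 = f x" and V1: "V 1 = f y" by (simp_all add: V_def x0 y0)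
  have VIG: "V \<tau> \<in> IG n k" for \<tau> unfolding V_def by (rule fIG)
  obtain I where I: "I \<subseteq> {1..2 * n + 1}" "card I = k" "m + e < card (I - {1..k + 1})"
    "poly (P I) 1 \<noteq> 0"
  proof (rule ccontr)
    assume "\<not> thesis"
    then have "V 1 \<in> flag_locus n k (m + e)"
      using that by (intro flag_locus_of_plucker_zero[OF VIG pl k]) blast
    then show False using neg V1 by simp
  qed
  have fI: "finite I" using I(1) finite_subset by blast
  let ?F = "coord_space {1..k + 1}"
  have q: "k + 1 \<le> 2 * n + 1" using k by simp
  have V0': "cv.subspace (V 0)" "V 0 \<subseteq> E_odd n" "cv.dim (V 0) = k" using VIG[of 0] by (auto simp: IG_def)
  obtain J where J: "J \<subseteq> {1..2 * n + 1}" "card J = cv.dim (V 0)" "V 0 \<inter> coord_space (- J) = {0}"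
    "card (J \<inter> {1..k + 1}) = cv.dim (V 0 \<inter> ?F)" "V 0 \<inter> coord_space (- (J - {1..k + 1})) = V 0 \<inter> ?F"
    by (rule adapted_index_set[OF V0'(1,2) q])
  have cJ: "card J = k" and fJ: "finite J" using J(1,2) V0'(3) finite_subset by auto
  define Q where "Q = P J"
  have Q0: "poly Q 0 \<noteq> 0"
    unfolding Q_def using plucker_eq_0_iff[OF pl[of 0] J(1) cJ] J(3) by auto
  let ?LJ = "sorted_list_of_set J" and ?LI = "sorted_list_of_set I"
  have LJ: "length ?LJ = k" "set ?LJ = J" "distinct ?LJ" using fJ cJ by auto
  have LI: "length ?LI = k" "set ?LI = I" "distinct ?LI" using fI I(2) by auto
  have nf: "\<exists>b. normalized_frame k J (V \<tau>) b" if "poly Q \<tau> \<noteq> 0" for \<tau>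
  proof -
    have "v = 0" if "v \<in> V \<tau>" "v \<in> coord_space (- J)" for v
      using plucker_eq_0_iff[OF pl[of \<tau>] J(1) cJ] \<open>poly Q \<tau> \<noteq> 0\<close> that by (auto simp: Q_def)
    then show ?thesis using normalized_frame_exists[OF IG_fin_subspace[OF VIG] _ fJ cJ] VIG
      by (metis (mono_tags, lifting) IG_def mem_Collect_eq)
  qed
  have "\<exists>\<epsilon>. \<forall>V p b. plucker n k V p \<longrightarrow> normalized_frame k J V b \<longrightarrow>
      b a j * p J = \<epsilon> * p (insert j (J - {?LJ ! a}))" if "a < k \<and> j \<in> {1..2 * n + 1} - J" for a j
    using normalized_frame_entry[OF J(1) cJ] that by blast
  then obtain \<epsilon> where \<epsilon>: "\<And>a j V p b. a < k \<Longrightarrow> j \<in> {1..2 * n + 1} - J \<Longrightarrow> plucker n k V p \<Longrightarrow>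
      normalized_frame k J V b \<Longrightarrow> b a j * p J = \<epsilon> a j * p (insert j (J - {?LJ ! a}))"
    by metis
  \<comment> \<open>The entries of the normalized frame with denominator \<open>Q\<close> cleared;
    on the columns of \<open>J\<close> they are those of \<open>Q\<close> times the
    identity.\<close>
  define W where "W a j = (if j \<in> J then (if j = ?LJ ! a then Q else 0)
    else smult (\<epsilon> a j) (P (insert j (J - {?LJ ! a}))))" for a j
  have W: "poly (W a j) \<tau> = b a j * poly Q \<tau>"
    if a: "a < k" and j: "j \<in> {1..2 * n + 1}" and b: "normalized_frame k J (V \<tau>) b" for a j \<tau> b
  proof (cases "j \<in> J")
    case True
    then obtain l where l: "l < k" "j = ?LJ ! l" using LJ by (metis in_set_conv_nth)
    then have "b a j = (if l = a then 1 else 0)" using b a by (simp add: normalized_frame_def)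
    moreover have "j = ?LJ ! a \<longleftrightarrow> l = a" using l a LJ nth_eq_iff_index_eq by metis
    ultimately show ?thesis using True by (simp add: W_def)
  next
    case False
    then show ?thesis using \<epsilon>[OF a _ pl b] j by (simp add: W_def Q_def)
  qed
  define M where "M = (\<Sum>p | p permutes {0..<k}. smult (signof p) (\<Prod>i = 0..<k. W i (?LI ! p i)))"
  have LIp: "?LI ! p i \<in> I" if "p permutes {0..<k}" "i < k" for p i
    using permutes_in_image[OF that(1), of i] that(2) LI nth_mem[of "p i" ?LI] by simp
  \<comment> \<open>Where \<open>Q\<close> is nonzero, the Leibniz formula gives
    \<open>Q * M = Q ^ k * P I\<close>. One more factor \<open>Q\<close> makes both sides vanish at
    the zeros of \<open>Q\<close>, where no normalized frame exists.\<close>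
  have "Q ^ (k + 1) * P I = Q ^ 2 * M"
  proof (rule poly_eq_poly_eq_iff[THEN iffD1], rule ext)
    fix \<tau>
    show "poly (Q ^ (k + 1) * P I) \<tau> = poly (Q ^ 2 * M) \<tau>"
    proof (cases "poly Q \<tau> = 0")
      case False
      then obtain b where b: "normalized_frame k J (V \<tau>) b" using nf by blast
      have WI: "poly (W i (?LI ! p i)) \<tau> = b i (?LI ! p i) * poly Q \<tau>"
        if "p permutes {0..<k}" "i < k" for p i
        using W[OF that(2) _ b] LIp[OF that] I(1) by blast
      have "poly M \<tau> = (\<Sum>p | p permutes {0..<k}. signof p * (\<Prod>i = 0..<k. b i (?LI ! p i) * poly Q \<tau>))"
        unfolding M_def poly_sum poly_smult poly_prod by (intro sum.cong) (use WI in auto)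
      also have "\<dots> = poly Q \<tau> ^ k * minor k b I"
        unfolding minor_expand by (simp add: prod.distrib sum_distrib_left mult_ac)
      finally have "poly Q \<tau> * poly M \<tau> = poly Q \<tau> ^ k * poly (P I) \<tau>"
        using plucker_normalized_frame[OF pl b J(1) cJ I(1,2)] by (simp add: Q_def mult_ac)
      then show ?thesis by (simp add: power2_eq_square mult_ac)
    qed simp
  qed
  moreover have "[:0, 1:] ^ (e + 1) dvd M"
    unfolding M_def
  proof (rule dvd_sum)
    fix p assume "p \<in> {p. p permutes {0..<k}}"
    then have p: "p permutes {0..<k}" by simp
    \<comment> \<open>\<open>A\<close> collects the rows which at the parameter \<open>0\<close> lie
      in the flag space, at least \<open>k - m\<close> of them; \<open>B\<close> collects the rows
      whose column under \<open>p\<close> is beyond \<open>k + 1\<close>, more than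
      \<open>m + e\<close> of them. Among \<open>k\<close> rows at least \<open>e + 1\<close> are in
      both, and each contributes a factor vanishing at \<open>0\<close>.\<close>
    define A where "A = {i. i < k \<and> ?LJ ! i \<in> {1..k + 1}}"
    define B where "B = {i. i < k \<and> ?LI ! p i \<in> - {1..k + 1}}"
    have cA: "card A = cv.dim (V 0 \<inter> ?F)"
      unfolding A_def card_nth_sorted_list_of_set[OF fJ cJ] by (rule J(4))
    have "p ` B = {i. i < k \<and> ?LI ! i \<in> - {1..k + 1}}"
    proof (intro equalityI subsetI)
      fix j assume j: "j \<in> {i. i < k \<and> ?LI ! i \<in> - {1..k + 1}}"
      then obtain i where "j = p i" using permutes_surj[OF p] by (metis surjD)
      then show "j \<in> p ` B" using j permutes_in_image[OF p, of i] by (auto simp: B_def)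
    qed (use permutes_in_image[OF p] in \<open>auto simp: B_def\<close>)
    then have "card B = card (I \<inter> - {1..k + 1})"
      using card_nth_sorted_list_of_set[OF fI I(2)] card_image[OF inj_on_subset[OF permutes_inj[OF p]]]
      by (metis subset_UNIV)
    then have cB: "card B > m + e" using I(3) by (simp add: Diff_eq)
    have fin: "finite A" "finite B" by (auto simp: A_def B_def)
    have "card (A \<union> B) \<le> card {..<k}" by (rule card_mono) (auto simp: A_def B_def)
    then have "card A + card B \<le> k + card (A \<inter> B)"
      using card_Un_Int[OF fin] by simp
    moreover have "k \<le> card A + m" using x cA V0 by (simp add: flag_locus_def)
    ultimately have "e + 1 \<le> card (A \<inter> B)" using cB by linarith
    then have "[:0, 1:] ^ (e + 1) dvd [:0, 1 :: complex:] ^ card (A \<inter> B)" by (rule le_imp_power_dvd)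
    also have "[:0, 1:] ^ card (A \<inter> B) = (\<Prod>i\<in>A \<inter> B. [:0, 1 :: complex:])" by simp
    also have "\<dots> dvd (\<Prod>i = 0..<k. W i (?LI ! p i))"
    proof (rule prod_dvd_prod_subset2)
      fix i assume i: "i \<in> A \<inter> B"
      then have ik: "i < k" by (simp add: A_def)
      obtain b where b: "normalized_frame k J (V 0) b" using nf[OF Q0] by blast
      have "b i j = 0" if j: "j \<in> J - {1..k + 1}" for j
      proof -
        obtain l where l: "l < k" "j = ?LJ ! l" using j LJ by (metis DiffD1 in_set_conv_nth)
        moreover have "l \<noteq> i" using l j i by (auto simp: A_def)
        ultimately show ?thesis using b ik by (simp add: normalized_frame_def)
      qed
      then have "b i \<in> coord_space (- (J - {1..k + 1}))" unfolding in_coord_space_compl by blast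
      then have "b i \<in> ?F" using J(5) b ik by (auto simp: normalized_frame_def)
      then have "b i (?LI ! p i) = 0" using i by (auto simp: B_def coord_space_def)
      then have "poly (W i (?LI ! p i)) 0 = 0" using W[OF ik _ b] LIp[OF p ik] I(1) by auto
      then show "[:0, 1:] dvd W i (?LI ! p i)" by (simp add: dvd_iff_poly_eq_0)
    qed (auto simp: A_def)
    finally show "[:0, 1:] ^ (e + 1) dvd smult (signof p) (\<Prod>i = 0..<k. W i (?LI ! p i))"
      by (rule dvd_smult)
  qed
  ultimately have "[:- 0, 1:] ^ (e + 1) dvd Q ^ (k + 1) * P I" by simp
  moreover have "Q ^ (k + 1) * P I \<noteq> 0" using Q0 I(4) by auto
  \<comment> \<open>\<open>Q\<close> does not vanish at \<open>0\<close>, so the whole order of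
    vanishing belongs to \<open>P I\<close>, whose degree is at most \<open>e\<close>.\<close>
  ultimately have "e + 1 \<le> order 0 (Q ^ (k + 1) * P I)" using order_divides by blast
  also have "\<dots> = order 0 (Q ^ (k + 1)) + order 0 (P I)"
    by (rule order_mult) fact
  also have "order 0 (Q ^ (k + 1)) = 0" using Q0 by (simp add: order_0I)
  also have "0 + order 0 (P I) \<le> degree (P I)" using I(4) by (auto intro: order_degree)
  also have "\<dots> \<le> e" by (rule P(1))
  finally show False by simp
qed

text \<open>A maximal set \<open>S\<close> of components is grown from the first marked point so
  that its whole image lies in the locus for the total degree of \<open>S\<close>. An edge leaving
  \<open>S\<close> would carry the bound across the node, at the cost of the degree of one more
  component; by connectedness \<open>S\<close> is everything.\<close>

lemma stable_map_flag_locus: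
  assumes C: "stable_map n k d C" and k: "k \<le> n" and ev: "ev1 C \<in> flag_locus n k 0"
  shows "ev2 C \<in> flag_locus n k d"
proof -
  have "\<exists>e. (\<forall>u\<in>comps C. P1_morphism n k (e u) (comp_map C u)) \<and> (\<Sum>u\<in>comps C. e u) = d"
    using C unfolding stable_map_def by (elim conjE)
  then obtain e where e: "\<And>u. u \<in> comps C \<Longrightarrow> P1_morphism n k (e u) (comp_map C u)"
    "(\<Sum>u\<in>comps C. e u) = d" by blast
  have node: "comp_map C u (node C u v) = comp_map C v (node C v u)" if "(u, v) \<in> edges C" for u v
    using C that by (auto simp: stable_map_def)
  have g: "pointed_genus0_curve C" using C by (simp add: stable_map_def)
  then have tree: "dual_tree C" and mk: "fst (mark1 C) \<in> comps C" "fst (mark2 C) \<in> comps C"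
    by (auto simp: pointed_genus0_curve_def)
  have fin: "finite (comps C)" and E: "edges C \<subseteq> comps C \<times> comps C"
    and conn: "\<And>u v. u \<in> comps C \<Longrightarrow> v \<in> comps C \<Longrightarrow> (u, v) \<in> (edges C)\<^sup>*"
    using tree by (auto simp: dual_tree_def)
  define G where "G S \<longleftrightarrow> S \<subseteq> comps C \<and> fst (mark1 C) \<in> S \<and>
    (\<forall>u\<in>S. \<forall>x. comp_map C u x \<in> flag_locus n k (\<Sum>u\<in>S. e u))" for S
  have "comp_map C (fst (mark1 C)) x \<in> flag_locus n k (0 + e (fst (mark1 C)))" for x
    by (rule P1_morphism_flag_locus[OF e(1)[OF mk(1)] k]) (use ev in \<open>simp add: ev1_def\<close>)
  then have "{fst (mark1 C)} \<in> Collect G" using mk by (simp add: G_def)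
  moreover have "finite (Collect G)"
    by (rule finite_subset[of _ "Pow (comps C)"]) (use fin in \<open>auto simp: G_def\<close>)
  ultimately obtain S where S: "G S" "\<And>S'. G S' \<Longrightarrow> S \<subseteq> S' \<Longrightarrow> S' = S"
    using finite_has_maximal[of "Collect G"] by blast
  note SG = S(1)[unfolded G_def]
  have "S = comps C"
  proof (rule ccontr)
    assume "S \<noteq> comps C"
    then obtain w where w: "w \<in> comps C" "w \<notin> S" using SG by blast
    have "\<exists>u v. u \<in> S \<and> v \<notin> S \<and> (u, v) \<in> edges C"
    proof (rule ccontr)
      assume no: "\<not> ?thesis"
      have "(fst (mark1 C), w) \<in> (edges C)\<^sup>*" using conn mk w by blast
      then have "w \<in> S"
        by (induction rule: rtrancl_induct) (use SG no in auto)
      then show False using w by simp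
    qed
    then obtain u v where uv: "u \<in> S" "v \<notin> S" "(u, v) \<in> edges C" by blast
    have vC: "v \<in> comps C" using uv(3) E by auto
    have fS: "finite S" using SG fin finite_subset by blast
    have sum: "(\<Sum>u\<in>insert v S. e u) = (\<Sum>u\<in>S. e u) + e v" using uv(2) fS by simp
    have mono: "V \<in> flag_locus n k (\<Sum>u\<in>insert v S. e u)" if "V \<in> flag_locus n k (\<Sum>u\<in>S. e u)" for V
      using that unfolding sum by (auto simp: flag_locus_def)
    have "comp_map C v (node C v u) \<in> flag_locus n k (\<Sum>u\<in>S. e u)"
      using SG uv(1) node[OF uv(3)] by metis
    then have "comp_map C v x \<in> flag_locus n k (\<Sum>u\<in>insert v S. e u)" for x
      unfolding sum by (rule P1_morphism_flag_locus[OF e(1)[OF vC] k])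
    then have "G (insert v S)" unfolding G_def using SG vC mono by blast
    then show False using S(2) uv(2) by blast
  qed
  then show ?thesis using SG mk(2) e(2) unfolding ev2_def by blast
qed

section \<open>Chains of lines\<close>

lemma minor_snoc_linear:
  "minor (Suc r) (\<lambda>i. if i < r then b i else cscale s x + cscale t y) I =
   s * minor (Suc r) (\<lambda>i. if i < r then b i else x) I + t * minor (Suc r) (\<lambda>i. if i < r then b i else y) I"
  unfolding minor_expand
  by (simp add: cscale_def sum_distrib_left sum.distrib[symmetric] algebra_simps)

lemma span_insert_scale:
  assumes "c \<noteq> 0"
  shows "cv.span (insert (cscale c w) H) = cv.span (insert w H)"
proof (rule cv.span_eq[THEN iffD2], intro conjI)
  show "insert (cscale c w) H \<subseteq> cv.span (insert w H)"
    by (auto intro: cv.span_base cv.span_scale)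
  have "cscale (1 / c) (cscale c w) \<in> cv.span (insert (cscale c w) H)"
    by (intro cv.span_scale cv.span_base) simp
  then show "insert w H \<subseteq> cv.span (insert (cscale c w) H)"
    using assms by (auto intro: cv.span_base)
qed

text \<open>The chosen representative of the point matters only up to a scalar, which the span
  absorbs.\<close>

definition pencil :: "cvec set \<Rightarrow> cvec \<Rightarrow> cvec \<Rightarrow> P1 \<Rightarrow> cvec set" where
  "pencil H x y p = cv.span (insert (cscale (fst (rep_P1 p)) x + cscale (snd (rep_P1 p)) y) H)"

lemma pencil_abs:
  assumes "(s, t) \<noteq> (0, 0)"
  shows "pencil H x y (abs_P1 (s, t)) = cv.span (insert (cscale s x + cscale t y) H)"
proof -
  have "proportional (s, t) (s, t)" using assms by (auto simp: proportional_def intro!: exI[of _ 1])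
  then have "proportional (s, t) (rep_P1 (abs_P1 (s, t)))"
    using Quotient3_rel[OF Quotient3_P1, of "(s, t)" "rep_P1 (abs_P1 (s, t))"]
      Quotient3_rep_reflp[OF Quotient3_P1] Quotient3_abs_rep[OF Quotient3_P1] by simp
  then obtain c where c: "c \<noteq> 0" "rep_P1 (abs_P1 (s, t)) = (c * s, c * t)"
    by (auto simp: proportional_def)
  have "cscale (c * s) x + cscale (c * t) y = cscale c (cscale s x + cscale t y)"
    by (simp add: cv.scale_right_distrib)
  then show ?thesis using span_insert_scale[OF c(1)] by (simp add: pencil_def c(2))
qed

text \<open>Only the last row of the frame depends on \<open>(s, t)\<close>, and it does so
  linearly; by multilinearity every Pluecker coordinate is a linear form in \<open>s\<close> and
  \<open>t\<close>.\<close>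

lemma pencil_morphism:
  assumes H: "fin_subspace H" "H \<subseteq> E_odd n" "cv.dim H + 1 = k" and xy: "x \<in> E_odd n" "y \<in> E_odd n"
    and iso: "\<And>v w. v \<in> H \<Longrightarrow> w \<in> H \<Longrightarrow> omega n v w = 0" "x \<in> perp n H" "y \<in> perp n H"
    and new: "\<And>s t. (s, t) \<noteq> (0, 0) \<Longrightarrow> cscale s x + cscale t y \<notin> H"
  shows "P1_morphism n k 1 (pencil H x y)"
proof -
  obtain b where b: "frame (cv.dim H) b H" using frame_exists[OF H(1)] by blast
  let ?r = "cv.dim H" and ?z = "\<lambda>s t. cscale s x + cscale t y"
  let ?b = "\<lambda>s t i. if i < ?r then b i else ?z s t"
  have k: "k = Suc ?r" using H(3) by simp
  have fr: "frame k (?b s t) (pencil H x y (abs_P1 (s, t)))" if "(s, t) \<noteq> (0, 0)" for s t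
    unfolding k pencil_abs[OF that] by (rule frame_snoc[OF b new[OF that]])
  have two_terms: "(\<Sum>i\<le>1. g i) = g 0 + g 1" for g :: "nat \<Rightarrow> complex" by simp
  have bH: "b i \<in> H" if "i < ?r" for i using frame_in[OF b that] .
  have "omega n v (?z s t) = 0" if "v \<in> H" for v s t
  proof -
    have "omega n (?z s t) v = 0" using iso(2,3) that by (simp add: perp_def omega_bilinear)
    then show ?thesis using omega_skew[of n v] by simp
  qed
  then have IG: "pencil H x y (abs_P1 (s, t)) \<in> IG n k" if "(s, t) \<noteq> (0, 0)" for s t
    by (intro IG_I[OF fr[OF that]])
       (use bH iso(1) H(2) xy k in \<open>auto simp: E_odd_eq intro!: cv.subspace_add cv.subspace_scale\<close>)
  have "pencil H x y p \<in> IG n k" for p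
  proof (induction p rule: P1.abs_induct)
    case (1 q)
    then show ?case using IG[of "fst q" "snd q"] by (auto simp: proportional_def)
  qed
  moreover have "\<exists>c. \<forall>s t. (s, t) \<noteq> (0, 0) \<longrightarrow>
      plucker n k (pencil H x y (abs_P1 (s, t))) (\<lambda>I. \<Sum>i\<le>1. c I i * s ^ i * t ^ (1 - i))"
  proof (intro exI allI impI)
    fix s t :: complex assume st: "(s, t) \<noteq> (0, 0)"
    let ?c = "\<lambda>I i. if I \<subseteq> {1..2 * n + 1} \<and> card I = k then
      (if i = 0 then minor k (\<lambda>i. if i < ?r then b i else y) I
       else minor k (\<lambda>i. if i < ?r then b i else x) I) else 0"
    have "(\<lambda>I. if I \<subseteq> {1..2 * n + 1} \<and> card I = k then minor k (?b s t) I else 0) =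
        (\<lambda>I. \<Sum>i\<le>1. ?c I i * s ^ i * t ^ (1 - i))"
      unfolding two_terms by (rule ext) (simp add: k minor_snoc_linear mult_ac add.commute)
    then show "plucker n k (pencil H x y (abs_P1 (s, t))) (\<lambda>I. \<Sum>i\<le>1. ?c I i * s ^ i * t ^ (1 - i))"
      using plucker_frame[OF fr[OF st], of n] by simp
  qed
  ultimately show ?thesis by (auto simp: P1_morphism_def)
qed

definition P1_zero :: P1 where "P1_zero = abs_P1 (0, 1)"
definition P1_infinity :: P1 where "P1_infinity = abs_P1 (1, 0)"

lemma P1_zero_neq_infinity: "P1_zero \<noteq> P1_infinity"
proof
  assume "P1_zero = P1_infinity"
  moreover have "proportional (0, 1) (0, 1)" "proportional (1, 0) (1, 0)"
    by (auto simp: proportional_def)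
  ultimately have "proportional (0, 1) (1, 0)"
    using Quotient3_rel[OF Quotient3_P1, of "(0, 1)" "(1, 0)"] by (simp add: P1_zero_def P1_infinity_def)
  then show False by (auto simp: proportional_def)
qed

text \<open>A hyperplane \<open>H\<close> of \<open>V\<close> is kept and the remaining vector is
  exchanged for a vector \<open>z\<close> of the flag space. With truncated subtraction the case
  \<open>j = 0\<close> is included: the line then joins two different subspaces of the flag space.
  The line is never constant, which later gives stability and lets every chain have exactly
  \<open>d\<close> lines.\<close>

lemma flag_locus_line:
  assumes V: "V \<in> flag_locus n k j" and k: "1 \<le> k" "k \<le> n"
  obtains f where "P1_morphism n k 1 f" "f P1_zero \<in> flag_locus n k (j - 1)" "f P1_infinity = V"
    "f P1_zero \<noteq> V"
proof -
  let ?F = "coord_space {1..k + 1}"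
  have IG: "V \<in> IG n k" and dVF: "k \<le> cv.dim (V \<inter> ?F) + j" using V by (auto simp: flag_locus_def)
  have V': "fin_subspace V" "cv.subspace V" "V \<subseteq> E_odd n" "cv.dim V = k"
    and iso: "\<And>v w. v \<in> V \<Longrightarrow> w \<in> V \<Longrightarrow> omega n v w = 0"
    using IG IG_fin_subspace by (auto simp: IG_def)
  \<comment> \<open>If some coordinate beyond \<open>k + 1\<close> is nonzero on \<open>V\<close>,
    it is used to cut out \<open>H\<close>; then \<open>H\<close> keeps the whole intersection of
    \<open>V\<close> with the flag space. Otherwise \<open>V\<close> lies in the flag space and any
    coordinate nonzero on \<open>V\<close> will do.\<close>
  have "\<exists>i v. v \<in> V \<and> v i \<noteq> 0 \<and> (V \<subseteq> ?F \<or> i \<notin> {1..k + 1})"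
  proof (cases "V \<subseteq> ?F")
    case True
    obtain v where "v \<in> V" "v \<noteq> 0" using nonzero_of_dim[OF _ V'(1)] V'(4) k by auto
    then show ?thesis using True by (auto simp: fun_eq_iff)
  next
    case False
    then show ?thesis by (auto simp: coord_space_def)
  qed
  then obtain i v where v: "v \<in> V" "v i \<noteq> 0" and i: "V \<subseteq> ?F \<or> i \<notin> {1..k + 1}" by blast
  define H where "H = V \<inter> {v. v i = 0}"
  have H: "fin_subspace H" unfolding H_def
    using V'(1) subspace_ker[OF linear_form_coord] by (rule fin_subspace_Int)
  have HV: "H \<subseteq> V" by (auto simp: H_def)
  have dH: "cv.dim V = cv.dim H + 1"
    unfolding H_def by (rule dim_ker_nonzero[OF V'(1) linear_form_coord v])
  have HF: "V \<subseteq> ?F \<and> H \<inter> ?F = H \<or> H \<inter> ?F = V \<inter> ?F"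
    using i by (auto simp: H_def coord_space_def)
  have VF: "V \<inter> ?F = V" if "V \<subseteq> ?F" using that by blast
  obtain z where z: "z \<in> ?F" "z \<in> perp n H" "z \<notin> V"
    by (rule ex_flag_perp[OF IG fin_subspace_subspace[OF H] HV k(2)])
       (use HF VF dH V'(4) in auto)
  have zE: "z \<in> E_odd n" using z(1) coord_space_mono[of "{1..k + 1}" "{1..2 * n + 1}"] k
    by (auto simp: E_odd_eq)
  have vH: "v \<notin> H" using v(2) by (simp add: H_def)
  have new: "cscale s v + cscale t z \<notin> H" if st: "(s, t) \<noteq> (0, 0)" for s t
  proof
    assume a: "cscale s v + cscale t z \<in> H"
    then have "(cscale s v + cscale t z) - cscale s v \<in> V"
      using HV v(1) V'(2) by (intro cv.subspace_diff[OF V'(2)] cv.subspace_scale) auto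
    then have "cscale t z \<in> V" by simp
    then have "t = 0" by (rule subspace_scale_notin[OF V'(2) z(3)])
    then have "cscale s v \<in> H" using a by simp
    then have "s = 0" by (rule subspace_scale_notin[OF fin_subspace_subspace[OF H] vH])
    then show False using \<open>t = 0\<close> st by simp
  qed
  let ?f = "pencil H v z"
  have f: "P1_morphism n k 1 ?f"
  proof (rule pencil_morphism[OF H])
    show "v \<in> perp n H" using iso v(1) HV by (auto simp: perp_def)
    show "omega n v w = 0" if "v \<in> H" "w \<in> H" for v w using iso that HV by blast
  qed (use HV V'(3,4) dH v(1) zE iso z(2) new in auto)
  have f0: "?f P1_zero = cv.span (insert z H)" and f1: "?f P1_infinity = cv.span (insert v H)"
    unfolding P1_zero_def P1_infinity_def by (subst pencil_abs; simp)+
  have "cv.span (insert v H) = V"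
  proof (rule dim_eq_imp_eq[OF V'(1)])
    show "cv.span (insert v H) \<subseteq> V" using v(1) HV by (intro cv.span_minimal V'(2)) auto
    show "cv.dim V \<le> cv.dim (cv.span (insert v H))" using dim_insert[OF H vH] dH by simp
  qed simp
  moreover have "z \<in> cv.span (insert z H)" by (rule cv.span_base) simp
  moreover have "cv.span (insert z H) \<in> flag_locus n k (j - 1)"
  proof -
    have IG': "?f P1_zero \<in> IG n k" using f by (auto simp: P1_morphism_def)
    have fHF: "fin_subspace (H \<inter> ?F)" using H by (rule fin_subspace_Int) simp
    have "cv.dim (H \<inter> ?F) + 1 = cv.dim (cv.span (insert z (H \<inter> ?F)))"
      by (rule dim_insert[OF fHF, symmetric]) (use z(3) HV in auto)
    also have "\<dots> \<le> cv.dim (?f P1_zero \<inter> ?F)"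
    proof (rule dim_mono)
      show "fin_subspace (?f P1_zero \<inter> ?F)" using IG_fin_subspace[OF IG'] by (rule fin_subspace_Int) simp
      show "cv.span (insert z (H \<inter> ?F)) \<subseteq> ?f P1_zero \<inter> ?F"
      proof (rule cv.span_minimal)
        show "insert z (H \<inter> ?F) \<subseteq> ?f P1_zero \<inter> ?F"
          using z(1) by (auto simp: f0 intro: cv.span_base)
      qed (auto simp: f0 intro: cv.subspace_inter)
    qed
    finally have "cv.dim (H \<inter> ?F) + 1 \<le> cv.dim (?f P1_zero \<inter> ?F)" .
    moreover have "cv.dim (H \<inter> ?F) + 1 = k \<or> cv.dim (H \<inter> ?F) = cv.dim (V \<inter> ?F)"
      using HF dH V'(4) by (elim disjE conjE) simp_all
    ultimately have "k \<le> cv.dim (?f P1_zero \<inter> ?F) + (j - 1)" using dVF by linarith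
    then show ?thesis using IG' unfolding f0 flag_locus_def by blast
  qed
  ultimately show ?thesis using that[OF f] f0 f1 z(3) by auto
qed

lemma flag_locus_chain:
  assumes "V \<in> flag_locus n k d" "1 \<le> k" "k \<le> n"
  shows "\<exists>U f. U 0 \<in> flag_locus n k 0 \<and> U d = V \<and> (\<forall>i<d. P1_morphism n k 1 (f i) \<and>
    f i P1_zero = U i \<and> f i P1_infinity = U (Suc i) \<and> U i \<noteq> U (Suc i))"
  using assms(1)
proof (induction d arbitrary: V)
  case 0
  then show ?case by (intro exI[of _ "\<lambda>_. V"]) auto
next
  case (Suc d)
  obtain g where g: "P1_morphism n k 1 g" "g P1_zero \<in> flag_locus n k d" "g P1_infinity = V"
    "g P1_zero \<noteq> V"
    using flag_locus_line[OF Suc.prems assms(2,3)] by auto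
  obtain U f where Uf: "U 0 \<in> flag_locus n k 0" "U d = g P1_zero"
    "\<And>i. i < d \<Longrightarrow> P1_morphism n k 1 (f i) \<and>
      f i P1_zero = U i \<and> f i P1_infinity = U (Suc i) \<and> U i \<noteq> U (Suc i)"
    using Suc.IH[OF g(2)] by blast
  show ?case
    by (intro exI[of _ "\<lambda>i. if i \<le> d then U i else V"] exI[of _ "\<lambda>i. if i < d then f i else g"])
       (use Uf g in \<open>auto simp: less_Suc_eq Suc_le_eq\<close>)
qed

text \<open>Each component is glued at infinity to the zero of its successor. The marks take the two
  free ends, so special points stay distinct even for \<open>d = 1\<close>, where both marks are on
  the same component.\<close>

definition chain_map :: "nat \<Rightarrow> (nat \<Rightarrow> P1 \<Rightarrow> cvec set) \<Rightarrow> map_data" where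
  "chain_map d f = \<lparr>comps = {..<d}, edges = {(i, j). i < d \<and> j < d \<and> (j = Suc i \<or> i = Suc j)},
     node = (\<lambda>i j. if j = Suc i then P1_infinity else P1_zero),
     mark1 = (0, P1_zero), mark2 = (d - 1, P1_infinity), comp_map = f\<rparr>"

lemma dual_tree_chain_map:
  assumes "d \<ge> 1"
  shows "dual_tree (chain_map d f)"
proof -
  let ?E = "{(i, j). i < d \<and> j < d \<and> (j = Suc i \<or> i = Suc j)}"
  have sym: "sym ?E" by (auto simp: sym_def)
  have r: "(0, u) \<in> ?E\<^sup>*" if "u < d" for u
    using that
  proof (induction u)
    case (Suc u)
    then have "(0, u) \<in> ?E\<^sup>*" "(u, Suc u) \<in> ?E" by auto
    then show ?case by (rule rtrancl_into_rtrancl)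
  qed simp
  have "(u, v) \<in> ?E\<^sup>*" if "u < d" "v < d" for u v
    using r[OF that(1)] r[OF that(2)] sym_rtrancl[OF sym] by (meson symD rtrancl_trans)
  moreover have "card ?E = 2 * (d - 1)"
  proof -
    have "?E = (\<lambda>i. (i, Suc i)) ` {..<d - 1} \<union> (\<lambda>i. (Suc i, i)) ` {..<d - 1}" by auto
    moreover have "(\<lambda>i. (i, Suc i)) ` {..<d - 1} \<inter> (\<lambda>i. (Suc i, i)) ` {..<d - 1} = {}" by auto
    moreover have "card ((\<lambda>i. (i, Suc i)) ` {..<d - 1}) = d - 1"
      "card ((\<lambda>i. (Suc i, i)) ` {..<d - 1}) = d - 1"
      by (simp_all add: card_image inj_on_def)
    ultimately show ?thesis by (simp add: card_Un_disjoint)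
  qed
  moreover have "{..<d} \<noteq> {}" using assms by (simp add: lessThan_empty_iff)
  ultimately show ?thesis using sym
    by (auto simp: dual_tree_def chain_map_def irrefl_def)
qed

lemma stable_map_chain_map:
  assumes d: "d \<ge> 1"
    and f: "\<And>i. i < d \<Longrightarrow> P1_morphism n k 1 (f i)"
    and glue: "\<And>i. Suc i < d \<Longrightarrow> f i P1_infinity = f (Suc i) P1_zero"
    and nonconst: "\<And>i. i < d \<Longrightarrow> f i P1_zero \<noteq> f i P1_infinity"
  shows "stable_map n k d (chain_map d f)"
proof -
  have "pointed_genus0_curve (chain_map d f)"
    unfolding pointed_genus0_curve_def
    using dual_tree_chain_map[OF d, of f] P1_zero_neq_infinity P1_zero_neq_infinity[symmetric] d
    by (auto simp: chain_map_def nodes_on_def inj_on_def split: if_splits)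
  moreover have "\<exists>e. (\<forall>u\<in>comps (chain_map d f). P1_morphism n k (e u) (comp_map (chain_map d f) u)) \<and>
      (\<Sum>u\<in>comps (chain_map d f). e u) = d"
    by (rule exI[of _ "\<lambda>_. 1"]) (use f in \<open>auto simp: chain_map_def\<close>)
  moreover have "\<forall>(u, v)\<in>edges (chain_map d f). comp_map (chain_map d f) u (node (chain_map d f) u v) =
      comp_map (chain_map d f) v (node (chain_map d f) v u)"
    using glue by (auto simp: chain_map_def)
  moreover have "\<not> (\<exists>V. \<forall>x. comp_map (chain_map d f) u x = V)" if "u \<in> comps (chain_map d f)" for u
    using nonconst[of u] that by (auto simp: chain_map_def)
  ultimately show ?thesis unfolding stable_map_def by blast
qed

lemma flag_locus_subset_curve_nbhd:
  assumes "1 \<le> k" "k \<le> n" "1 \<le> d"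
  shows "flag_locus n k d \<subseteq> curve_nbhd n k d (flag_locus n k 0)"
proof
  fix V assume "V \<in> flag_locus n k d"
  then obtain U f where Uf: "U 0 \<in> flag_locus n k 0" "U d = V"
    "\<And>i. i < d \<Longrightarrow> P1_morphism n k 1 (f i) \<and>
      f i P1_zero = U i \<and> f i P1_infinity = U (Suc i) \<and> U i \<noteq> U (Suc i)"
    using flag_locus_chain[OF _ assms(1,2)] by blast
  have "stable_map n k d (chain_map d f)"
    by (rule stable_map_chain_map[OF assms(3)]) (use Uf(3) in auto)
  moreover have "ev1 (chain_map d f) \<in> flag_locus n k 0"
    using Uf(1) Uf(3)[of 0] assms(3) by (simp add: ev1_def chain_map_def)
  moreover have "ev2 (chain_map d f) = V"
    using Uf(2) Uf(3)[of "d - 1"] assms(3) by (simp add: ev2_def chain_map_def)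
  ultimately show "V \<in> curve_nbhd n k d (flag_locus n k 0)"
    unfolding curve_nbhd_def by blast
qed

section \<open>The modified Hecke product\<close>

text \<open>For \<open>i = n + 1\<close> the pairs \<open>i, i + 1\<close> and
  \<open>bar n (i + 1), bar n i\<close> coincide, so one formula covers both branches of the
  definition.\<close>

lemma simple_refl_apply:
  assumes "1 \<le> i" "i \<le> n + 1"
  shows "simple_refl n i x = (if x = i then i + 1 else if x = i + 1 then i
    else if x = bar n i then bar n (i + 1) else if x = bar n (i + 1) then bar n i else x)"
proof (cases "i \<le> n")
  case True
  then have "i < bar n (i + 1)" "i + 1 < bar n (i + 1)" "bar n (i + 1) < bar n i"
    using assms by (auto simp: bar_def)
  then show ?thesis using True by (auto simp: simple_refl_def Transposition.transpose_def)
next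
  case False
  then have "i = n + 1" "bar n i = i + 1" "bar n (i + 1) = i" using assms by (auto simp: bar_def)
  then show ?thesis by (auto simp: simple_refl_def Transposition.transpose_def)
qed

lemma simple_refl_involution:
  assumes "1 \<le> i" "i \<le> n + 1"
  shows "simple_refl n i (simple_refl n i x) = x"
proof -
  have swap: "Transposition.transpose a b (Transposition.transpose c d
      (Transposition.transpose a b (Transposition.transpose c d y))) = y"
    if "a \<noteq> c" "a \<noteq> d" "b \<noteq> c" "b \<noteq> d" for a b c d y :: nat
    using that by (auto simp: Transposition.transpose_def)
  show ?thesis
  proof (cases "i \<le> n")
    case True
    then have "i \<noteq> bar n i" "i \<noteq> bar n (i + 1)" "i + 1 \<noteq> bar n i" "i + 1 \<noteq> bar n (i + 1)"
      using assms by (auto simp: bar_def)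
    then show ?thesis using True swap by (simp add: simple_refl_def)
  qed (simp add: simple_refl_def)
qed

lemma simple_refl_values:
  assumes "1 \<le> i" "i \<le> n + 1"
  shows "simple_refl n i i = i + 1" "simple_refl n i (i + 1) = i"
    "simple_refl n i (bar n i) = bar n (i + 1)" "simple_refl n i (bar n (i + 1)) = bar n i"
    "x \<notin> {i, i + 1, bar n i, bar n (i + 1)} \<Longrightarrow> simple_refl n i x = x"
proof -
  show s: "simple_refl n i i = i + 1" "simple_refl n i (i + 1) = i"
    "x \<notin> {i, i + 1, bar n i, bar n (i + 1)} \<Longrightarrow> simple_refl n i x = x"
    by (simp_all add: simple_refl_apply[OF assms])
  show b: "simple_refl n i (bar n i) = bar n (i + 1)"
  proof (cases "i \<le> n")
    case True
    then have "bar n i \<noteq> i" "bar n i \<noteq> i + 1" by (auto simp: bar_def)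
    then show ?thesis by (simp add: simple_refl_apply[OF assms])
  next
    case False
    then have "bar n i = i + 1" "bar n (i + 1) = i" using assms by (auto simp: bar_def)
    then show ?thesis using s(2) by simp
  qed
  show "simple_refl n i (bar n (i + 1)) = bar n i"
    unfolding b[symmetric] by (rule simple_refl_involution[OF assms])
qed

lemma simple_refl_range:
  assumes "1 \<le> i" "i \<le> n + 1" "x \<in> {1..2 * n + 2}"
  shows "simple_refl n i x \<in> {1..2 * n + 2}"
proof -
  consider "x = i" | "x = i + 1" | "x = bar n i" | "x = bar n (i + 1)"
    | "x \<notin> {i, i + 1, bar n i, bar n (i + 1)}" by blast
  moreover have "bar n i \<in> {1..2 * n + 2}" "bar n (i + 1) \<in> {1..2 * n + 2}"
    using assms(1,2) by (auto simp: bar_def)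
  ultimately show ?thesis
  proof cases
    case 5
    then show ?thesis using simple_refl_values(5)[OF assms(1,2) 5] assms(3) by simp
  qed (use assms(1,2) in \<open>simp_all only: simple_refl_values[OF assms(1,2)], simp_all\<close>)
qed

lemma simple_refl_bar:
  assumes "1 \<le> i" "i \<le> n + 1" "x \<in> {1..2 * n + 2}"
  shows "simple_refl n i (bar n x) = bar n (simple_refl n i x)"
proof -
  have bb: "bar n (bar n i) = i" "bar n (bar n (i + 1)) = i + 1" "bar n (bar n x) = x"
    using assms by (simp_all add: bar_bar)
  consider "x = i" | "x = i + 1" | "x = bar n i" | "x = bar n (i + 1)"
    | "x \<notin> {i, i + 1, bar n i, bar n (i + 1)}" by blast
  then show ?thesis
  proof cases
    case 5
    then have "bar n x \<notin> {i, i + 1, bar n i, bar n (i + 1)}" using bb by fastforce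
    then show ?thesis using simple_refl_values(5)[OF assms(1,2)] 5 by simp
  qed (simp_all only: simple_refl_values[OF assms(1,2)] bb)
qed

lemma simple_refl_Weyl:
  assumes "1 \<le> i" "i \<le> n + 1"
  shows "simple_refl n i \<in> Weyl n"
proof -
  have "bij_betw (simple_refl n i) {1..2 * n + 2} {1..2 * n + 2}"
    by (rule bij_betw_byWitness[where f' = "simple_refl n i"])
       (use simple_refl_involution[OF assms] simple_refl_range[OF assms] in blast)+
  moreover have "simple_refl n i x = x" if "x \<notin> {1..2 * n + 2}" for x
    by (rule simple_refl_values(5)[OF assms]) (use that assms in \<open>auto simp: bar_def\<close>)
  ultimately have "simple_refl n i permutes {1..2 * n + 2}" by (rule bij_imp_permutes)
  then show ?thesis using simple_refl_bar[OF assms] by (auto simp: Weyl_def)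
qed

section \<open>Inversions and Coxeter length\<close>

lemma Weyl_range: "w \<in> Weyl n \<Longrightarrow> x \<in> {1..2 * n + 2} \<Longrightarrow> w x \<in> {1..2 * n + 2}"
  using permutes_in_image[of w "{1..2 * n + 2}" x] by (auto simp: Weyl_def)

lemma Weyl_bar: "w \<in> Weyl n \<Longrightarrow> x \<in> {1..2 * n + 2} \<Longrightarrow> w (bar n x) = bar n (w x)"
  by (simp add: Weyl_def)

lemma Weyl_inj: "w \<in> Weyl n \<Longrightarrow> w x = w y \<longleftrightarrow> x = y"
  using permutes_inj[of w "{1..2 * n + 2}"] by (auto simp: Weyl_def inj_eq)

lemma Weyl_comp: "v \<in> Weyl n \<Longrightarrow> w \<in> Weyl n \<Longrightarrow> v \<circ> w \<in> Weyl n"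
  using Weyl_range[of w n] by (auto simp: Weyl_def permutes_compose)

text \<open>Twice the Coxeter length: an inversion \<open>(a, b)\<close> and its mirror \<open>(bar n b, bar n a)\<close> belong
  to the same reflection, so an inversion equal to its mirror counts twice.\<close>

definition inversions :: "nat \<Rightarrow> (nat \<Rightarrow> nat) \<Rightarrow> (nat \<times> nat) set" where
  "inversions n w = {(a, b). 1 \<le> a \<and> a < b \<and> b \<le> 2 * n + 2 \<and> w b < w a}"

definition inversion_weight :: "nat \<Rightarrow> (nat \<Rightarrow> nat) \<Rightarrow> nat" where
  "inversion_weight n w = (\<Sum>(a, b)\<in>inversions n w. if b = bar n a then 2 else 1)"

lemma finite_inversions: "finite (inversions n w)"
  by (rule finite_subset[of _ "{1..2 * n + 2} \<times> {1..2 * n + 2}"]) (auto simp: inversions_def)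

lemma simple_refl_mono:
  assumes i: "1 \<le> i" "i \<le> n + 1" and ab: "1 \<le> a" "a < b" "b \<le> 2 * n + 2"
    and "(a, b) \<noteq> (i, i + 1)" "(a, b) \<noteq> (bar n (i + 1), bar n i)"
  shows "simple_refl n i a < simple_refl n i b"
proof -
  define c where "c = bar n (i + 1)"
  \<comment> \<open>The reflection swaps \<open>i, i + 1\<close> and \<open>c, c + 1\<close>; these
    two adjacent pairs are equal or disjoint, so no other pair can be reversed.\<close>
  have c: "bar n i = c + 1" "c = i \<or> i + 2 \<le> c"
    using i by (cases "i = n + 1"; auto simp: c_def bar_def)+
  have s: "simple_refl n i x = (if x = i then i + 1 else if x = i + 1 then i
    else if x = c + 1 then c else if x = c then c + 1 else x)" for x
    using simple_refl_apply[OF i, of x] c(1) by (simp add: c_def)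
  have "a \<noteq> i \<or> b \<noteq> i + 1" "a \<noteq> c \<or> b \<noteq> c + 1" using assms c by (auto simp: c_def)
  then show ?thesis unfolding s using ab(2) c(2) by (auto split: if_splits)
qed

text \<open>Applying the reflection to both entries matches the inversions of \<open>w\<close> with
  those of the product outside \<open>?X\<close>, and it preserves self-mirrored pairs. The new
  inversions \<open>?X\<close> have weight 2: two mirrored pairs for \<open>i \<le> n\<close>, one
  self-mirrored pair for \<open>i = n + 1\<close>.\<close>

lemma inversion_weight_ascent:
  assumes w: "w \<in> Weyl n" and i: "1 \<le> i" "i \<le> n + 1" and asc: "w i < w (i + 1)"
  shows "inversion_weight n (w \<circ> simple_refl n i) = inversion_weight n w + 2"
proof -
  let ?s = "simple_refl n i" and ?wt = "\<lambda>(a, b). if b = bar n a then 2 else 1 :: nat"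
  let ?X = "{(i, i + 1), (bar n (i + 1), bar n i)}"
  let ?\<phi> = "map_prod ?s ?s"
  have inv: "?s (?s x) = x" for x by (rule simple_refl_involution[OF i])
  have wbar: "w (bar n (i + 1)) < w (bar n i)" "w (bar n (i + 1)) = bar n (w (i + 1))"
    "w (bar n i) = bar n (w i)"
    using Weyl_bar[OF w, of i] Weyl_bar[OF w, of "i + 1"] Weyl_range[OF w, of i]
      Weyl_range[OF w, of "i + 1"] i asc by (auto simp: bar_def)
  note sX = simple_refl_values(1-4)[OF i]
  have X: "?X \<subseteq> inversions n (w \<circ> ?s)"
  proof -
    have "1 \<le> bar n (i + 1)" "bar n (i + 1) < bar n i" "bar n i \<le> 2 * n + 2"
      using i by (auto simp: bar_def)
    moreover have "(w \<circ> ?s) (i + 1) < (w \<circ> ?s) i" "(w \<circ> ?s) (bar n i) < (w \<circ> ?s) (bar n (i + 1))"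
      using asc wbar(1) by (simp_all only: o_apply sX)
    ultimately show ?thesis using i unfolding inversions_def by auto
  qed
  have notX: "(a, b) \<notin> ?X" if "(a, b) \<in> inversions n w" for a b
    using that asc wbar(1) by (auto simp: inversions_def)
  have bij: "bij_betw ?\<phi> (inversions n w) (inversions n (w \<circ> ?s) - ?X)"
  proof (rule bij_betw_byWitness[where f' = ?\<phi>])
    show "?\<phi> ` inversions n w \<subseteq> inversions n (w \<circ> ?s) - ?X"
    proof (rule image_subsetI)
      fix p assume p: "p \<in> inversions n w"
      obtain a b where ab: "p = (a, b)" by fastforce
      have r: "1 \<le> a" "a < b" "b \<le> 2 * n + 2" "w b < w a" using p ab by (auto simp: inversions_def)
      have "?s a < ?s b"
        using simple_refl_mono[OF i r(1-3)] notX[of a b] p ab by blast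
      moreover have "1 \<le> ?s a" "?s b \<le> 2 * n + 2"
        using simple_refl_range[OF i, of a] simple_refl_range[OF i, of b] r by auto
      ultimately have "?\<phi> p \<in> inversions n (w \<circ> ?s)" using r(4) by (simp add: ab inversions_def inv)
      moreover have "?\<phi> p \<notin> ?X"
      proof
        assume "?\<phi> p \<in> ?X"
        then have "?\<phi> (?\<phi> p) \<in> ?\<phi> ` ?X" by (rule imageI)
        then have "(a, b) \<in> {(i + 1, i), (bar n i, bar n (i + 1))}" by (simp only: ab map_prod_simp inv image_insert image_empty sX)
        then show False using r(2) i by (auto simp: bar_def)
      qed
      ultimately show "?\<phi> p \<in> inversions n (w \<circ> ?s) - ?X" by blast
    qed
    show "?\<phi> ` (inversions n (w \<circ> ?s) - ?X) \<subseteq> inversions n w"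
    proof (rule image_subsetI)
      fix p assume p: "p \<in> inversions n (w \<circ> ?s) - ?X"
      obtain a b where ab: "p = (a, b)" by fastforce
      have r: "1 \<le> a" "a < b" "b \<le> 2 * n + 2" "w (?s b) < w (?s a)"
        using p ab by (auto simp: inversions_def)
      have "?s a < ?s b" using simple_refl_mono[OF i r(1-3)] p ab by blast
      then show "?\<phi> p \<in> inversions n w"
        using simple_refl_range[OF i, of a] simple_refl_range[OF i, of b] r
        by (simp add: ab inversions_def)
    qed
  qed (auto simp: inv)
  have wt: "?wt (?\<phi> p) = ?wt p" if p: "p \<in> inversions n w" for p
  proof -
    obtain a b where ab: "p = (a, b)" by fastforce
    have a: "a \<in> {1..2 * n + 2}" using p ab by (auto simp: inversions_def)
    have "?s b = bar n (?s a) \<longleftrightarrow> ?s b = ?s (bar n a)" using simple_refl_bar[OF i a] by simp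
    also have "\<dots> \<longleftrightarrow> b = bar n a" using inv by metis
    finally show ?thesis by (simp add: ab)
  qed
  have "inversion_weight n (w \<circ> ?s) =
      sum ?wt (inversions n (w \<circ> ?s) - ?X) + sum ?wt ?X"
    unfolding inversion_weight_def by (rule sum.subset_diff[OF X finite_inversions])
  also have "sum ?wt (inversions n (w \<circ> ?s) - ?X) = inversion_weight n w"
    unfolding inversion_weight_def sum.reindex_bij_betw[OF bij, symmetric]
    by (rule sum.cong) (use wt in auto)
  also have "sum ?wt ?X = 2"
  proof (cases "i \<le> n")
    case True
    then show ?thesis using i by (auto simp: bar_def)
  next
    case False
    then have "i = n + 1" using i by simp
    then have "?X = {(n + 1, n + 2)}" by (auto simp: bar_def)
    then show ?thesis by (simp only:) (simp add: bar_def)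
  qed
  finally show ?thesis .
qed

lemma comp_simple_refl_twice:
  assumes "1 \<le> i" "i \<le> n + 1"
  shows "w \<circ> simple_refl n i \<circ> simple_refl n i = w"
  using simple_refl_involution[OF assms] by auto

lemma inversion_weight_descent:
  assumes w: "w \<in> Weyl n" and i: "1 \<le> i" "i \<le> n + 1" and desc: "w (i + 1) < w i"
  shows "inversion_weight n w = inversion_weight n (w \<circ> simple_refl n i) + 2"
proof -
  have "inversion_weight n (w \<circ> simple_refl n i \<circ> simple_refl n i) =
      inversion_weight n (w \<circ> simple_refl n i) + 2"
  proof (rule inversion_weight_ascent[OF Weyl_comp[OF w simple_refl_Weyl[OF i]] i])
    show "(w \<circ> simple_refl n i) i < (w \<circ> simple_refl n i) (i + 1)"
      using desc i by (simp add: simple_refl_apply)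
  qed
  then show ?thesis by (simp only: comp_simple_refl_twice[OF i])
qed

lemma strict_mono_permutation_id:
  assumes r: "\<And>i. i \<in> {1..N} \<Longrightarrow> w i \<in> {1..N :: nat}"
    and asc: "\<And>i. 1 \<le> i \<Longrightarrow> i < N \<Longrightarrow> w i < w (i + 1)" and i: "i \<in> {1..N}"
  shows "w i = i"
proof -
  have "1 \<le> i \<longrightarrow> i \<le> w i" if "i \<le> N" for i
    using that
  proof (induction i)
    case (Suc i)
    then show ?case using asc[of i] r[of 1] by (cases "i = 0") auto
  qed simp
  moreover have "w i \<le> i" if "i \<le> N" "1 \<le> i" for i
    using that
  proof (induction rule: inc_induct)
    case base
    then show ?case using r[of N] by auto
  next
    case (step j)
    then show ?case using asc[of j] by auto
  qed
  ultimately show ?thesis using i by (simp add: antisym)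
qed

text \<open>The symmetry under \<open>bar n\<close> mirrors the ascents to the second half, so
  \<open>w\<close> increases on all of \<open>{1..2 * n + 2}\<close>.\<close>

lemma Weyl_no_descent:
  assumes w: "w \<in> Weyl n" and asc: "\<And>i. 1 \<le> i \<Longrightarrow> i \<le> n + 1 \<Longrightarrow> w i < w (i + 1)"
  shows "w = id"
proof
  fix x
  have "w i < w (i + 1)" if i: "1 \<le> i" "i < 2 * n + 2" for i
  proof (cases "i \<le> n + 1")
    case False
    let ?j = "bar n (i + 1)"
    have j: "1 \<le> ?j" "?j \<le> n + 1" "?j + 1 = bar n i" using False i by (auto simp: bar_def)
    have "w ?j < w (bar n i)" using asc[OF j(1,2)] j(3) by simp
    then show ?thesis
      using Weyl_bar[OF w, of i] Weyl_bar[OF w, of "i + 1"] Weyl_range[OF w, of i]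
        Weyl_range[OF w, of "i + 1"] i by (auto simp: bar_def)
  qed (use asc i in auto)
  then have "w x = x" if "x \<in> {1..2 * n + 2}"
    by (intro strict_mono_permutation_id[of "2 * n + 2" w x] Weyl_range[OF w] that) auto
  moreover have "w x = x" if "x \<notin> {1..2 * n + 2}"
    using w that by (auto simp: Weyl_def permutes_def)
  ultimately show "w x = id x" by auto
qed

lemma Weyl_id: "id \<in> Weyl n"
  unfolding Weyl_def by (rule CollectI, rule conjI, rule permutes_id, simp)

lemma inversion_weight_id: "inversion_weight n id = 0"
proof -
  have "inversions n id = {}" unfolding inversions_def id_apply by auto
  then show ?thesis by (simp add: inversion_weight_def)
qed

lemma word_prod_Nil: "word_prod n [] = id"
  by (simp add: word_prod_def)

lemma word_prod_snoc: "word_prod n (is @ [i]) = word_prod n is \<circ> simple_refl n i"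
proof -
  have "foldr (\<lambda>i w. simple_refl n i \<circ> w) is v = word_prod n is \<circ> v" for v
    by (induction "is") (simp_all add: word_prod_def comp_assoc)
  then show ?thesis by (simp add: word_prod_def)
qed

lemma word_prod_Weyl: "set is \<subseteq> {1..n + 1} \<Longrightarrow> word_prod n is \<in> Weyl n"
proof (induction "is" rule: rev_induct)
  case Nil
  show ?case unfolding word_prod_Nil by (rule Weyl_id)
next
  case (snoc i "is")
  then show ?case unfolding word_prod_snoc by (intro Weyl_comp simple_refl_Weyl) auto
qed

lemma inversion_weight_word_prod:
  "set is \<subseteq> {1..n + 1} \<Longrightarrow> inversion_weight n (word_prod n is) \<le> 2 * length is"
proof (induction "is" rule: rev_induct)
  case Nil
  show ?case unfolding word_prod_Nil inversion_weight_id by simp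
next
  case (snoc i "is")
  let ?w = "word_prod n is"
  have w: "?w \<in> Weyl n" by (rule word_prod_Weyl) (use snoc.prems in auto)
  have i: "1 \<le> i" "i \<le> n + 1" using snoc.prems by auto
  have "?w i \<noteq> ?w (i + 1)" using Weyl_inj[OF w] by simp
  then have "?w i < ?w (i + 1) \<or> ?w (i + 1) < ?w i" by (rule neq_iff[THEN iffD1])
  then have "inversion_weight n (?w \<circ> simple_refl n i) \<le> inversion_weight n ?w + 2"
    using inversion_weight_ascent[OF w i] inversion_weight_descent[OF w i] by linarith
  moreover have "inversion_weight n (word_prod n (is @ [i])) = inversion_weight n (?w \<circ> simple_refl n i)"
    by (rule arg_cong[OF word_prod_snoc])
  moreover have "inversion_weight n ?w \<le> 2 * length is" using snoc by simp
  ultimately show ?case by simp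
qed

lemma Weyl_reduced_word:
  assumes "w \<in> Weyl n"
  shows "\<exists>is. set is \<subseteq> {1..n + 1} \<and> word_prod n is = w \<and> 2 * length is = inversion_weight n w"
  using assms
proof (induction "inversion_weight n w" arbitrary: w rule: less_induct)
  case less
  show ?case
  proof (cases "\<exists>i. 1 \<le> i \<and> i \<le> n + 1 \<and> w (i + 1) < w i")
    case True
    then obtain i where i: "1 \<le> i" "i \<le> n + 1" "w (i + 1) < w i" by blast
    have d: "inversion_weight n w = inversion_weight n (w \<circ> simple_refl n i) + 2"
      by (rule inversion_weight_descent[OF less.prems i])
    obtain "is" where "set is \<subseteq> {1..n + 1}" "word_prod n is = w \<circ> simple_refl n i"
      "2 * length is = inversion_weight n (w \<circ> simple_refl n i)"
      using less.hyps[of "w \<circ> simple_refl n i"] d Weyl_comp[OF less.prems simple_refl_Weyl[OF i(1,2)]]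
      by auto
    moreover from this(2) have "word_prod n (is @ [i]) = w"
      using word_prod_snoc[of n "is" i] comp_simple_refl_twice[OF i(1,2), of w] by simp
    ultimately show ?thesis using i d by (intro exI[of _ "is @ [i]"] conjI) auto
  next
    case False
    have "w = id"
    proof (rule Weyl_no_descent[OF less.prems])
      fix i assume "1 \<le> i" "i \<le> n + 1"
      then have "\<not> w (i + 1) < w i" using False by blast
      moreover have "w i \<noteq> w (i + 1)" using Weyl_inj[OF less.prems, of i "i + 1"] by simp
      ultimately show "w i < w (i + 1)" by linarith
    qed
    then show ?thesis
      by (intro exI[of _ "[]"] conjI) (simp_all add: word_prod_Nil inversion_weight_id[unfolded id_def] id_def)
  qed
qed

text \<open>Each letter changes the weight by at most 2, which bounds words from below; removing
  descents one by one gives a word that attains the bound.\<close>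

lemma weyl_length_eq:
  assumes "w \<in> Weyl n"
  shows "2 * weyl_length n w = inversion_weight n w"
proof -
  obtain "is" where "is": "set is \<subseteq> {1..n + 1}" "word_prod n is = w" "2 * length is = inversion_weight n w"
    using Weyl_reduced_word[OF assms] by blast
  have "weyl_length n w = length is"
    unfolding weyl_length_def
  proof (rule Least_equality)
    show "\<exists>js. length js = length is \<and> set js \<subseteq> {1..n + 1} \<and> word_prod n js = w" using "is" by blast
    show "length is \<le> m" if "\<exists>js. length js = m \<and> set js \<subseteq> {1..n + 1} \<and> word_prod n js = w" for m
      using that "is"(3) inversion_weight_word_prod by fastforce
  qed
  then show ?thesis using "is"(3) by simp
qed

text \<open>From here on lengths disappear: a letter is decided by comparing two adjacent
  values.\<close>

lemma hecke_eq:
  assumes w: "w \<in> Weyl n" and i: "1 \<le> i" "i \<le> n + 1"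
  shows "hecke n k w i = (if w i < w (i + 1) \<or> i = k then w \<circ> simple_refl n i else w)"
proof -
  have w': "w \<circ> simple_refl n i \<in> Weyl n" by (rule Weyl_comp[OF w simple_refl_Weyl[OF i]])
  have "w i \<noteq> w (i + 1)" using Weyl_inj[OF w] by simp
  then have "weyl_length n (w \<circ> simple_refl n i) > weyl_length n w \<longleftrightarrow> w i < w (i + 1)"
    using weyl_length_eq[OF w] weyl_length_eq[OF w'] inversion_weight_ascent[OF w i]
      inversion_weight_descent[OF w i] by (cases "w i < w (i + 1)") auto
  then show ?thesis by (simp add: hecke_def)
qed

section \<open>The product on one-line notation\<close>

lemma hecke_Weyl:
  assumes "w \<in> Weyl n" "1 \<le> i" "i \<le> n + 1"
  shows "hecke n k w i \<in> Weyl n"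
  using hecke_eq[OF assms] Weyl_comp[OF assms(1) simple_refl_Weyl[OF assms(2,3)]] assms(1) by simp

lemma hecke_swap:
  assumes "w \<in> Weyl n" "1 \<le> i" "i \<le> n" "w i < w (i + 1) \<or> i = k" "j \<le> n + 1"
  shows "hecke n k w i j = (if j = i then w (i + 1) else if j = i + 1 then w i else w j)"
proof -
  have "j \<noteq> bar n i" "j \<noteq> bar n (i + 1)" using assms by (auto simp: bar_def)
  then show ?thesis using assms by (simp add: hecke_eq simple_refl_apply)
qed

lemma hecke_negate:
  assumes w: "w \<in> Weyl n" and "w (n + 1) \<le> n + 1" "j \<le> n + 1"
  shows "hecke n k w (n + 1) j = (if j = n + 1 then bar n (w (n + 1)) else w j)"
proof -
  have b: "bar n (n + 1) = n + 2" by (simp add: bar_def)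
  then have w2: "w (n + 2) = bar n (w (n + 1))" using Weyl_bar[OF w, of "n + 1"] by simp
  then have "w (n + 1) < w (n + 1 + 1)" using assms(2) by (simp add: bar_def)
  then show ?thesis using assms w2 by (auto simp: hecke_eq simple_refl_apply bar_def)
qed

lemma hecke_unchanged:
  assumes "w \<in> Weyl n" "1 \<le> i" "i \<le> n + 1" "i \<noteq> k" "w (i + 1) < w i"
  shows "hecke n k w i = w"
  using assms by (simp add: hecke_eq)

lemma foldl_hecke_unchanged:
  assumes "w \<in> Weyl n" "\<And>i. i \<in> set is \<Longrightarrow> 1 \<le> i \<and> i \<le> n + 1 \<and> i \<noteq> k \<and> w (i + 1) < w i"
  shows "foldl (hecke n k) w is = w"
  using assms(2) by (induction "is") (auto simp: hecke_unchanged[OF assms(1)])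

text \<open>The travelling value \<open>w a\<close> is smaller than every value it passes, so each
  letter meets an ascent and acts.\<close>

lemma foldl_hecke_up:
  assumes w: "w \<in> Weyl n" and ab: "1 \<le> a" "a \<le> b" "b \<le> n + 1"
    and less: "\<And>j. a < j \<Longrightarrow> j \<le> b \<Longrightarrow> w a < w j"
  shows "foldl (hecke n k) w [a..<b] \<in> Weyl n \<and> (\<forall>j\<le>n + 1. foldl (hecke n k) w [a..<b] j =
    (if j = b then w a else if a \<le> j \<and> j < b then w (j + 1) else w j))"
  using ab(2,3) less
proof (induction b rule: dec_induct)
  case base
  then show ?case using w by auto
next
  case (step b)
  let ?u = "foldl (hecke n k) w [a..<b]"
  have u: "?u \<in> Weyl n" "\<And>j. j \<le> n + 1 \<Longrightarrow>
      ?u j = (if j = b then w a else if a \<le> j \<and> j < b then w (j + 1) else w j)"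
    using step.IH step.prems by auto
  have eq: "foldl (hecke n k) w [a..<Suc b] = hecke n k ?u b" using step.hyps by simp
  have "?u b < ?u (b + 1)" using u(2)[of b] u(2)[of "b + 1"] step by simp
  then have "hecke n k ?u b j = (if j = b then ?u (b + 1) else if j = b + 1 then ?u b else ?u j)"
    if "j \<le> n + 1" for j
    using that step ab by (intro hecke_swap[OF u(1)]) auto
  moreover have "hecke n k ?u b \<in> Weyl n" using step ab by (intro hecke_Weyl[OF u(1)]) auto
  ultimately show ?case unfolding eq using u(2) step by (auto simp: less_Suc_eq)
qed

text \<open>Here the travelling value \<open>w b\<close> is larger than every value it passes on the
  way down.\<close>

lemma foldl_hecke_down:
  assumes "w \<in> Weyl n" and ab: "1 \<le> a" "a \<le> b" "b \<le> n + 1"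
    and less: "\<And>j. a \<le> j \<Longrightarrow> j < b \<Longrightarrow> w j < w b"
  shows "foldl (hecke n k) w (rev [a..<b]) \<in> Weyl n \<and> (\<forall>j\<le>n + 1. foldl (hecke n k) w (rev [a..<b]) j =
    (if j = a then w b else if a < j \<and> j \<le> b then w (j - 1) else w j))"
  using ab(2,3) assms(1) less
proof (induction b arbitrary: w rule: dec_induct)
  case base
  then show ?case by auto
next
  case (step b)
  let ?u = "hecke n k w b"
  have b: "1 \<le> b" "b \<le> n" "b \<le> n + 1" using step ab by auto
  have w: "w \<in> Weyl n" by fact
  have u: "?u \<in> Weyl n" by (rule hecke_Weyl[OF w b(1,3)])
  have "w b < w (b + 1)" using step by simp
  then have uj: "?u j = (if j = b then w (b + 1) else if j = b + 1 then w b else w j)" if "j \<le> n + 1" for j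
    using that by (intro hecke_swap[OF w b(1,2)]) auto
  have eq: "foldl (hecke n k) w (rev [a..<Suc b]) = foldl (hecke n k) ?u (rev [a..<b])"
    using step.hyps by simp
  have "?u j < ?u b" if "a \<le> j" "j < b" for j
    using uj[of j] uj[of b] step.prems(3)[of j] that b by simp
  then have IH: "foldl (hecke n k) ?u (rev [a..<b]) \<in> Weyl n"
    "\<And>j. j \<le> n + 1 \<Longrightarrow> foldl (hecke n k) ?u (rev [a..<b]) j =
      (if j = a then ?u b else if a < j \<and> j \<le> b then ?u (j - 1) else ?u j)"
    using step.IH[OF _ u] b by auto
  show ?case unfolding eq
  proof (intro conjI allI impI IH(1))
    fix j assume j: "j \<le> n + 1"
    show "foldl (hecke n k) ?u (rev [a..<b]) j =
        (if j = a then w (Suc b) else if a < j \<and> j \<le> Suc b then w (j - 1) else w j)"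
      using IH(2)[OF j] uj[of b] uj[of "j - 1"] uj[OF j] j b step.hyps by auto
  qed
qed

text \<open>The Schubert variety depends only on the values at \<open>1..k\<close>. Position
  \<open>k + 1\<close> is recorded because the forced swap exchanges it with position
  \<open>k\<close>; the later positions are recorded only while \<open>m < k\<close>, as further
  rounds may permute them.\<close>

definition hecke_state :: "nat \<Rightarrow> nat \<Rightarrow> nat \<Rightarrow> (nat \<Rightarrow> nat) \<Rightarrow> bool" where
  "hecke_state n k m w \<longleftrightarrow> w \<in> Weyl n \<and> (\<forall>j\<in>{1..k}. w j = (if j \<le> m then bar n (j + 1) else j + 1)) \<and>
     w (k + 1) = 1 \<and> (m < k \<longrightarrow> (\<forall>j\<in>{k + 2..n + 1}. w j = j))"

text \<open>Monotonicity is squeezed from both ends: downward from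
  \<open>w (n + 1) \<le> n + 1\<close>, and upward from position \<open>k + 2\<close>, where the
  value jumps from \<open>1\<close> to at least \<open>k + 2\<close> because \<open>2..k + 1\<close>
  are taken.\<close>

lemma hecke_state_id_Y:
  assumes "is_id_Y n k w" "k \<le> n"
  shows "hecke_state n k 0 w"
proof -
  have W: "w \<in> Weyl n" and sm: "strict_mono_on {k + 1..n + 1} w" and le: "w (n + 1) \<le> n + 1"
    and eq: "\<And>i. i \<in> {1..k} \<Longrightarrow> w i = i + 1"
    using assms(1) by (auto simp: is_id_Y_def min_reps_def)
  have upper: "w j \<le> j" if "j \<le> n + 1" "k + 1 \<le> j" for j
    using that
  proof (induction rule: inc_induct)
    case (step j)
    then show ?case using strict_mono_onD[OF sm, of j "Suc j"] by auto
  qed (use le in auto)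
  have notin: "w j \<notin> {2..k + 1}" if "j > k" for j
  proof
    assume a: "w j \<in> {2..k + 1}"
    define l where "l = w j - 1"
    have l: "l \<in> {1..k}" "w j = l + 1" using a by (auto simp: l_def)
    then have "w l = w j" using eq by simp
    then show False using Weyl_inj[OF W, of l j] l(1) that by simp
  qed
  have pos: "1 \<le> w j" if "1 \<le> j" "j \<le> n + 1" for j using Weyl_range[OF W, of j] that by auto
  have one: "w (k + 1) = 1" using upper[of "k + 1"] notin[of "k + 1"] pos[of "k + 1"] assms(2) by force
  have lower: "k + 2 \<le> j \<longrightarrow> j \<le> w j" if "j \<le> n + 1" for j
    using that
  proof (induction j)
    case (Suc j)
    show ?case
    proof
      assume j: "k + 2 \<le> Suc j"
      have less: "w j < w (Suc j)" using j Suc.prems by (intro strict_mono_onD[OF sm]) auto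
      show "Suc j \<le> w (Suc j)"
      proof (cases "j = k + 1")
        case True
        then show ?thesis using less one notin[of "Suc j"] by auto
      next
        case False
        then show ?thesis using Suc j less by auto
      qed
    qed
  qed simp
  have "w j = j" if "j \<in> {k + 2..n + 1}" for j
    using that upper[of j] lower[of j] by (intro antisym) auto
  then show ?thesis using W eq one by (simp add: hecke_state_def)
qed

lemma upt_split: "i \<le> j \<Longrightarrow> j \<le> l \<Longrightarrow> [i..<l] = [i..<j] @ [j..<l]"
  using upt_add_eq_append[of i j "l - j"] by simp

text \<open>While \<open>m < k\<close>, the value \<open>m + 2\<close> is carried from position \<open>m + 1\<close> to the end, is negated there,
  and returns to position \<open>m + 1\<close>.\<close>

lemma hecke_O1_state_less:
  assumes st: "hecke_state n k m w" and mk: "m < k" and kn: "k \<le> n"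
  shows "hecke_state n k (m + 1) (hecke_O1 n k w)"
proof -
  let ?f = "foldl (hecke n k)"
  have W: "w \<in> Weyl n" and w1: "\<And>j. 1 \<le> j \<Longrightarrow> j \<le> m \<Longrightarrow> w j = bar n (j + 1)"
    and w2: "\<And>j. m < j \<Longrightarrow> j \<le> k \<Longrightarrow> w j = j + 1" and w3: "w (k + 1) = 1"
    and w4: "\<And>j. k + 2 \<le> j \<Longrightarrow> j \<le> n + 1 \<Longrightarrow> w j = j"
    using st mk by (auto simp: hecke_state_def)
  have word: "[1..<n + 2] @ rev [1..<n + 1] = [1..<m + 1] @ [m + 1..<k] @ [k] @ [k + 1..<n + 1] @ [n + 1]
      @ rev [k + 1..<n + 1] @ [k] @ rev [m + 1..<k] @ rev [1..<m + 1]"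
  proof -
    have "[1..<n + 1] = [1..<m + 1] @ [m + 1..<k] @ [k] @ [k + 1..<n + 1]"
      using mk kn upt_split[of 1 "m + 1" "n + 1"] upt_split[of "m + 1" k "n + 1"]
        upt_split[of k "k + 1" "n + 1"] by simp
    moreover have "[1..<n + 2] = [1..<n + 1] @ [n + 1]" by simp
    ultimately show ?thesis by simp
  qed
  have s0: "?f w [1..<m + 1] = w"
  proof (rule foldl_hecke_unchanged[OF W])
    fix i assume i: "i \<in> set [1..<m + 1]"
    \<comment> \<open>At the last letter \<open>i = m\<close> the descent goes from
      \<open>bar n (m + 1)\<close> to the unnegated value \<open>m + 2\<close>.\<close>
    then have "w (i + 1) < w i"
      using w1[of i] w1[of "i + 1"] w2[of "i + 1"] mk kn by (cases "i = m") (auto simp: bar_def)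
    then show "1 \<le> i \<and> i \<le> n + 1 \<and> i \<noteq> k \<and> w (i + 1) < w i" using i mk kn by auto
  qed
  define u1 where "u1 = ?f w [m + 1..<k]"
  have "u1 \<in> Weyl n \<and> (\<forall>j\<le>n + 1. u1 j =
      (if j = k then w (m + 1) else if m + 1 \<le> j \<and> j < k then w (j + 1) else w j))"
    unfolding u1_def by (rule foldl_hecke_up[OF W]) (use mk kn w2 in auto)
  then have U1: "u1 \<in> Weyl n" "u1 k = m + 2" "u1 (k + 1) = 1"
    "\<And>j. 1 \<le> j \<Longrightarrow> j \<le> m \<Longrightarrow> u1 j = bar n (j + 1)" "\<And>j. m < j \<Longrightarrow> j < k \<Longrightarrow> u1 j = j + 2"
    "\<And>j. k + 2 \<le> j \<Longrightarrow> j \<le> n + 1 \<Longrightarrow> u1 j = j"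
    using w1 w2 w3 w4 mk kn by auto
  \<comment> \<open>The values at \<open>k\<close> and \<open>k + 1\<close> are \<open>m + 2\<close>
    and \<open>1\<close>, a descent: the letter acts only by the special rule for
    \<open>k\<close>.\<close>
  define u2 where "u2 = hecke n k u1 k"
  have "u2 j = (if j = k then u1 (k + 1) else if j = k + 1 then u1 k else u1 j)" if "j \<le> n + 1" for j
    unfolding u2_def using that mk kn by (intro hecke_swap[OF U1(1)]) auto
  moreover have "u2 \<in> Weyl n" unfolding u2_def using mk kn by (intro hecke_Weyl[OF U1(1)]) auto
  ultimately have U2: "u2 \<in> Weyl n" "u2 k = 1" "u2 (k + 1) = m + 2"
    "\<And>j. 1 \<le> j \<Longrightarrow> j \<le> m \<Longrightarrow> u2 j = bar n (j + 1)" "\<And>j. m < j \<Longrightarrow> j < k \<Longrightarrow> u2 j = j + 2"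
    "\<And>j. k + 2 \<le> j \<Longrightarrow> j \<le> n + 1 \<Longrightarrow> u2 j = j"
    using U1 mk kn by auto
  define u3 where "u3 = ?f u2 [k + 1..<n + 1]"
  have "u3 \<in> Weyl n \<and> (\<forall>j\<le>n + 1. u3 j =
      (if j = n + 1 then u2 (k + 1) else if k + 1 \<le> j \<and> j < n + 1 then u2 (j + 1) else u2 j))"
    unfolding u3_def by (rule foldl_hecke_up[OF U2(1)]) (use mk kn U2 in auto)
  then have U3: "u3 \<in> Weyl n" "u3 k = 1" "u3 (n + 1) = m + 2"
    "\<And>j. 1 \<le> j \<Longrightarrow> j \<le> m \<Longrightarrow> u3 j = bar n (j + 1)" "\<And>j. m < j \<Longrightarrow> j < k \<Longrightarrow> u3 j = j + 2"
    "\<And>j. k + 1 \<le> j \<Longrightarrow> j < n + 1 \<Longrightarrow> u3 j = j + 1"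
    using U2 mk kn by auto
  define u4 where "u4 = hecke n k u3 (n + 1)"
  have "u4 j = (if j = n + 1 then bar n (u3 (n + 1)) else u3 j)" if "j \<le> n + 1" for j
    unfolding u4_def using that mk kn U3 by (intro hecke_negate[OF U3(1)]) auto
  moreover have "u4 \<in> Weyl n" unfolding u4_def by (intro hecke_Weyl[OF U3(1)]) auto
  ultimately have U4: "u4 \<in> Weyl n" "u4 k = 1" "u4 (n + 1) = bar n (m + 2)"
    "\<And>j. 1 \<le> j \<Longrightarrow> j \<le> m \<Longrightarrow> u4 j = bar n (j + 1)" "\<And>j. m < j \<Longrightarrow> j < k \<Longrightarrow> u4 j = j + 2"
    "\<And>j. k + 1 \<le> j \<Longrightarrow> j < n + 1 \<Longrightarrow> u4 j = j + 1"
    using U3 mk kn by auto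
  define u5 where "u5 = ?f u4 (rev [k + 1..<n + 1])"
  have "u5 \<in> Weyl n \<and> (\<forall>j\<le>n + 1. u5 j =
      (if j = k + 1 then u4 (n + 1) else if k + 1 < j \<and> j \<le> n + 1 then u4 (j - 1) else u4 j))"
    unfolding u5_def by (rule foldl_hecke_down[OF U4(1)]) (use mk kn U4 in \<open>auto simp: bar_def\<close>)
  then have U5: "u5 \<in> Weyl n" "u5 k = 1" "u5 (k + 1) = bar n (m + 2)"
    "\<And>j. 1 \<le> j \<Longrightarrow> j \<le> m \<Longrightarrow> u5 j = bar n (j + 1)" "\<And>j. m < j \<Longrightarrow> j < k \<Longrightarrow> u5 j = j + 2"
    "\<And>j. k + 2 \<le> j \<Longrightarrow> j \<le> n + 1 \<Longrightarrow> u5 j = j"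
    using U4 mk kn by auto
  define u6 where "u6 = hecke n k u5 k"
  have "u6 j = (if j = k then u5 (k + 1) else if j = k + 1 then u5 k else u5 j)" if "j \<le> n + 1" for j
    unfolding u6_def using that mk kn by (intro hecke_swap[OF U5(1)]) auto
  moreover have "u6 \<in> Weyl n" unfolding u6_def using mk kn by (intro hecke_Weyl[OF U5(1)]) auto
  ultimately have U6: "u6 \<in> Weyl n" "u6 k = bar n (m + 2)" "u6 (k + 1) = 1"
    "\<And>j. 1 \<le> j \<Longrightarrow> j \<le> m \<Longrightarrow> u6 j = bar n (j + 1)" "\<And>j. m < j \<Longrightarrow> j < k \<Longrightarrow> u6 j = j + 2"
    "\<And>j. k + 2 \<le> j \<Longrightarrow> j \<le> n + 1 \<Longrightarrow> u6 j = j"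
    using U5 mk kn by auto
  define u7 where "u7 = ?f u6 (rev [m + 1..<k])"
  have "u7 \<in> Weyl n \<and> (\<forall>j\<le>n + 1. u7 j =
      (if j = m + 1 then u6 k else if m + 1 < j \<and> j \<le> k then u6 (j - 1) else u6 j))"
    unfolding u7_def by (rule foldl_hecke_down[OF U6(1)]) (use mk kn U6 in \<open>auto simp: bar_def\<close>)
  then have U7: "u7 \<in> Weyl n" "u7 (m + 1) = bar n (m + 2)" "u7 (k + 1) = 1"
    "\<And>j. 1 \<le> j \<Longrightarrow> j \<le> m \<Longrightarrow> u7 j = bar n (j + 1)" "\<And>j. m + 1 < j \<Longrightarrow> j \<le> k \<Longrightarrow> u7 j = j + 1"
    "\<And>j. k + 2 \<le> j \<Longrightarrow> j \<le> n + 1 \<Longrightarrow> u7 j = j"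
    using U6 mk kn by auto
  have "?f u7 (rev [1..<m + 1]) = u7"
  proof (rule foldl_hecke_unchanged[OF U7(1)])
    fix i assume i: "i \<in> set (rev [1..<m + 1])"
    then have "u7 (i + 1) < u7 i"
      using U7(2) U7(4)[of i] U7(4)[of "i + 1"] mk kn by (cases "i = m") (auto simp: bar_def)
    then show "1 \<le> i \<and> i \<le> n + 1 \<and> i \<noteq> k \<and> u7 (i + 1) < u7 i" using i mk kn by auto
  qed
  then have "hecke_O1 n k w = u7"
    unfolding hecke_O1_def word
    by (simp only: foldl_append foldl.simps s0 u1_def[symmetric] u2_def[symmetric] u3_def[symmetric]
        u4_def[symmetric] u5_def[symmetric] u6_def[symmetric] u7_def[symmetric])
  moreover have "u7 j = (if j \<le> m + 1 then bar n (j + 1) else j + 1)" if "j \<in> {1..k}" for j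
    using that U7(2) U7(4)[of j] U7(5)[of j] by (cases "j = m + 1") auto
  ultimately show ?thesis using U7 by (simp add: hecke_state_def)
qed

text \<open>Once \<open>m \<ge> k\<close>, the forced swap at \<open>k\<close> is undone on the way back and the first \<open>k + 1\<close> values
  no longer change.\<close>

lemma hecke_O1_state_full:
  assumes st: "hecke_state n k m w" and km: "k \<le> m" and k: "1 \<le> k" "k \<le> n"
  shows "hecke_state n k m (hecke_O1 n k w)"
proof -
  let ?f = "foldl (hecke n k)"
  have W: "w \<in> Weyl n" and w1: "\<And>j. 1 \<le> j \<Longrightarrow> j \<le> k \<Longrightarrow> w j = bar n (j + 1)" and w2: "w (k + 1) = 1"
    using st km by (auto simp: hecke_state_def)
  have word: "[1..<n + 2] @ rev [1..<n + 1] =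
      [1..<k] @ [k] @ ([k + 1..<n + 2] @ rev [k + 1..<n + 1]) @ [k] @ rev [1..<k]"
  proof -
    have "[1..<n + 1] = [1..<k] @ [k] @ [k + 1..<n + 1]" "[1..<n + 2] = [1..<k] @ [k] @ [k + 1..<n + 2]"
      using k upt_split[of 1 k "n + 1"] upt_split[of k "k + 1" "n + 1"]
        upt_split[of 1 k "n + 2"] upt_split[of k "k + 1" "n + 2"] by simp_all
    then show ?thesis by simp
  qed
  have desc: "?f v is = v"
    if v: "v \<in> Weyl n" "\<And>j. 1 \<le> j \<Longrightarrow> j \<le> k \<Longrightarrow> v j = bar n (j + 1)" and "is": "set is \<subseteq> {1..<k}" for v "is"
  proof (rule foldl_hecke_unchanged[OF v(1)])
    fix i assume i: "i \<in> set is"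
    then have r: "1 \<le> i" "i < k" using "is" by auto
    then have "v (i + 1) < v i" using v(2)[of i] v(2)[of "i + 1"] k by (simp add: bar_def)
    then show "1 \<le> i \<and> i \<le> n + 1 \<and> i \<noteq> k \<and> v (i + 1) < v i" using r k by auto
  qed
  \<comment> \<open>The situation between the two letters \<open>k\<close>: the value
    \<open>1\<close> is at position \<open>k\<close>, and the value to be restored waits at position
    \<open>k + 1\<close>.\<close>
  define mid where "mid v \<longleftrightarrow> v \<in> Weyl n \<and> (\<forall>j. 1 \<le> j \<and> j < k \<longrightarrow> v j = bar n (j + 1)) \<and> v k = 1 \<and>
    v (k + 1) = bar n (k + 1)" for v
  have midI: "mid (hecke n k v i)" if v: "mid v" and i: "i \<in> {k + 1..n + 1}" for v i
  proof -
    have V: "v \<in> Weyl n" and v1: "\<And>j. 1 \<le> j \<Longrightarrow> j < k \<Longrightarrow> v j = bar n (j + 1)" and v2: "v k = 1"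
      "v (k + 1) = bar n (k + 1)" using v by (auto simp: mid_def)
    have i1: "1 \<le> i" "i \<le> n + 1" using i by auto
    show ?thesis
    proof (cases "i = k + 1")
      case True
      have r: "v (k + 2) \<in> {1..2 * n + 2}" using Weyl_range[OF V, of "k + 2"] k by auto
      \<comment> \<open>All values from \<open>bar n (k + 1)\<close> upward are taken:
        \<open>bar n 1\<close> sits at position \<open>bar n k\<close>, as \<open>v k = 1\<close>,
        and the others sit at positions up to \<open>k + 1\<close>. Hence the letter
        \<open>k + 1\<close> cannot move the waiting value.\<close>
      have "v (k + 2) < v (k + 1)"
      proof (rule ccontr)
        assume "\<not> v (k + 2) < v (k + 1)"
        then have ge: "bar n (k + 1) \<le> v (k + 2)" using v2 by simp
        define l where "l = bar n (v (k + 2))"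
        have l: "1 \<le> l" "l \<le> k + 1" "v (k + 2) = bar n l" using ge r k by (auto simp: l_def bar_def)
        consider "l = 1" | "2 \<le> l" "l \<le> k" | "l = k + 1" using l by linarith
        then show False
        proof cases
          case 1
          then have "v (k + 2) = v (bar n k)" using l(3) Weyl_bar[OF V, of k] v2 k by simp
          then have "k + 2 = bar n k" using Weyl_inj[OF V] by blast
          then show False using k by (auto simp: bar_def)
        next
          case 2
          then have "v (k + 2) = v (l - 1)" using v1[of "l - 1"] l(3) by simp
          then have "k + 2 = l - 1" using Weyl_inj[OF V] by blast
          then show False using 2 by simp
        next
          case 3
          then have "v (k + 2) = v (k + 1)" using l(3) v2 by simp
          then show False using Weyl_inj[OF V, of "k + 2" "k + 1"] by simp
        qed
      qed
      then have "hecke n k v i = v" using True by (intro hecke_unchanged[OF V i1]) auto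
      then show ?thesis using v by simp
    next
      case False
      have "hecke n k v i j = v j" if "j \<le> k + 1" for j
      proof -
        have "simple_refl n i j = j"
          by (rule simple_refl_values(5)[OF i1]) (use that False i k in \<open>auto simp: bar_def\<close>)
        then show ?thesis by (simp add: hecke_eq[OF V i1])
      qed
      then show ?thesis using v hecke_Weyl[OF V i1] by (simp add: mid_def)
    qed
  qed
  have mid_list: "mid (?f v is)" if "mid v" "set is \<subseteq> {k + 1..n + 1}" for v "is"
    using that
  proof (induction "is" arbitrary: v)
    case (Cons i "is")
    then have "mid (hecke n k v i)" by (intro midI) auto
    then show ?case using Cons by simp
  qed simp
  have swap: "hecke n k v k j = (if j = k then v (k + 1) else if j = k + 1 then v k else v j)"
    "hecke n k v k \<in> Weyl n" if "v \<in> Weyl n" "j \<le> n + 1" for v j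
    using hecke_swap[OF that(1) k _ that(2), of k] hecke_Weyl[OF that(1) k(1), of k] k by simp_all
  have "mid (hecke n k w k)" using swap[OF W] w1 w2 k by (auto simp: mid_def)
  then have m: "mid (?f (hecke n k w k) ([k + 1..<n + 2] @ rev [k + 1..<n + 1]))"
    by (rule mid_list) auto
  define u where "u = ?f (hecke n k w k) ([k + 1..<n + 2] @ rev [k + 1..<n + 1])"
  have U: "u \<in> Weyl n" "\<And>j. 1 \<le> j \<Longrightarrow> j < k \<Longrightarrow> u j = bar n (j + 1)" "u k = 1" "u (k + 1) = bar n (k + 1)"
    using m by (auto simp: u_def mid_def)
  define v where "v = hecke n k u k"
  have V: "v \<in> Weyl n" "v (k + 1) = 1" "\<And>j. 1 \<le> j \<Longrightarrow> j \<le> k \<Longrightarrow> v j = bar n (j + 1)"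
    using swap[OF U(1)] U k by (auto simp: v_def)
  have "hecke_O1 n k w = v"
  proof -
    have "?f w [1..<k] = w" by (rule desc[OF W w1]) auto
    moreover have "?f v (rev [1..<k]) = v" by (rule desc[OF V(1,3)]) auto
    ultimately show ?thesis
      unfolding hecke_O1_def word
      by (simp only: foldl_append foldl.simps u_def[unfolded foldl_append, symmetric] v_def[symmetric])
  qed
  then show ?thesis using V km by (simp add: hecke_state_def)
qed

lemma hecke_O_state:
  assumes "hecke_state n k 0 w" "1 \<le> k" "k \<le> n"
  shows "hecke_state n k (min d k) (hecke_O n k d w)"
proof (induction d)
  case 0
  then show ?case using assms(1) by (simp add: hecke_O_def)
next
  case (Suc d)
  have eq: "hecke_O n k (Suc d) w = hecke_O1 n k (hecke_O n k d w)" by (simp add: hecke_O_def)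
  show ?case
  proof (cases "d < k")
    case True
    then show ?thesis
      using hecke_O1_state_less[of n k d "hecke_O n k d w"] Suc assms unfolding eq by simp
  next
    case False
    then show ?thesis
      using hecke_O1_state_full[of n k k "hecke_O n k d w"] Suc assms unfolding eq by simp
  qed
qed

lemma hecke_state_image:
  assumes "hecke_state n k m w" "m \<le> k" "k \<le> n"
  shows "w ` {1..k} = schubert_index n k m"
proof -
  have "{1..k} = {1..m} \<union> {m + 1..k}" using assms(2) by auto
  then have "w ` {1..k} = w ` {1..m} \<union> w ` {m + 1..k}" by (simp only: image_Un)
  also have "w ` {1..m} = (\<lambda>j. bar n (j + 1)) ` {1..m}"
    by (rule image_cong) (use assms in \<open>auto simp: hecke_state_def\<close>)
  also have "\<dots> = {2 * n + 2 - m..2 * n + 1}"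
  proof (intro equalityI subsetI)
    fix j assume j: "j \<in> {2 * n + 2 - m..2 * n + 1}"
    then have "j = bar n ((2 * n + 2 - j) + 1)" "2 * n + 2 - j \<in> {1..m}"
      using assms by (auto simp: bar_def)
    then show "j \<in> (\<lambda>j. bar n (j + 1)) ` {1..m}" by blast
  qed (use assms in \<open>auto simp: bar_def\<close>)
  also have "w ` {m + 1..k} = (\<lambda>j. j + 1) ` {m + 1..k}"
    by (rule image_cong) (use assms in \<open>auto simp: hecke_state_def\<close>)
  also have "\<dots> = {m + 2..k + 1}" by (simp add: image_add_atLeastAtMost')
  finally show ?thesis by (simp add: schubert_index_def Un_commute)
qed

theorem proposition4p6:
  fixes n k d :: nat and id_Y :: "nat \<Rightarrow> nat"
  assumes "1 \<le> k" and "k \<le> n" and "1 \<le> d"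
    and "is_id_Y n k id_Y"
  shows "curve_nbhd n k d (schubert_variety n k id_Y) =
         schubert_variety n k (hecke_O n k d id_Y)"
proof -
  have variety: "schubert_variety n k w = flag_locus n k m" if "hecke_state n k m w" "m \<le> k" for w m
  proof -
    interpret schubert n k m by unfold_locales (use that assms in auto)
    show ?thesis by (rule schubert_variety_eq[OF hecke_state_image[OF that assms(2)]])
  qed
  have st: "hecke_state n k 0 id_Y" by (rule hecke_state_id_Y[OF assms(4,2)])
  have "curve_nbhd n k d (flag_locus n k 0) = flag_locus n k d"
    using flag_locus_subset_curve_nbhd[OF assms(1-3)] stable_map_flag_locus[OF _ assms(2)]
    by (auto simp: curve_nbhd_def)
  \<comment> \<open>For \<open>d \<ge> k\<close> both sides are all of
    \<open>IG n k\<close>.\<close>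
  also have "\<dots> = flag_locus n k (min d k)" by (auto simp: flag_locus_def)
  finally show ?thesis
    using variety[OF st] variety[OF hecke_O_state[OF st assms(1,2), of d]] by simp
qed

end
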